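(* For a finite Galois extension $L/K$ of number fields, we have \begin{equation*} \mathrm{Ost}(L/K) \subseteq \frac{\mathrm{Po}(L/K)}{\mathrm{Po}(L/K)_{nr}}. \end{equation*}
   Context: $\mathrm{Cl}(\cdot)$ is the ideal class group and $\epsilon_{L/K}:\mathrm{Cl}(K)\to\mathrm{Cl}(L)$ is induced by $\mathfrak{a}\mapsto\mathfrak{a}\mathcal{O}_L$. The relative Ostrowski ideal $\Pi_{\mathfrak{P}^f}(L/K)$ is the product of all maximal ideals $\mathfrak{M}$ of $\mathcal{O}_L$ with $N_{L/K}(\mathfrak{M})=\mathfrak{P}^f$; $\mathrm{Po}(L/K)$ is the subgroup of $\mathrm{Cl}(L)$ generated by their classes, and $\mathrm{Po}(L/K)_{nr}$ is the subgroup generated by those with $\mathfrak{P}$ unramified in $L$. The Ostrowski quotient is $\mathrm{Ost}(L/K)=\mathrm{Po}(L/K)/(\mathrm{Po}(L/K)\cap\epsilon_{L/K}(\mathrm{Cl}(K)))$. *)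

theory Defs
  imports
    "HOL-Algebra.Finite_Extensions"
    "HOL-Algebra.Generated_Fields"
    "HOL-Algebra.Ideal_Product"
    "HOL-Algebra.QuotRing"
begin

text \<open>
  Fields are HOL-Algebra structures. In an extension \<open>L/K\<close> the base field is a subset \<open>K\<close> of
  \<open>carrier L\<close> with \<open>subfield K L\<close>; as a field in its own right it is \<open>L\<lparr>carrier := K\<rparr>\<close>.
\<close>

definition number_field :: "('a, 'b) ring_scheme \<Rightarrow> bool" where
  "number_field L \<longleftrightarrow>
     field L \<and>
     inj (\<lambda>n::int. [n] \<cdot>\<^bsub>L\<^esub> \<one>\<^bsub>L\<^esub>) \<and>
     ring.finite_dimension L (generate_field L {}) (carrier L)"

definition finite_galois_extension :: "('a, 'b) ring_scheme \<Rightarrow> 'a set \<Rightarrow> bool" where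
  "finite_galois_extension L K \<longleftrightarrow>
     ring.finite_dimension L K (carrier L) \<and>
     {x \<in> carrier L. \<forall>\<sigma> \<in> ring_iso L L. (\<forall>k\<in>K. \<sigma> k = k) \<longrightarrow> \<sigma> x = x} = K"

definition integral_over_int :: "('a, 'b) ring_scheme \<Rightarrow> 'a \<Rightarrow> bool" where
  "integral_over_int L x \<longleftrightarrow>
     (\<exists>p. polynomial\<^bsub>L\<^esub> (range (\<lambda>n::int. [n] \<cdot>\<^bsub>L\<^esub> \<one>\<^bsub>L\<^esub>)) p \<and>
          p \<noteq> [] \<and> lead_coeff p = \<one>\<^bsub>L\<^esub> \<and> ring.eval L p x = \<zero>\<^bsub>L\<^esub>)"

definition ring_of_integers :: "('a, 'b) ring_scheme \<Rightarrow> ('a, 'b) ring_scheme" where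
  "ring_of_integers L = L\<lparr>carrier := {x \<in> carrier L. integral_over_int L x}\<rparr>"

abbreviation integers :: "('a, 'b) ring_scheme \<Rightarrow> 'a set" where
  "integers L \<equiv> carrier (ring_of_integers L)"

definition fractional_ideal :: "('a, 'b) ring_scheme \<Rightarrow> 'a set \<Rightarrow> bool" where
  "fractional_ideal L I \<longleftrightarrow>
     additive_subgroup I L \<and>
     (\<forall>a \<in> integers L. \<forall>x \<in> I. a \<otimes>\<^bsub>L\<^esub> x \<in> I) \<and>
     I \<noteq> {\<zero>\<^bsub>L\<^esub>} \<and>
     (\<exists>d \<in> integers L. d \<noteq> \<zero>\<^bsub>L\<^esub> \<and> (\<forall>x \<in> I. d \<otimes>\<^bsub>L\<^esub> x \<in> integers L))"

text \<open>
  \<^const>\<open>ideal_prod\<close> \<open>L I J\<close> is the set of nonempty finite sums of products \<open>i \<otimes> j\<close>; its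
  definition does not refer to the carrier, so it serves for fractional ideals, and for integral
  ideals it is the product of ideals of the ring of integers.
\<close>

definition fractional_ideals :: "('a, 'b) ring_scheme \<Rightarrow> 'a set monoid" where
  "fractional_ideals L =
     \<lparr>carrier = {I. fractional_ideal L I}, mult = ideal_prod L, one = integers L\<rparr>"

definition principal_fractional_ideals :: "('a, 'b) ring_scheme \<Rightarrow> 'a set set" where
  "principal_fractional_ideals L =
     {(\<lambda>a. a \<otimes>\<^bsub>L\<^esub> x) ` integers L | x. x \<in> carrier L \<and> x \<noteq> \<zero>\<^bsub>L\<^esub>}"

definition class_group :: "('a, 'b) ring_scheme \<Rightarrow> 'a set set monoid" where
  "class_group L = fractional_ideals L Mod principal_fractional_ideals L"

definition ideal_class :: "('a, 'b) ring_scheme \<Rightarrow> 'a set \<Rightarrow> 'a set set" where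
  "ideal_class L I = principal_fractional_ideals L #>\<^bsub>fractional_ideals L\<^esub> I"

definition extend_ideal :: "('a, 'b) ring_scheme \<Rightarrow> 'a set \<Rightarrow> 'a set" where
  "extend_ideal L I = ideal_prod L I (integers L)"

text \<open>
  The map on classes induced by extension of ideals: the image of the class \<open>c\<close> under
  \<open>I \<mapsto> [I \<O>\<^sub>L]\<close> is a singleton.
\<close>

definition class_extension :: "('a, 'b) ring_scheme \<Rightarrow> 'a set set \<Rightarrow> 'a set set" where
  "class_extension L c = the_elem ((\<lambda>I. ideal_class L (extend_ideal L I)) ` c)"

text \<open>
  For a maximal ideal \<open>M\<close> of the ring of integers of \<open>L\<close>, the prime below it, the residue degree
  (the residue field of the prime below is identified with its image in the residue field of
  \<open>M\<close>), and the norm \<open>N(M) = (M \<inter> \<O>\<^sub>K)\<^sup>f\<close>.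
\<close>

definition prime_below :: "('a, 'b) ring_scheme \<Rightarrow> 'a set \<Rightarrow> 'a set \<Rightarrow> 'a set" where
  "prime_below L K M = M \<inter> integers (L\<lparr>carrier := K\<rparr>)"

definition residue_degree :: "('a, 'b) ring_scheme \<Rightarrow> 'a set \<Rightarrow> 'a set \<Rightarrow> nat" where
  "residue_degree L K M =
     ring.dim (ring_of_integers L Quot M)
       ((\<lambda>x. M +>\<^bsub>ring_of_integers L\<^esub> x) ` integers (L\<lparr>carrier := K\<rparr>))
       (carrier (ring_of_integers L Quot M))"

definition relative_norm :: "('a, 'b) ring_scheme \<Rightarrow> 'a set \<Rightarrow> 'a set \<Rightarrow> 'a set" where
  "relative_norm L K M =
     prime_below L K M [^]\<^bsub>fractional_ideals (L\<lparr>carrier := K\<rparr>)\<^esub> residue_degree L K M"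

text \<open>The exponent of \<open>M\<close> in the factorisation of \<open>P \<O>\<^sub>L\<close>.\<close>

definition ramification_index :: "('a, 'b) ring_scheme \<Rightarrow> 'a set \<Rightarrow> 'a set \<Rightarrow> nat" where
  "ramification_index L P M =
     (GREATEST e. \<exists>J. ideal J (ring_of_integers L) \<and>
        extend_ideal L P = ideal_prod L (M [^]\<^bsub>fractional_ideals L\<^esub> e) J)"

text \<open>Residue fields are finite, so no separability condition is needed.\<close>

definition unramified :: "('a, 'b) ring_scheme \<Rightarrow> 'a set \<Rightarrow> 'a set \<Rightarrow> bool" where
  "unramified L K P \<longleftrightarrow>
     (\<forall>M. maximalideal M (ring_of_integers L) \<and> prime_below L K M = P \<longrightarrow>
        ramification_index L P M = 1)"

text \<open>The empty product is \<open>\<O>\<^sub>L\<close>.\<close>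

definition ostrowski_ideal ::
    "('a, 'b) ring_scheme \<Rightarrow> 'a set \<Rightarrow> 'a set \<Rightarrow> nat \<Rightarrow> 'a set" where
  "ostrowski_ideal L K P f =
     finprod (fractional_ideals L) (\<lambda>M. M)
       {M. maximalideal M (ring_of_integers L) \<and>
           relative_norm L K M = P [^]\<^bsub>fractional_ideals (L\<lparr>carrier := K\<rparr>)\<^esub> f}"

definition relative_Polya_group :: "('a, 'b) ring_scheme \<Rightarrow> 'a set \<Rightarrow> 'a set set set" where
  "relative_Polya_group L K =
     generate (class_group L)
       {ideal_class L (ostrowski_ideal L K P f) | P f.
          maximalideal P (ring_of_integers (L\<lparr>carrier := K\<rparr>)) \<and> f \<ge> 1}"

definition relative_Polya_group_nr :: "('a, 'b) ring_scheme \<Rightarrow> 'a set \<Rightarrow> 'a set set set" where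
  "relative_Polya_group_nr L K =
     generate (class_group L)
       {ideal_class L (ostrowski_ideal L K P f) | P f.
          maximalideal P (ring_of_integers (L\<lparr>carrier := K\<rparr>)) \<and> f \<ge> 1 \<and> unramified L K P}"

definition Ostrowski_quotient :: "('a, 'b) ring_scheme \<Rightarrow> 'a set \<Rightarrow> 'a set set set monoid" where
  "Ostrowski_quotient L K =
     (class_group L)\<lparr>carrier := relative_Polya_group L K\<rparr> Mod
       (relative_Polya_group L K \<inter>
        class_extension L ` carrier (class_group (L\<lparr>carrier := K\<rparr>)))"

end

theory Submission
  imports
    Defs
    "HOL-Computational_Algebra.Primes"
    "HOL-Algebra.Polynomial_Divisibility"
begin

text \<open>
  In fact \<open>\<epsilon>(Cl(K)) = Po(L/K)\<^sub>n\<^sub>r\<close>, so that the two quotients coincide. If \<open>P\<close> is unramified, the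
  primes above it are conjugate and hence share one residue degree, so each \<open>\<Pi>\<close> attached to \<open>P\<close> is
  \<open>\<O>\<^sub>L\<close> or \<open>P\<O>\<^sub>L\<close>, and \<open>P\<O>\<^sub>L\<close> does occur. Conversely only finitely many primes ramify,
  and every class of \<open>K\<close> contains an integral ideal prime to these.

  The ideal theory rests on two facts about the ring of integers \<open>R\<close> of a number field: \<open>R/aR\<close> is
  finite for \<open>a \<noteq> 0\<close>, and \<open>x \<in> R\<close> as soon as \<open>a x\<^sup>k \<in> R\<close> for all \<open>k\<close>. The first holds since more
  than \<open>[F:\<rat>]\<close> integers satisfy a relation over \<open>\<int>\<close> that is nontrivial modulo \<open>p\<close>; the second
  follows from it, as then \<open>x\<^sup>j - x\<^sup>i \<in> R\<close> for some \<open>i < j\<close>.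
\<close>

section \<open>Dedekind rings inside a field\<close>

text \<open>The two facts stand in for the usual axioms of a Dedekind ring. Finite quotients leave
  only finitely many ideals above a nonzero one, and this count drives the inductions on ideals.
  They also make two members of any sequence agree modulo \<open>a\<close>
  (\<open>pigeonhole_mod\<close>); applied to powers, this shows that nonzero primes are maximal and
  that some \<open>x\<close> outside \<open>R\<close> multiplies a given maximal ideal into
  \<open>R\<close>. The second fact then keeps \<open>I\<close> times its inverse from being
  \<open>I\<close> again, which gives invertibility.

  The hard point is that only finitely many primes ramify. Instead of a discriminant, one nonzero
  integer \<open>d\<close> is built from the Galois group: for every \<open>P\<close> it multiplies
  the elements common to all primes above \<open>P\<close> into \<open>P\<O>\<^sub>L\<close>. Hence
  it lies in every \<open>M\<close> above \<open>P\<close> such that \<open>M\<^sup>2\<close>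
  contains \<open>P\<O>\<^sub>L\<close>, and only finitely many ideals contain \<open>d\<close>.

  Conjugacy of the primes above \<open>P\<close> comes from a norm argument. Equality of their
  residue degrees is then a matter of counting: an automorphism preserves the cardinalities of the
  residue fields, and these determine the degree.\<close>

lemma (in cring) pigeonhole_mod:
  assumes H: "subring H R" and a: "a \<in> H"
    and quot: "\<exists>S. finite S \<and> S \<subseteq> H \<and> (\<forall>x\<in>H. \<exists>s\<in>S. \<exists>r\<in>H. x = s \<oplus> a \<otimes> r)"
    and u: "\<And>k::nat. u k \<in> H"
  shows "\<exists>i j. i < j \<and> (\<exists>t\<in>H. u i \<ominus> u j = a \<otimes> t)"
proof -
  note Hc = subsetD[OF subringE(1)[OF H]]
  obtain S where S: "finite S" "S \<subseteq> H" "\<forall>x\<in>H. \<exists>s\<in>S. \<exists>r\<in>H. x = s \<oplus> a \<otimes> r"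
    using quot by (elim exE conjE) simp
  have "\<forall>k. \<exists>s. s \<in> S \<and> (\<exists>t\<in>H. u k = s \<oplus> a \<otimes> t)" using S(3) u by blast
  then obtain g where g: "\<And>k. g k \<in> S \<and> (\<exists>t\<in>H. u k = g k \<oplus> a \<otimes> t)" by metis
  have "finite (range g)" by (rule finite_subset[OF _ S(1)]) (use g in blast)
  then have "\<not> inj g" using finite_imageD[of g UNIV] by auto
  then obtain i j where ij: "i < j" "g i = g j" unfolding inj_def by (metis linorder_neqE_nat)
  obtain t t' where t: "t \<in> H" "t' \<in> H" "u i = g i \<oplus> a \<otimes> t" "u j = g i \<oplus> a \<otimes> t'"
    using g ij(2) by metis
  have c: "t \<in> carrier R" "t' \<in> carrier R" "g i \<in> carrier R" "a \<in> carrier R"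
    using t a g S(2) Hc by blast+
  have "u i \<ominus> u j = a \<otimes> (t \<ominus> t')" unfolding t(3,4) using c by algebra
  moreover have "t \<ominus> t' \<in> H" unfolding a_minus_def using t subringE(5,7)[OF H] by blast
  ultimately show ?thesis using ij(1) by blast
qed

text \<open>A Dedekind domain with finite residue rings, given inside its fraction field.
  \<open>R_finite_quotient\<close> supplies the chain condition and dimension one,
  \<open>R_closed\<close> is complete integral closedness, and \<open>R_not_field\<close> keeps the
  zero ideal from being maximal. It is instantiated twice, for the integers of \<open>L\<close> and
  for those of \<open>K\<close>.\<close>

locale dedekind_subring = field F for F (structure) +
  fixes R :: "'a set"
  assumes R_subring: "subring R F"
    and R_fractions: "x \<in> carrier F \<Longrightarrow> \<exists>d\<in>R. d \<noteq> \<zero> \<and> d \<otimes> x \<in> R"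
    and R_finite_quotient:
      "\<lbrakk>a \<in> R; a \<noteq> \<zero>\<rbrakk> \<Longrightarrow> \<exists>S. finite S \<and> S \<subseteq> R \<and> (\<forall>x\<in>R. \<exists>s\<in>S. \<exists>r\<in>R. x = s \<oplus> a \<otimes> r)"
    and R_closed: "\<lbrakk>x \<in> carrier F; a \<in> R; a \<noteq> \<zero>; \<And>k::nat. a \<otimes> x [^] k \<in> R\<rbrakk> \<Longrightarrow> x \<in> R"
    and R_not_field: "\<exists>a\<in>R. a \<noteq> \<zero> \<and> inv a \<notin> R"
begin

lemma R_carrier: "x \<in> R \<Longrightarrow> x \<in> carrier F"
  and R_zero: "\<zero> \<in> R" and R_one: "\<one> \<in> R"
  and R_minus: "x \<in> R \<Longrightarrow> \<ominus> x \<in> R"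
  and R_mult: "x \<in> R \<Longrightarrow> y \<in> R \<Longrightarrow> x \<otimes> y \<in> R"
  and R_add: "x \<in> R \<Longrightarrow> y \<in> R \<Longrightarrow> x \<oplus> y \<in> R"
  using subringE[OF R_subring] by auto

text \<open>Submodules of the whole field, so that integral ideals, fractional ideals and their
  products share one set of closure lemmas.\<close>

definition submod :: "'a set \<Rightarrow> bool" where
  "submod I \<longleftrightarrow> I \<subseteq> carrier F \<and> \<zero> \<in> I \<and> (\<forall>x\<in>I. \<forall>y\<in>I. x \<oplus> y \<in> I) \<and> (\<forall>a\<in>R. \<forall>x\<in>I. a \<otimes> x \<in> I)"

definition fracid :: "'a set \<Rightarrow> bool" where
  "fracid I \<longleftrightarrow> submod I \<and> I \<noteq> {\<zero>} \<and> (\<exists>d\<in>R. d \<noteq> \<zero> \<and> (\<forall>x\<in>I. d \<otimes> x \<in> R))"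

definition int_ideal :: "'a set \<Rightarrow> bool" where
  "int_ideal I \<longleftrightarrow> submod I \<and> I \<subseteq> R"

definition maxi :: "'a set \<Rightarrow> bool" where
  "maxi M \<longleftrightarrow> int_ideal M \<and> M \<noteq> R \<and> (\<forall>J. int_ideal J \<longrightarrow> M \<subseteq> J \<longrightarrow> J = M \<or> J = R)"

lemma submod_carrier: "submod I \<Longrightarrow> x \<in> I \<Longrightarrow> x \<in> carrier F"
  and submod_subset: "submod I \<Longrightarrow> I \<subseteq> carrier F"
  and submod_zero: "submod I \<Longrightarrow> \<zero> \<in> I"
  and submod_add: "submod I \<Longrightarrow> x \<in> I \<Longrightarrow> y \<in> I \<Longrightarrow> x \<oplus> y \<in> I"
  and submod_mult: "submod I \<Longrightarrow> a \<in> R \<Longrightarrow> x \<in> I \<Longrightarrow> a \<otimes> x \<in> I"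
  unfolding submod_def by auto

lemma submod_minus: "\<ominus> x \<in> I" if I: "submod I" and x: "x \<in> I"
proof -
  have "(\<ominus> \<one>) \<otimes> x \<in> I"
    using submod_mult[OF I R_minus[OF R_one] x] .
  then show ?thesis
    using submod_carrier[OF I x] by (simp add: l_minus)
qed

lemma submod_diff: "submod I \<Longrightarrow> x \<in> I \<Longrightarrow> y \<in> I \<Longrightarrow> x \<ominus> y \<in> I"
  by (simp add: a_minus_def submod_add submod_minus)

lemma submod_iff:
  "submod I \<longleftrightarrow> additive_subgroup I F \<and> (\<forall>a\<in>R. \<forall>x\<in>I. a \<otimes> x \<in> I)"
proof
  assume I: "submod I"
  have "subgroup I (add_monoid F)"
    using I submod_minus[OF I]
    by (auto simp: subgroup_def submod_def a_inv_def)
  then show "additive_subgroup I F \<and> (\<forall>a\<in>R. \<forall>x\<in>I. a \<otimes> x \<in> I)"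
    using I by (auto simp: submod_def additive_subgroupI)
next
  assume *: "additive_subgroup I F \<and> (\<forall>a\<in>R. \<forall>x\<in>I. a \<otimes> x \<in> I)"
  then interpret additive_subgroup I F by simp
  show "submod I"
    unfolding submod_def using * a_subset by auto
qed

lemma submod_R: "submod R"
  unfolding submod_def using R_carrier R_zero R_mult R_add by auto

lemma int_ideal_R: "int_ideal R"
  by (simp add: int_ideal_def submod_R)

lemma int_ideal_eq_R: "int_ideal I \<Longrightarrow> \<one> \<in> I \<Longrightarrow> I = R"
  using submod_mult[of I _ \<one>] R_carrier unfolding int_ideal_def by fastforce

lemma fracid_nonzero: "fracid I \<Longrightarrow> \<exists>x\<in>I. x \<noteq> \<zero>"
  using submod_zero unfolding fracid_def by blast

lemma fracid_submod: "fracid I \<Longrightarrow> submod I"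
  by (simp add: fracid_def)

lemma int_ideal_submod: "int_ideal I \<Longrightarrow> submod I"
  by (simp add: int_ideal_def)

lemma int_ideal_fracid: "int_ideal I \<Longrightarrow> I \<noteq> {\<zero>} \<Longrightarrow> fracid I"
  unfolding fracid_def int_ideal_def using R_one
  by (auto intro!: bexI[of _ \<one>] simp: R_carrier subset_iff)

lemma fracid_R: "fracid R"
  using int_ideal_fracid[OF int_ideal_R] R_one one_not_zero by blast

lemma submod_principal:
  assumes "x \<in> carrier F" shows "submod ((\<lambda>a. a \<otimes> x) ` R)"
proof -
  have "\<exists>c\<in>R. a \<otimes> x \<oplus> b \<otimes> x = c \<otimes> x" if "a \<in> R" "b \<in> R" for a b
    using that assms R_carrier R_add by (metis l_distr)
  moreover have "\<exists>c\<in>R. b \<otimes> (a \<otimes> x) = c \<otimes> x" if "a \<in> R" "b \<in> R" for a b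
    using that assms R_carrier R_mult by (metis m_assoc)
  moreover have "\<exists>c\<in>R. \<zero> = c \<otimes> x"
    using assms R_zero by (metis l_null)
  ultimately show ?thesis
    unfolding submod_def using assms R_carrier by (auto simp: image_iff)
qed

lemma principal_mem: "x \<in> carrier F \<Longrightarrow> x \<in> (\<lambda>a. a \<otimes> x) ` R"
  using R_one by (metis imageI l_one)

lemma fracid_principal:
  assumes "x \<in> carrier F" "x \<noteq> \<zero>" shows "fracid ((\<lambda>a. a \<otimes> x) ` R)"
proof -
  obtain d where d: "d \<in> R" "d \<noteq> \<zero>" "d \<otimes> x \<in> R"
    using R_fractions assms by blast
  have "d \<otimes> (a \<otimes> x) \<in> R" if "a \<in> R" for a
    using d that assms R_carrier R_mult by (metis m_lcomm)
  then show ?thesis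
    unfolding fracid_def using submod_principal[OF assms(1)] principal_mem[OF assms(1)] assms d
    by auto
qed

lemma int_ideal_principal: "x \<in> R \<Longrightarrow> int_ideal ((\<lambda>a. a \<otimes> x) ` R)"
  unfolding int_ideal_def using submod_principal R_carrier R_mult by auto

subsection \<open>Products\<close>

lemma prod_least:
  assumes "submod N" "\<And>i j. i \<in> I \<Longrightarrow> j \<in> J \<Longrightarrow> i \<otimes> j \<in> N"
  shows "I \<cdot> J \<subseteq> N"
proof
  fix x assume "x \<in> I \<cdot> J"
  then show "x \<in> N"
    by induct (use assms submod_add in auto)
qed

lemma prod_mono: "I \<subseteq> I' \<Longrightarrow> J \<subseteq> J' \<Longrightarrow> I \<cdot> J \<subseteq> I' \<cdot> J'"
proof
  fix x assume *: "I \<subseteq> I'" "J \<subseteq> J'" "x \<in> I \<cdot> J"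
  from *(3) show "x \<in> I' \<cdot> J'"
    by induct (use * in \<open>auto intro: ideal_prod.intros\<close>)
qed

lemma prod_carrier: "I \<subseteq> carrier F \<Longrightarrow> J \<subseteq> carrier F \<Longrightarrow> I \<cdot> J \<subseteq> carrier F"
proof
  fix x assume *: "I \<subseteq> carrier F" "J \<subseteq> carrier F" "x \<in> I \<cdot> J"
  from *(3) show "x \<in> carrier F"
    by induct (use * in auto)
qed

text \<open>The right factor may be any nonempty subset. An ideal of the smaller ring is not a
  module over the larger one, and this form is what makes its extension a module.\<close>

lemma submod_prod':
  assumes I: "submod I" and J: "J \<subseteq> carrier F" "J \<noteq> {}"
  shows "submod (I \<cdot> J)"
proof -
  note Ic = submod_subset[OF I]
  obtain j where "j \<in> J" using J by blast
  then have "\<zero> \<in> I \<cdot> J"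
    using ideal_prod.prod[OF submod_zero[OF I], of j J F] J by auto
  moreover have "a \<otimes> x \<in> I \<cdot> J" if a: "a \<in> R" and "x \<in> I \<cdot> J" for a x
    using that(2)
  proof induct
    case (prod i j)
    then have "a \<otimes> (i \<otimes> j) = (a \<otimes> i) \<otimes> j"
      using R_carrier[OF a] Ic J by (metis m_assoc subsetD)
    then show ?case
      using ideal_prod.prod[of "a \<otimes> i" I j J F] prod submod_mult[OF I a] by auto
  next
    case (sum x y)
    have "x \<in> carrier F" "y \<in> carrier F"
      using sum(1,3) prod_carrier[OF Ic J(1)] by auto
    then show ?case
      using sum R_carrier[OF a] by (simp add: r_distr ideal_prod.sum)
  qed
  ultimately show ?thesis
    unfolding submod_def using prod_carrier[OF Ic J(1)] by (auto intro: ideal_prod.sum)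
qed

lemma submod_prod: "submod I \<Longrightarrow> submod J \<Longrightarrow> submod (I \<cdot> J)"
  using submod_prod' submod_zero submod_subset by blast

lemma prod_comm_subset: "I \<subseteq> carrier F \<Longrightarrow> J \<subseteq> carrier F \<Longrightarrow> I \<cdot> J \<subseteq> J \<cdot> I"
proof
  fix x assume *: "I \<subseteq> carrier F" "J \<subseteq> carrier F" "x \<in> I \<cdot> J"
  from *(3) show "x \<in> J \<cdot> I"
  proof induct
    case (prod i j)
    then show ?case
      using ideal_prod.prod[of j J i I F] * by (metis m_comm subsetD)
  qed (auto intro: ideal_prod.sum)
qed

lemma prod_comm: "I \<subseteq> carrier F \<Longrightarrow> J \<subseteq> carrier F \<Longrightarrow> I \<cdot> J = J \<cdot> I"
  using prod_comm_subset by blast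

lemma prod_assoc_subset:
  assumes "I \<subseteq> carrier F" "J \<subseteq> carrier F" "N \<subseteq> carrier F"
  shows "(I \<cdot> J) \<cdot> N \<subseteq> I \<cdot> (J \<cdot> N)"
proof
  fix z assume "z \<in> (I \<cdot> J) \<cdot> N"
  then show "z \<in> I \<cdot> (J \<cdot> N)"
  proof induct
    case (prod x n)
    from prod(1) show "x \<otimes> n \<in> I \<cdot> (J \<cdot> N)"
    proof induct
      case (prod i j)
      have "i \<otimes> j \<otimes> n = i \<otimes> (j \<otimes> n)"
        using prod assms \<open>n \<in> N\<close> by (intro m_assoc) blast+
      then show ?case
        using prod \<open>n \<in> N\<close> by (auto intro!: ideal_prod.prod)
    next
      case (sum x y)
      have "x \<in> carrier F" "y \<in> carrier F" "n \<in> carrier F"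
        using sum(1,3) prod_carrier[OF assms(1,2)] \<open>n \<in> N\<close> assms(3) by auto
      then have "(x \<oplus> y) \<otimes> n = x \<otimes> n \<oplus> y \<otimes> n"
        by (simp add: l_distr)
      then show ?case
        using sum by (auto intro: ideal_prod.sum)
    qed
  qed (rule ideal_prod.sum)
qed

text \<open>Stated for subsets because extension of ideals multiplies modules over two different
  rings. The second inclusion is the first one read backwards through commutativity.\<close>

lemma prod_assoc':
  assumes sub: "I \<subseteq> carrier F" "J \<subseteq> carrier F" "N \<subseteq> carrier F"
  shows "(I \<cdot> J) \<cdot> N = I \<cdot> (J \<cdot> N)"
proof
  show "(I \<cdot> J) \<cdot> N \<subseteq> I \<cdot> (J \<cdot> N)"
    using prod_assoc_subset[OF sub] .
  have "I \<cdot> (J \<cdot> N) = (N \<cdot> J) \<cdot> I"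
    using prod_comm[OF sub(1) prod_carrier[OF sub(2,3)]] prod_comm[OF sub(2,3)] by simp
  also have "\<dots> \<subseteq> N \<cdot> (J \<cdot> I)"
    using prod_assoc_subset[OF sub(3,2,1)] .
  also have "\<dots> = (I \<cdot> J) \<cdot> N"
    using prod_comm[OF sub(3) prod_carrier[OF sub(2,1)]] prod_comm[OF sub(2,1)] by simp
  finally show "I \<cdot> (J \<cdot> N) \<subseteq> (I \<cdot> J) \<cdot> N" .
qed

lemma prod_assoc:
  "submod I \<Longrightarrow> submod J \<Longrightarrow> submod N \<Longrightarrow> (I \<cdot> J) \<cdot> N = I \<cdot> (J \<cdot> N)"
  by (intro prod_assoc' submod_subset)

lemma prod_R: "submod I \<Longrightarrow> R \<cdot> I = I"
proof
  assume I: "submod I"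
  show "R \<cdot> I \<subseteq> I"
    using I submod_mult by (intro prod_least) auto
  show "I \<subseteq> R \<cdot> I"
    using ideal_prod.prod[OF R_one, of _ I F] submod_carrier[OF I] by auto
qed

lemma prod_R_right: "submod I \<Longrightarrow> I \<cdot> R = I"
  using prod_R prod_comm submod_subset submod_R by metis

lemma prod_int: "int_ideal I \<Longrightarrow> int_ideal J \<Longrightarrow> int_ideal (I \<cdot> J)"
  unfolding int_ideal_def using submod_prod prod_mono[of I R J R] prod_R[OF submod_R] by auto

lemma prod_int_left: "int_ideal I \<Longrightarrow> submod J \<Longrightarrow> I \<cdot> J \<subseteq> J"
  unfolding int_ideal_def using prod_mono[of I R J J] prod_R[of J] by auto

lemma prod_nonzero:
  assumes "submod I" "submod J" "I \<noteq> {\<zero>}" "J \<noteq> {\<zero>}" shows "I \<cdot> J \<noteq> {\<zero>}"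
proof -
  obtain i j where ij: "i \<in> I" "j \<in> J" "i \<noteq> \<zero>" "j \<noteq> \<zero>"
    using assms(3,4) submod_zero[OF assms(1)] submod_zero[OF assms(2)] by blast
  then have "i \<otimes> j \<in> I \<cdot> J" "i \<otimes> j \<noteq> \<zero>"
    using integral[of i j] submod_carrier[OF assms(1)] submod_carrier[OF assms(2)]
    by (auto intro: ideal_prod.prod)
  then show ?thesis by blast
qed

lemma fracid_prod:
  assumes "fracid I" "fracid J" shows "fracid (I \<cdot> J)"
proof -
  obtain d e where d: "d \<in> R" "d \<noteq> \<zero>" "\<forall>x\<in>I. d \<otimes> x \<in> R" and e: "e \<in> R" "e \<noteq> \<zero>" "\<forall>x\<in>J. e \<otimes> x \<in> R"
    using assms unfolding fracid_def by blast
  note IJ = fracid_submod[OF assms(1)] fracid_submod[OF assms(2)]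
  have *: "d \<otimes> e \<in> R" "d \<otimes> e \<noteq> \<zero>"
    using d e R_mult R_carrier integral[of d e] by auto
  have "(d \<otimes> e) \<otimes> x \<in> R" if "x \<in> I \<cdot> J" for x
    using that
  proof induct
    case (prod i j)
    have "i \<in> carrier F" "j \<in> carrier F"
      using prod IJ submod_carrier by auto
    then have "(d \<otimes> e) \<otimes> (i \<otimes> j) = (d \<otimes> i) \<otimes> (e \<otimes> j)"
      using d e R_carrier by (simp add: m_ac)
    then show ?case
      using d e prod R_mult by auto
  next
    case (sum x y)
    have "x \<in> carrier F" "y \<in> carrier F"
      using sum submod_carrier[OF submod_prod[OF IJ]] by auto
    then have "(d \<otimes> e) \<otimes> (x \<oplus> y) = (d \<otimes> e) \<otimes> x \<oplus> (d \<otimes> e) \<otimes> y"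
      using * R_carrier by (simp add: r_distr)
    then show ?case using sum R_add by auto
  qed
  then show ?thesis
    using submod_prod[OF IJ] prod_nonzero[OF IJ] * assms unfolding fracid_def by blast
qed

subsection \<open>Maximal ideals\<close>

text \<open>An ideal containing \<open>a\<close> is a union of classes modulo \<open>a\<close>, so
  it is determined by which of the finitely many representatives in \<open>S\<close> it
  contains.\<close>

lemma finite_overideals:
  assumes "a \<in> R" "a \<noteq> \<zero>" shows "finite {I. int_ideal I \<and> a \<in> I}"
proof -
  obtain S where S: "finite S" "S \<subseteq> R" "\<forall>x\<in>R. \<exists>s\<in>S. \<exists>r\<in>R. x = s \<oplus> a \<otimes> r"
    using R_finite_quotient[OF assms] by blast
  have "I \<subseteq> J" if I: "int_ideal I" "a \<in> I" and J: "int_ideal J" "a \<in> J" and eq: "I \<inter> S = J \<inter> S" for I J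
  proof
    fix x assume x: "x \<in> I"
    then obtain s r where s: "s \<in> S" "r \<in> R" "x = s \<oplus> a \<otimes> r"
      using S I unfolding int_ideal_def by blast
    have c: "s \<in> carrier F" "a \<in> carrier F" "r \<in> carrier F"
      using s S assms R_carrier by auto
    have ra: "r \<otimes> a \<in> I" "r \<otimes> a \<in> J"
      using s I J submod_mult unfolding int_ideal_def by auto
    have "x \<ominus> r \<otimes> a \<in> I"
      using x ra I submod_diff unfolding int_ideal_def by auto
    moreover have "x \<ominus> r \<otimes> a = s"
      using s(3) c by algebra
    ultimately have "s \<in> J" using s eq by auto
    then have "s \<oplus> r \<otimes> a \<in> J"
      using ra J submod_add unfolding int_ideal_def by auto
    then show "x \<in> J"
      using s(3) c by (simp add: m_comm)
  qed
  then have "inj_on (\<lambda>I. I \<inter> S) {I. int_ideal I \<and> a \<in> I}"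
    by (intro inj_onI) blast
  moreover have "(\<lambda>I. I \<inter> S) ` {I. int_ideal I \<and> a \<in> I} \<subseteq> Pow S"
    by blast
  ultimately show ?thesis
    using finite_imageD finite_subset S(1) by (metis finite_Pow_iff)
qed

lemma finite_overideals':
  assumes "int_ideal I" "I \<noteq> {\<zero>}" shows "finite {J. int_ideal J \<and> I \<subseteq> J}"
proof -
  obtain a where "a \<in> I" "a \<noteq> \<zero>" "a \<in> R"
    using assms submod_zero unfolding int_ideal_def by blast
  then show ?thesis
    using finite_overideals[of a] by (auto elim!: rev_finite_subset)
qed

lemma maxi_int: "maxi M \<Longrightarrow> int_ideal M"
  and maxi_submod: "maxi M \<Longrightarrow> submod M"
  and maxi_subset: "maxi M \<Longrightarrow> M \<subseteq> R"
  and maxi_neq: "maxi M \<Longrightarrow> M \<noteq> R"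
  unfolding maxi_def int_ideal_def by auto

lemma maxi_eqI: "maxi M \<Longrightarrow> maxi N \<Longrightarrow> M \<subseteq> N \<Longrightarrow> M = N"
  unfolding maxi_def by auto

text \<open>If the zero ideal were maximal, each nonzero \<open>a\<close> in \<open>R\<close> would
  generate \<open>R\<close> and so have its inverse in \<open>R\<close>, against
  \<open>R_not_field\<close>.\<close>

lemma maxi_nonzero: "maxi M \<Longrightarrow> M \<noteq> {\<zero>}"
proof
  assume M: "maxi M" and 0: "M = {\<zero>}"
  obtain a where a: "a \<in> R" "a \<noteq> \<zero>" "inv a \<notin> R"
    using R_not_field by blast
  let ?J = "(\<lambda>b. b \<otimes> a) ` R"
  have "int_ideal ?J" "M \<subseteq> ?J" "a \<in> ?J"
    using int_ideal_principal[OF a(1)] 0 submod_zero principal_mem a R_carrier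
    unfolding int_ideal_def by auto
  then have "?J = R"
    using M a 0 unfolding maxi_def by auto
  then have "\<one> \<in> ?J"
    using R_one by (simp only:)
  then obtain b where "b \<in> R" "b \<otimes> a = \<one>"
    by (elim imageE) simp
  then show False
    using a R_carrier comm_inv_char[of a b] m_comm[of a b] by simp
qed

lemma maxi_fracid: "maxi M \<Longrightarrow> fracid M"
  using int_ideal_fracid maxi_int maxi_nonzero by blast

text \<open>The proper ideals above \<open>I\<close> form a finite nonempty set, which has a maximal
  member.\<close>

lemma maxi_exists:
  assumes "int_ideal I" "I \<noteq> {\<zero>}" "I \<noteq> R" shows "\<exists>M. maxi M \<and> I \<subseteq> M"
proof -
  let ?A = "{J. int_ideal J \<and> I \<subseteq> J \<and> J \<noteq> R}"
  have A: "finite ?A" "I \<in> ?A"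
    using finite_overideals'[OF assms(1,2)] assms by (auto elim!: rev_finite_subset)
  then obtain M where M: "M \<in> ?A" "I \<subseteq> M" "\<forall>J\<in>?A. M \<subseteq> J \<longrightarrow> M = J"
    using finite_has_maximal2[OF A] by (elim bexE conjE)
  then have "maxi M"
    unfolding maxi_def by auto
  then show ?thesis using M by blast
qed

text \<open>The sum of \<open>M\<close> and the multiples of \<open>x\<close> is an ideal strictly
  larger than \<open>M\<close>, hence all of \<open>R\<close>.\<close>

lemma maxi_comax:
  assumes "maxi M" "x \<in> R" "x \<notin> M" shows "\<exists>m\<in>M. \<exists>r\<in>R. \<one> = m \<oplus> r \<otimes> x"
proof -
  note M = maxi_submod[OF assms(1)]
  let ?J = "{m \<oplus> r \<otimes> x | m r. m \<in> M \<and> r \<in> R}"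
  note xc = R_carrier[OF assms(2)]
  have in_J: "m \<oplus> r \<otimes> x \<in> ?J" if "m \<in> M" "r \<in> R" for m r
    using that by blast
  have "submod ?J"
    unfolding submod_def
  proof (intro conjI ballI)
    show "?J \<subseteq> carrier F"
      using submod_carrier[OF M] R_carrier xc by auto
    show "\<zero> \<in> ?J"
      using in_J[OF submod_zero[OF M] R_zero] xc by simp
  next
    fix y z assume "y \<in> ?J" "z \<in> ?J"
    then obtain m r m' r' where *: "m \<in> M" "r \<in> R" "m' \<in> M" "r' \<in> R"
      and yz: "y = m \<oplus> r \<otimes> x" "z = m' \<oplus> r' \<otimes> x" by blast
    have "m \<in> carrier F" "r \<in> carrier F" "m' \<in> carrier F" "r' \<in> carrier F"
      using * submod_carrier[OF M] R_carrier by auto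
    then have "y \<oplus> z = (m \<oplus> m') \<oplus> (r \<oplus> r') \<otimes> x"
      using xc yz by algebra
    then show "y \<oplus> z \<in> ?J"
      using in_J[OF submod_add[OF M *(1,3)] R_add[OF *(2,4)]] by (simp only:)
  next
    fix a y assume a: "a \<in> R" and "y \<in> ?J"
    then obtain m r where *: "m \<in> M" "r \<in> R" and y: "y = m \<oplus> r \<otimes> x" by blast
    have "m \<in> carrier F" "r \<in> carrier F" "a \<in> carrier F"
      using * a submod_carrier[OF M] R_carrier by auto
    then have "a \<otimes> y = (a \<otimes> m) \<oplus> (a \<otimes> r) \<otimes> x"
      using xc y by algebra
    then show "a \<otimes> y \<in> ?J"
      using in_J[OF submod_mult[OF M a *(1)] R_mult[OF a *(2)]] by (simp only:)
  qed
  moreover have "?J \<subseteq> R"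
    using maxi_subset[OF assms(1)] assms(2) R_add R_mult by auto
  moreover have "m \<in> ?J" if "m \<in> M" for m
    using in_J[OF that R_zero] xc submod_carrier[OF M that] by simp
  moreover have "x \<in> ?J"
    using in_J[OF submod_zero[OF M] R_one] xc by simp
  ultimately have "?J = R"
    using assms(1,3) unfolding maxi_def int_ideal_def by blast
  then show ?thesis
    using R_one by blast
qed

lemma maxi_one: "maxi M \<Longrightarrow> \<one> \<notin> M"
  using int_ideal_eq_R maxi_int maxi_neq by blast

lemma maxi_prime:
  assumes M: "maxi M" and "x \<in> R" "y \<in> R" "x \<otimes> y \<in> M" shows "x \<in> M \<or> y \<in> M"
proof (subst disj_commute, rule disjCI)
  assume "x \<notin> M"
  then obtain m r where *: "m \<in> M" "r \<in> R" "\<one> = m \<oplus> r \<otimes> x"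
    using maxi_comax[OF M assms(2)] by blast
  have c: "m \<in> carrier F" "r \<in> carrier F" "x \<in> carrier F" "y \<in> carrier F"
    using * assms submod_carrier[OF maxi_submod[OF M]] R_carrier by auto
  have "y = \<one> \<otimes> y" using c by simp
  also have "\<dots> = y \<otimes> m \<oplus> r \<otimes> (x \<otimes> y)"
    unfolding *(3) using c by algebra
  also have "\<dots> \<in> M"
    using maxi_submod[OF M] assms * submod_add submod_mult by auto
  finally show "y \<in> M" .
qed

lemma maxi_prod_prime:
  assumes M: "maxi M" and "int_ideal I" "int_ideal J" "I \<cdot> J \<subseteq> M" shows "I \<subseteq> M \<or> J \<subseteq> M"
proof (subst disj_commute, rule disjCI)
  assume "\<not> I \<subseteq> M"
  then obtain i where i: "i \<in> I" "i \<notin> M" by blast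
  show "J \<subseteq> M"
  proof
    fix j assume j: "j \<in> J"
    have "i \<otimes> j \<in> M"
      using ideal_prod.prod[of i I j J F] i j assms by auto
    then show "j \<in> M"
      using maxi_prime[OF M] i j assms unfolding int_ideal_def by blast
  qed
qed

lemma R_finprod: "finite S \<Longrightarrow> (\<And>s. s \<in> S \<Longrightarrow> f s \<in> R) \<Longrightarrow> finprod F f S \<in> R"
proof (induct S rule: finite_induct)
  case empty
  then show ?case using R_one by simp
next
  case (insert x S)
  then show ?case
    using R_carrier R_mult by (auto simp: Pi_def)
qed

lemma maxi_finprod_notin:
  assumes M: "maxi M"
  shows "finite S \<Longrightarrow> (\<And>s. s \<in> S \<Longrightarrow> f s \<in> R - M) \<Longrightarrow> finprod F f S \<notin> M"
proof (induct S rule: finite_induct)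
  case empty
  then show ?case using maxi_one[OF M] by simp
next
  case (insert x S)
  have "finprod F f (insert x S) = f x \<otimes> finprod F f S"
    using insert R_carrier by (auto simp: Pi_def)
  moreover have "finprod F f S \<in> R"
    using insert R_finprod by auto
  ultimately show ?case
    using insert maxi_prime[OF M, of "f x" "finprod F f S"] by auto
qed

text \<open>For \<open>a \<in> M\<close>, an element \<open>b\<close> whose annihilator modulo \<open>a\<close> is maximal among the annihilators
  contained in \<open>M\<close> has, after multiplication by some \<open>s \<notin> M\<close>, annihilator \<open>M\<close>; then \<open>sb/a\<close> works.\<close>

lemma maxi_multiplier:
  assumes M: "maxi M"
  shows "\<exists>x\<in>carrier F. x \<notin> R \<and> (\<forall>m\<in>M. x \<otimes> m \<in> R)"
proof -
  note Ms = maxi_submod[OF M] and MR = maxi_subset[OF M]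
  obtain a where aM: "a \<in> M" and a0: "a \<noteq> \<zero>"
    using maxi_nonzero[OF M] submod_zero[OF Ms] by blast
  have aR: "a \<in> R" using aM MR by auto
  note ac = R_carrier[OF aR]
  define A where "A = (\<lambda>c. c \<otimes> a) ` R"
  have A: "submod A" and AR: "A \<subseteq> R" and aA: "a \<in> A"
    unfolding A_def using submod_principal[OF ac] R_mult[OF _ aR] principal_mem[OF ac] by auto
  \<comment> \<open>The annihilator of the class of \<open>b\<close> modulo \<open>A\<close>. It
    always contains \<open>a\<close>, so by \<open>finite_overideals\<close> only finitely many
    annihilators occur and a maximal one can be chosen.\<close>
  define ann where "ann b = {r \<in> R. r \<otimes> b \<in> A}" for b
  have ann_int: "int_ideal (ann b)" if b: "b \<in> R" for b
    unfolding int_ideal_def submod_def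
  proof (intro conjI ballI)
    show "ann b \<subseteq> carrier F" "ann b \<subseteq> R" unfolding ann_def using R_carrier by auto
    show "\<zero> \<in> ann b" unfolding ann_def using R_zero submod_zero[OF A] R_carrier[OF b] by simp
  next
    fix x y assume "x \<in> ann b" "y \<in> ann b"
    then show "x \<oplus> y \<in> ann b"
      unfolding ann_def using R_add submod_add[OF A] R_carrier b by (simp add: l_distr)
  next
    fix x y assume "x \<in> R" "y \<in> ann b"
    then show "x \<otimes> y \<in> ann b"
      unfolding ann_def using R_mult submod_mult[OF A] R_carrier b by (simp add: m_assoc)
  qed
  have ann_a: "a \<in> ann b" if "b \<in> R" for b
    unfolding ann_def using aR submod_mult[OF A that aA] that R_carrier ac by (simp add: m_comm)
  have ann_mono: "ann b \<subseteq> ann (r \<otimes> b)" if "r \<in> R" "b \<in> R" for r b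
  proof
    fix x assume "x \<in> ann b"
    then have x: "x \<in> R" "x \<otimes> b \<in> A" unfolding ann_def by auto
    have "x \<otimes> (r \<otimes> b) = r \<otimes> (x \<otimes> b)"
      using that x(1) R_carrier by (intro m_lcomm) auto
    then show "x \<in> ann (r \<otimes> b)"
      unfolding ann_def using x submod_mult[OF A that(1) x(2)] by simp
  qed
  let ?\<A> = "{ann b | b. b \<in> R \<and> ann b \<subseteq> M}"
  have fin: "finite ?\<A>"
    by (rule finite_subset[OF _ finite_overideals[OF aR a0]]) (use ann_int ann_a in auto)
  have "ann \<one> \<subseteq> M"
  proof
    fix r assume "r \<in> ann \<one>"
    then have "r \<in> A" unfolding ann_def using R_carrier by auto
    then show "r \<in> M" unfolding A_def using submod_mult[OF Ms] aM by auto
  qed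
  then have ne: "?\<A> \<noteq> {}" using R_one by blast
  obtain N where "N \<in> ?\<A>" and N: "\<forall>N'\<in>?\<A>. N \<subseteq> N' \<longrightarrow> N = N'"
    using finite_has_maximal[OF fin ne] by (elim bexE)
  then obtain b where b: "b \<in> R" "ann b \<subseteq> M" and Nb: "N = ann b"
    by blast
  have max: "ann b' = ann b" if "b' \<in> R" "ann b' \<subseteq> M" "ann b \<subseteq> ann b'" for b'
    using N that unfolding Nb by blast
  note bc = R_carrier[OF b(1)]
  \<comment> \<open>Otherwise \<open>ann (r \<otimes> b)\<close> lies in \<open>M\<close>, so by
    maximality it equals \<open>ann b\<close>, and then so does the annihilator of every
    \<open>r^k b\<close>. Two of these multiples agree modulo \<open>a\<close>, which puts some
    \<open>1 - r^(n+1)\<close> into \<open>ann b\<close> and hence into \<open>M\<close>; as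
    \<open>r\<close> is in \<open>M\<close>, so would be 1.\<close>
  have killer: "\<exists>s\<in>R. s \<notin> M \<and> s \<otimes> (r \<otimes> b) \<in> A" if r: "r \<in> M" for r
  proof (rule ccontr)
    assume "\<not> ?thesis"
    then have sub: "ann (r \<otimes> b) \<subseteq> M" unfolding ann_def by blast
    have rR: "r \<in> R" using r MR by auto
    note rc = R_carrier[OF rR]
    have rk: "r [^] (k::nat) \<in> R" for k
      by (induct k) (use R_one R_mult rR in auto)
    have eq: "ann (r [^] k \<otimes> b) = ann b" for k :: nat
    proof (induct k)
      case 0
      show ?case using bc by simp
    next
      case (Suc k)
      have 1: "ann (r \<otimes> b) = ann b"
        using max[OF R_mult[OF rR b(1)] sub ann_mono[OF rR b(1)]] .
      have "ann (r [^] Suc k \<otimes> b) = {s \<in> R. s \<otimes> r \<in> ann (r [^] k \<otimes> b)}"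
        unfolding ann_def using R_carrier rR rk bc R_mult rc by (auto simp: m_ac)
      also have "\<dots> = ann (r \<otimes> b)"
        unfolding Suc unfolding ann_def using R_carrier rR bc R_mult by (auto simp: m_assoc)
      finally show ?case using 1 by simp
    qed
    have "\<exists>i j::nat. i < j \<and> (\<exists>t\<in>R. r [^] i \<otimes> b \<ominus> r [^] j \<otimes> b = a \<otimes> t)"
      by (rule pigeonhole_mod[OF R_subring aR R_finite_quotient[OF aR a0]]) (rule R_mult[OF rk b(1)])
    then obtain i j :: nat and t where ij: "i < j" and t: "t \<in> R" "r [^] i \<otimes> b \<ominus> r [^] j \<otimes> b = a \<otimes> t"
      by blast
    obtain n where n: "j = Suc n + i"
      using ij by (metis less_iff_Suc_add add.commute add_Suc_right)
    define u v where "u = r [^] Suc n" and "v = r [^] i"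
    have uv: "u \<in> carrier F" "v \<in> carrier F" "u \<in> R"
      unfolding u_def v_def using rc rk by blast+
    have rj: "r [^] j = u \<otimes> v"
      unfolding u_def v_def n using nat_pow_mult[OF rc, of "Suc n" i] by (simp only:)
    have "(\<one> \<ominus> u) \<otimes> (v \<otimes> b) = v \<otimes> b \<ominus> (u \<otimes> v) \<otimes> b"
      using uv bc by algebra
    also have "\<dots> = t \<otimes> a"
      using t(2) R_carrier[OF t(1)] ac unfolding rj v_def[symmetric] by (simp add: m_comm)
    also have "\<dots> \<in> A"
      unfolding A_def using t(1) by blast
    finally have "\<one> \<ominus> u \<in> ann (r [^] i \<otimes> b)"
      unfolding ann_def v_def using submod_diff[OF submod_R R_one uv(3)] by blast
    then have 1: "\<one> \<ominus> u \<in> M"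
      using eq b(2) by blast
    have 2: "u \<in> M"
      unfolding u_def using submod_mult[OF Ms rk r] by simp
    have "(\<one> \<ominus> u) \<oplus> u = \<one>"
      using uv by algebra
    then show False
      using submod_add[OF Ms 1 2] maxi_one[OF M] by simp
  qed
  \<comment> \<open>The witness of \<open>killer\<close> depends on \<open>r\<close>. Since
    \<open>a\<close> times \<open>b\<close> already lies in \<open>A\<close>, only \<open>M\<close>
    modulo \<open>a\<close> matters, which has finitely many representatives. The product of their
    witnesses serves all of \<open>M\<close>, and it stays outside \<open>M\<close> because
    \<open>M\<close> is prime.\<close>
  obtain S where S: "finite S" "S \<subseteq> R" "\<forall>x\<in>R. \<exists>s\<in>S. \<exists>t\<in>R. x = s \<oplus> a \<otimes> t"
    using R_finite_quotient[OF aR a0] by blast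
  have "\<forall>r\<in>S \<inter> M. \<exists>s. s \<in> R - M \<and> s \<otimes> (r \<otimes> b) \<in> A"
    using killer by blast
  then obtain \<sigma> where \<sigma>: "\<And>r. r \<in> S \<inter> M \<Longrightarrow> \<sigma> r \<in> R - M" "\<And>r. r \<in> S \<inter> M \<Longrightarrow> \<sigma> r \<otimes> (r \<otimes> b) \<in> A"
    by metis
  define s where "s = finprod F \<sigma> (S \<inter> M)"
  have sR: "s \<in> R" and sM: "s \<notin> M"
    unfolding s_def using S(1) R_finprod[of "S \<inter> M" \<sigma>] maxi_finprod_notin[OF M, of "S \<inter> M" \<sigma>] \<sigma>(1)
    by auto
  note sc = R_carrier[OF sR]
  have kill: "s \<otimes> (m \<otimes> b) \<in> A" if m: "m \<in> M" for m
  proof -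
    obtain r t where rt: "r \<in> S" "t \<in> R" "m = r \<oplus> a \<otimes> t"
      using S(3) m MR by blast
    have c: "r \<in> carrier F" "t \<in> carrier F" "m \<in> carrier F"
      using rt S R_carrier m MR by auto
    have ta: "t \<otimes> a \<in> M" using submod_mult[OF Ms rt(2) aM] .
    have "m \<ominus> t \<otimes> a \<in> M"
      using submod_diff[OF Ms m ta] .
    moreover have "m \<ominus> t \<otimes> a = r"
      using rt(3) c ac by algebra
    ultimately have r: "r \<in> S \<inter> M" using rt(1) by simp
    define q where "q = finprod F \<sigma> (S \<inter> M - {r})"
    have qR: "q \<in> R"
      unfolding q_def using S(1) \<sigma>(1) by (intro R_finprod) auto
    have "s = \<sigma> r \<otimes> q"
    proof -
      have "s = finprod F \<sigma> (insert r (S \<inter> M - {r}))"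
        unfolding s_def using r by (simp add: insert_absorb)
      also have "\<dots> = \<sigma> r \<otimes> q"
        unfolding q_def using S(1) \<sigma>(1) R_carrier r by (intro finprod_insert) (auto simp: Pi_def)
      finally show ?thesis .
    qed
    have cc: "\<sigma> r \<in> carrier F" "q \<in> carrier F"
      using qR \<sigma>(1)[OF r] R_carrier by auto
    have "s \<otimes> (m \<otimes> b) = q \<otimes> (\<sigma> r \<otimes> (r \<otimes> b)) \<oplus> (s \<otimes> t \<otimes> b) \<otimes> a"
      unfolding \<open>s = \<sigma> r \<otimes> q\<close> rt(3) using cc c ac bc by algebra
    moreover have "q \<otimes> (\<sigma> r \<otimes> (r \<otimes> b)) \<in> A" "(s \<otimes> t \<otimes> b) \<otimes> a \<in> A"
      using submod_mult[OF A] qR \<sigma>(2)[OF r] aA R_mult sR rt(2) b(1) by auto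
    ultimately show ?thesis
      using submod_add[OF A] by simp
  qed
  have sb: "s \<otimes> b \<notin> A"
    using sM b(2) sR unfolding ann_def by blast
  let ?x = "s \<otimes> b \<otimes> inv a"
  have inva: "inv a \<in> carrier F" "inv a \<otimes> a = \<one>"
    using a0 ac field_Units by auto
  have "?x \<notin> R"
  proof
    assume "?x \<in> R"
    then have "?x \<otimes> a \<in> A" using submod_mult[OF A _ aA] by auto
    moreover have "?x \<otimes> a = s \<otimes> b"
      using inva sc bc ac by (simp add: m_assoc)
    ultimately show False using sb by simp
  qed
  moreover have "?x \<otimes> m \<in> R" if m: "m \<in> M" for m
  proof -
    obtain c where c: "c \<in> R" "s \<otimes> (m \<otimes> b) = c \<otimes> a"
      using kill[OF m] unfolding A_def by blast
    have mc: "m \<in> carrier F" using m MR R_carrier by auto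
    have "?x \<otimes> m = (s \<otimes> (m \<otimes> b)) \<otimes> inv a"
      using mc sc bc inva(1) by algebra
    also have "\<dots> = c \<otimes> (inv a \<otimes> a)"
      unfolding c(2) using inva(1) ac R_carrier[OF c(1)] by algebra
    finally show ?thesis
      using inva c R_carrier by simp
  qed
  moreover have "?x \<in> carrier F" using sc bc inva by simp
  ultimately show ?thesis by blast
qed

subsection \<open>The group of fractional ideals\<close>

text \<open>All \<open>x^k y\<close> stay in \<open>I\<close>, so a single denominator
  \<open>d\<close> of \<open>I\<close> controls every power: \<open>d y x^k\<close> lies in
  \<open>R\<close>. This plays the part of the determinant argument for finitely generated
  modules.\<close>

lemma multiplier_closed:
  assumes I: "fracid I" and x: "x \<in> carrier F" "\<And>y. y \<in> I \<Longrightarrow> x \<otimes> y \<in> I"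
  shows "x \<in> R"
proof -
  note Is = fracid_submod[OF I]
  obtain y where y: "y \<in> I" "y \<noteq> \<zero>" using fracid_nonzero[OF I] by blast
  obtain d where d: "d \<in> R" "d \<noteq> \<zero>" "\<forall>x\<in>I. d \<otimes> x \<in> R"
    using I unfolding fracid_def by blast
  note c = submod_carrier[OF Is y(1)] R_carrier[OF d(1)]
  have xy: "x [^] k \<otimes> y \<in> I" for k :: nat
  proof (induct k)
    case 0
    show ?case using y c by simp
  next
    case (Suc k)
    have "x [^] Suc k \<otimes> y = x \<otimes> (x [^] k \<otimes> y)"
      using x(1) c by (simp add: m_ac)
    then show ?case using x(2)[OF Suc] by simp
  qed
  show ?thesis
  proof (rule R_closed[OF x(1), of "d \<otimes> y"])
    show "d \<otimes> y \<in> R" using d y by blast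
    show "d \<otimes> y \<noteq> \<zero>" using integral[of d y] d y c by auto
    show "d \<otimes> y \<otimes> x [^] k \<in> R" for k :: nat
    proof -
      have "d \<otimes> y \<otimes> x [^] k = d \<otimes> (x [^] k \<otimes> y)"
        using c x(1) nat_pow_closed[OF x(1), of k] by algebra
      then show ?thesis using d(3) xy[of k] by simp
    qed
  qed
qed

definition inverse_ideal :: "'a set \<Rightarrow> 'a set" where
  "inverse_ideal I = {x \<in> carrier F. \<forall>y\<in>I. x \<otimes> y \<in> R}"

lemma inverse_ideal_fracid:
  assumes "int_ideal I" "I \<noteq> {\<zero>}" shows "fracid (inverse_ideal I)"
proof -
  have IR: "I \<subseteq> R" and Is: "submod I" using assms unfolding int_ideal_def by auto
  have Ic: "y \<in> carrier F" if "y \<in> I" for y using that IR R_carrier by auto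
  have "submod (inverse_ideal I)"
    unfolding submod_def inverse_ideal_def
    using Ic R_zero R_add R_mult R_carrier by (auto simp: l_distr m_assoc)
  moreover have "\<one> \<in> inverse_ideal I"
    unfolding inverse_ideal_def using Ic IR by auto
  moreover obtain y where "y \<in> I" "y \<noteq> \<zero>"
    using assms submod_zero[OF Is] by blast
  then have "y \<in> R \<and> y \<noteq> \<zero> \<and> (\<forall>x\<in>inverse_ideal I. y \<otimes> x \<in> R)"
    using IR Ic unfolding inverse_ideal_def by (auto simp: m_comm)
  ultimately show ?thesis
    unfolding fracid_def using one_not_zero by blast
qed

text \<open>Induction on the number of ideals above \<open>I\<close>. The product \<open>?J\<close>
  of \<open>I\<close> and \<open>inverse_ideal I\<close> lies between \<open>I\<close> and
  \<open>R\<close>. It is not \<open>I\<close>: the element \<open>x\<close> outside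
  \<open>R\<close> that multiplies a maximal ideal above \<open>I\<close> into \<open>R\<close> is
  in \<open>inverse_ideal I\<close>, and \<open>multiplier_closed\<close> would force it into
  \<open>R\<close>. So \<open>?J\<close> has fewer ideals above it, and an inverse of
  \<open>?J\<close> times \<open>inverse_ideal I\<close> inverts \<open>I\<close>.\<close>

lemma int_ideal_invertible:
  "int_ideal I \<Longrightarrow> I \<noteq> {\<zero>} \<Longrightarrow> \<exists>J. fracid J \<and> I \<cdot> J = R"
proof (induct "card {J. int_ideal J \<and> I \<subseteq> J}" arbitrary: I rule: less_induct)
  case less
  show ?case
  proof (cases "I = R")
    case True
    then show ?thesis using fracid_R prod_R[OF submod_R] by blast
  next
    case False
    obtain M where M: "maxi M" "I \<subseteq> M" using maxi_exists[OF less(2,3) False] by blast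
    obtain x where x: "x \<in> carrier F" "x \<notin> R" "\<forall>m\<in>M. x \<otimes> m \<in> R"
      using maxi_multiplier[OF M(1)] by blast
    let ?I' = "inverse_ideal I"
    note I' = inverse_ideal_fracid[OF less(2,3)]
    note If = int_ideal_fracid[OF less(2,3)]
    have Is: "submod I" "I \<subseteq> R" using less(2) unfolding int_ideal_def by auto
    have xI': "x \<in> ?I'" using x M unfolding inverse_ideal_def by auto
    have oneI': "\<one> \<in> ?I'" unfolding inverse_ideal_def using Is R_carrier by auto
    let ?J = "I \<cdot> ?I'"
    have IJ: "I \<subseteq> ?J"
    proof
      fix y assume "y \<in> I"
      then show "y \<in> ?J"
        using ideal_prod.prod[of y I \<one> ?I' F] oneI' submod_carrier[OF Is(1)] by simp
    qed
    have "?J \<subseteq> R"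
    proof (rule prod_least[OF submod_R])
      fix i j assume "i \<in> I" "j \<in> ?I'"
      then show "i \<otimes> j \<in> R"
        unfolding inverse_ideal_def using submod_carrier[OF Is(1)] by (auto simp: m_comm)
    qed
    then have Jint: "int_ideal ?J"
      unfolding int_ideal_def using submod_prod[OF Is(1) fracid_submod[OF I']] by simp
    have "?J \<noteq> I"
    proof
      assume eq: "?J = I"
      have "x \<otimes> y \<in> I" if "y \<in> I" for y
        using ideal_prod.prod[OF that xI', of F] eq submod_carrier[OF Is(1) that] x(1)
        by (simp add: m_comm)
      then show False using multiplier_closed[OF If x(1)] x(2) by blast
    qed
    then have "{N. int_ideal N \<and> ?J \<subseteq> N} \<subset> {N. int_ideal N \<and> I \<subseteq> N}"
      using IJ less(2) by blast
    then have lt: "card {N. int_ideal N \<and> ?J \<subseteq> N} < card {N. int_ideal N \<and> I \<subseteq> N}"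
      using psubset_card_mono[OF finite_overideals'[OF less(2,3)]] by blast
    have J0: "?J \<noteq> {\<zero>}"
      using fracid_prod[OF If I'] unfolding fracid_def by blast
    obtain N where N: "fracid N" "?J \<cdot> N = R"
      using less(1)[OF lt Jint J0] by blast
    then have "I \<cdot> (?I' \<cdot> N) = R"
      using prod_assoc[OF Is(1) fracid_submod[OF I'] fracid_submod[OF N(1)]] by simp
    then show ?thesis
      using fracid_prod[OF I' N(1)] by blast
  qed
qed

text \<open>A denominator \<open>d\<close> turns \<open>I\<close> into an integral ideal
  \<open>d I\<close>; the principal factor is then moved over to the inverse.\<close>

lemma fracid_invertible:
  assumes I: "fracid I" shows "\<exists>J. fracid J \<and> I \<cdot> J = R"
proof -
  note Is = fracid_submod[OF I]
  obtain d where d: "d \<in> R" "d \<noteq> \<zero>" "\<forall>x\<in>I. d \<otimes> x \<in> R"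
    using I unfolding fracid_def by blast
  let ?D = "(\<lambda>a. a \<otimes> d) ` R"
  note dc = R_carrier[OF d(1)]
  have D: "fracid ?D" using fracid_principal[OF dc d(2)] .
  note DI = fracid_prod[OF D I]
  have "?D \<cdot> I \<subseteq> R"
  proof (rule prod_least[OF submod_R])
    fix i j assume "i \<in> ?D" "j \<in> I"
    then show "i \<otimes> j \<in> R"
      using d R_mult R_carrier submod_carrier[OF Is] by (auto simp: m_assoc)
  qed
  then obtain J where J: "fracid J" "(?D \<cdot> I) \<cdot> J = R"
    using int_ideal_invertible[of "?D \<cdot> I"] DI unfolding int_ideal_def fracid_def by blast
  have "I \<cdot> (?D \<cdot> J) = (I \<cdot> ?D) \<cdot> J"
    using prod_assoc fracid_submod D I J by simp
  also have "I \<cdot> ?D = ?D \<cdot> I"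
    using prod_comm submod_subset fracid_submod D I by simp
  finally show ?thesis
    using J fracid_prod[OF D J(1)] by auto
qed

text \<open>The record of \<open>fractional_ideals\<close> with \<open>R\<close> in place of the
  ring of integers; \<open>fractional_ideals_eq\<close> identifies the two when \<open>R\<close> is
  that ring.\<close>

definition FI :: "'a set monoid" where
  "FI = \<lparr>carrier = {I. fracid I}, mult = ideal_prod F, one = R\<rparr>"

lemma FI_simps [simp]:
  "carrier FI = {I. fracid I}" "mult FI = ideal_prod F" "one FI = R"
  by (simp_all add: FI_def)

lemma FI_comm_group: "comm_group FI"
proof (rule comm_groupI)
  fix x assume "x \<in> carrier FI"
  then have x: "fracid x" by simp
  then obtain J where J: "fracid J" "x \<cdot> J = R"
    using fracid_invertible by blast
  then have "J \<cdot> x = R"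
    using prod_comm[of J x] submod_subset[OF fracid_submod] x by simp
  then show "\<exists>y\<in>carrier FI. y \<otimes>\<^bsub>FI\<^esub> x = \<one>\<^bsub>FI\<^esub>"
    using J by auto
next
  fix x y assume "x \<in> carrier FI" "y \<in> carrier FI"
  then show "x \<otimes>\<^bsub>FI\<^esub> y = y \<otimes>\<^bsub>FI\<^esub> x"
    using prod_comm[of x y] submod_subset[OF fracid_submod] by simp
qed (simp_all add: fracid_prod fracid_R prod_assoc fracid_submod prod_R)

sublocale FI: comm_group FI
  by (rule FI_comm_group)

abbreviation finv :: "'a set \<Rightarrow> 'a set" where
  "finv I \<equiv> inv\<^bsub>FI\<^esub> I"

subsection \<open>Divisibility and factorisation\<close>

lemma fracid_inv: "fracid I \<Longrightarrow> fracid (finv I)"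
  using FI.inv_closed[of I] by simp

lemma prod_inv: "fracid I \<Longrightarrow> I \<cdot> finv I = R"
  using FI.r_inv[of I] by simp

lemma prod_subset_cancel:
  assumes "fracid I" "submod A" "submod B" "I \<cdot> A \<subseteq> I \<cdot> B" shows "A \<subseteq> B"
proof -
  let ?J = "finv I"
  have J: "submod ?J" and I: "submod I"
    using fracid_submod fracid_inv assms by auto
  have JI: "?J \<cdot> I = R" using FI.l_inv[of I] assms by simp
  have "?J \<cdot> (I \<cdot> A) \<subseteq> ?J \<cdot> (I \<cdot> B)"
    using prod_mono[OF subset_refl assms(4)] .
  then show ?thesis
    using prod_assoc[OF J I assms(2)] prod_assoc[OF J I assms(3)] JI prod_R assms by simp
qed

text \<open>To contain is to divide: the cofactor is \<open>finv J \<cdot> I\<close>, which is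
  integral because \<open>I\<close> lies in \<open>J\<close>.\<close>

lemma divides_if_subset:
  assumes "fracid J" "fracid I" "I \<subseteq> J"
  shows "\<exists>A. int_ideal A \<and> A \<noteq> {\<zero>} \<and> I = J \<cdot> A"
proof -
  let ?A = "finv J \<cdot> I"
  have A: "fracid ?A" using fracid_prod fracid_inv assms by blast
  have s: "submod J" "submod (finv J)" "submod I"
    using fracid_submod fracid_inv assms by auto
  have "?A \<subseteq> finv J \<cdot> J" using prod_mono[OF subset_refl assms(3)] .
  also have "\<dots> = R" using FI.l_inv[of J] assms by simp
  finally have "int_ideal ?A"
    unfolding int_ideal_def using fracid_submod[OF A] by simp
  moreover have "I = J \<cdot> ?A"
    using prod_assoc[OF s] prod_inv[OF assms(1)] prod_R[OF s(3)] by simp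
  ultimately show ?thesis
    using A unfolding fracid_def by blast
qed

text \<open>Existence of prime factorisations in the form of an induction rule. The cofactor of
  \<open>I\<close> by a maximal ideal above it is strictly larger than \<open>I\<close>, because
  equality would cancel to \<open>R\<close> inside that maximal ideal; so the number of ideals above
  drops.\<close>

lemma int_ideal_induct [consumes 2, case_names R prod]:
  assumes "int_ideal I" "I \<noteq> {\<zero>}" and R: "Q R"
    and step: "\<And>M J. maxi M \<Longrightarrow> int_ideal J \<Longrightarrow> J \<noteq> {\<zero>} \<Longrightarrow> Q J \<Longrightarrow> Q (M \<cdot> J)"
  shows "Q I"
  using assms(1,2)
proof (induct "card {J. int_ideal J \<and> I \<subseteq> J}" arbitrary: I rule: less_induct)
  case less
  show ?case
  proof (cases "I = R")
    case False
    obtain M where M: "maxi M" "I \<subseteq> M" using maxi_exists[OF less(2,3) False] by blast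
    obtain J where J: "int_ideal J" "J \<noteq> {\<zero>}" "I = M \<cdot> J"
      using divides_if_subset[OF maxi_fracid[OF M(1)] int_ideal_fracid[OF less(2,3)] M(2)] by blast
    have Js: "submod J" "submod M" using J M maxi_submod unfolding int_ideal_def by auto
    have "I \<subseteq> J" using prod_int_left[OF maxi_int[OF M(1)] Js(1)] J by simp
    moreover have "I \<noteq> J"
    proof
      assume "I = J"
      then have "J \<cdot> R \<subseteq> J \<cdot> M"
        using J(3) prod_R_right[OF Js(1)] prod_comm[OF Js[THEN submod_subset]] by simp
      then have "R \<subseteq> M"
        using prod_subset_cancel[OF int_ideal_fracid[OF J(1,2)] submod_R Js(2)] by simp
      then show False using M maxi_one R_one by blast
    qed
    ultimately have "{N. int_ideal N \<and> J \<subseteq> N} \<subset> {N. int_ideal N \<and> I \<subseteq> N}"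
      using less(2) by blast
    then have "card {N. int_ideal N \<and> J \<subseteq> N} < card {N. int_ideal N \<and> I \<subseteq> N}"
      using psubset_card_mono[OF finite_overideals'[OF less(2,3)]] by blast
    then have "Q J" using less(1) J by blast
    then show ?thesis using step M J by blast
  qed (simp add: R)
qed

lemma pow_int: "int_ideal I \<Longrightarrow> I \<noteq> {\<zero>} \<Longrightarrow> int_ideal (I [^]\<^bsub>FI\<^esub> (n::nat)) \<and> I [^]\<^bsub>FI\<^esub> n \<noteq> {\<zero>}"
proof (induct n)
  case 0
  then show ?case using int_ideal_R fracid_R unfolding fracid_def by simp
next
  case (Suc n)
  then show ?case
    using prod_int prod_nonzero int_ideal_submod by simp
qed

lemma maxi_pow_subset:
  assumes "maxi P" shows "P [^]\<^bsub>FI\<^esub> Suc n \<subseteq> P"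
proof -
  have "int_ideal (P [^]\<^bsub>FI\<^esub> n)" using pow_int maxi_int maxi_nonzero assms by blast
  then show ?thesis using prod_int_left maxi_submod assms by simp
qed

lemma maxi_pow_ne_R:
  assumes "maxi P" "n > 0" shows "P [^]\<^bsub>FI\<^esub> (n::nat) \<noteq> R"
proof -
  obtain m where "n = Suc m" using assms(2) gr0_implies_Suc by blast
  then show ?thesis
    using maxi_pow_subset[OF assms(1), of m] maxi_one[OF assms(1)] R_one by blast
qed

lemma maxi_pow_inj:
  assumes P: "maxi P" and eq: "P [^]\<^bsub>FI\<^esub> (m::nat) = P [^]\<^bsub>FI\<^esub> (n::nat)" shows "m = n"
proof -
  have Pc: "P \<in> carrier FI" using maxi_fracid P by simp
  have *: "\<not> m < n" if eq: "P [^]\<^bsub>FI\<^esub> (m::nat) = P [^]\<^bsub>FI\<^esub> (n::nat)" for m n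
  proof
    assume "m < n"
    then have "P [^]\<^bsub>FI\<^esub> m \<otimes>\<^bsub>FI\<^esub> P [^]\<^bsub>FI\<^esub> (n - m) = P [^]\<^bsub>FI\<^esub> m \<otimes>\<^bsub>FI\<^esub> \<one>\<^bsub>FI\<^esub>"
      using FI.nat_pow_mult[OF Pc, of m "n - m"] eq FI.nat_pow_closed[OF Pc, of m] FI.r_one
      by simp
    then have "P [^]\<^bsub>FI\<^esub> (n - m) = \<one>\<^bsub>FI\<^esub>"
      using FI.nat_pow_closed[OF Pc] FI.one_closed by (metis FI.l_cancel)
    then show False using maxi_pow_ne_R[OF P, of "n - m"] \<open>m < n\<close> by simp
  qed
  show ?thesis using *[OF eq] *[OF eq[symmetric]] by simp
qed

lemma maxi_pow_prime:
  assumes M: "maxi M" and I: "int_ideal I" "I \<noteq> {\<zero>}" and "I [^]\<^bsub>FI\<^esub> (n::nat) \<subseteq> M"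
  shows "I \<subseteq> M"
  using assms(4)
proof (induct n)
  case 0
  then show ?case using maxi_one[OF M] R_one by auto
next
  case (Suc n)
  then show ?case
    using maxi_prod_prime[OF M] pow_int[OF I, of n] I by auto
qed

text \<open>Meant for norms of primes: an equation between a power of a prime and a positive power
  of \<open>P\<close> recovers both the prime and the exponent. For \<open>n = 0\<close> it would
  say nothing about \<open>N\<close>.\<close>

lemma maxi_pow_eq:
  assumes P: "maxi P" and N: "maxi N" and eq: "N [^]\<^bsub>FI\<^esub> (m::nat) = P [^]\<^bsub>FI\<^esub> (n::nat)" and n: "n > 0"
  shows "N = P \<and> m = n"
proof -
  obtain k where "n = Suc k" using n gr0_implies_Suc by blast
  then have "N [^]\<^bsub>FI\<^esub> m \<subseteq> P" using eq maxi_pow_subset[OF P] by simp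
  then have "N = P"
    using maxi_pow_prime[OF P maxi_int[OF N] maxi_nonzero[OF N]] maxi_eqI[OF N P] by blast
  then show ?thesis using maxi_pow_inj[OF P] eq by blast
qed

abbreviation fiprod :: "'a set set \<Rightarrow> 'a set" where
  "fiprod T \<equiv> finprod FI (\<lambda>M. M) T"

lemma fiprod_insert:
  "finite T \<Longrightarrow> N \<notin> T \<Longrightarrow> (\<And>M. M \<in> insert N T \<Longrightarrow> maxi M) \<Longrightarrow> fiprod (insert N T) = N \<cdot> fiprod T"
  using FI.finprod_insert[of T N "\<lambda>M. M"] maxi_fracid by (simp add: Pi_def)

lemma fiprod_int:
  "finite T \<Longrightarrow> (\<And>M. M \<in> T \<Longrightarrow> maxi M) \<Longrightarrow> int_ideal (fiprod T) \<and> fiprod T \<noteq> {\<zero>}"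
proof (induct T rule: finite_induct)
  case empty
  then show ?case using int_ideal_R fracid_R unfolding fracid_def by simp
next
  case (insert N T)
  then have "maxi N" "int_ideal (fiprod T)" "fiprod T \<noteq> {\<zero>}" by auto
  then show ?case
    using fiprod_insert[of T N] insert prod_int prod_nonzero maxi_int maxi_nonzero int_ideal_submod
    by simp
qed

lemma fiprod_subset:
  assumes "finite T" "\<And>M. M \<in> T \<Longrightarrow> maxi M" "N \<in> T" shows "fiprod T \<subseteq> N"
proof -
  have T': "finite (T - {N})" "N \<notin> T - {N}" "\<And>M. M \<in> insert N (T - {N}) \<Longrightarrow> maxi M"
    using assms by auto
  have "fiprod T = N \<cdot> fiprod (T - {N})"
    using fiprod_insert[OF T'] assms(3) by (simp add: insert_absorb)
  also have "\<dots> = fiprod (T - {N}) \<cdot> N"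
    using prod_comm submod_subset int_ideal_submod fiprod_int[OF T'(1)] T' maxi_submod by simp
  also have "\<dots> \<subseteq> N"
    using prod_int_left fiprod_int[OF T'(1)] T'(3) maxi_submod by simp
  finally show ?thesis .
qed

lemma fiprod_subset_maxi:
  assumes M: "maxi M"
  shows "finite T \<Longrightarrow> (\<And>N. N \<in> T \<Longrightarrow> maxi N) \<Longrightarrow> fiprod T \<subseteq> M \<Longrightarrow> M \<in> T"
proof (induct T rule: finite_induct)
  case empty
  then show ?case using maxi_one[OF M] R_one by auto
next
  case (insert N T)
  have "fiprod (insert N T) = N \<cdot> fiprod T" using fiprod_insert insert by simp
  then have "N \<subseteq> M \<or> fiprod T \<subseteq> M"
    using maxi_prod_prime[OF M, of N "fiprod T"] insert fiprod_int[of T] maxi_int by auto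
  then show ?case using insert maxi_eqI[OF _ M] by blast
qed

text \<open>Distinct maximal ideals divide independently. A new \<open>N\<close> contains
  \<open>fiprod T \<cdot> J\<close> but not \<open>fiprod T\<close>, so by primality it contains
  \<open>J\<close> and splits off there.\<close>

lemma fiprod_divides:
  assumes I: "int_ideal I" "I \<noteq> {\<zero>}"
  shows "finite T \<Longrightarrow> (\<And>N. N \<in> T \<Longrightarrow> maxi N \<and> I \<subseteq> N) \<Longrightarrow>
    \<exists>J. int_ideal J \<and> J \<noteq> {\<zero>} \<and> I = fiprod T \<cdot> J"
proof (induct T rule: finite_induct)
  case empty
  then show ?case using I prod_R int_ideal_submod by auto
next
  case (insert N T)
  then obtain J where J: "int_ideal J" "J \<noteq> {\<zero>}" "I = fiprod T \<cdot> J" by auto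
  have N: "maxi N" "I \<subseteq> N" using insert by auto
  have T: "int_ideal (fiprod T)" using insert fiprod_int by auto
  have "\<not> fiprod T \<subseteq> N" using fiprod_subset_maxi[OF N(1)] insert by blast
  then have "J \<subseteq> N" using maxi_prod_prime[OF N(1) T J(1)] J N by auto
  then obtain J' where J': "int_ideal J'" "J' \<noteq> {\<zero>}" "J = N \<cdot> J'"
    using divides_if_subset[OF maxi_fracid[OF N(1)] int_ideal_fracid[OF J(1,2)]] by blast
  have s: "submod (fiprod T)" "submod N" "submod J'"
    using T N J' maxi_submod int_ideal_submod by auto
  have "I = (fiprod T \<cdot> N) \<cdot> J'" using J J' prod_assoc[OF s] by simp
  also have "fiprod T \<cdot> N = fiprod (insert N T)"
    using prod_comm[OF s(1,2)[THEN submod_subset]] fiprod_insert insert by simp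
  finally show ?case using J' by blast
qed

lemma finite_maxi_above:
  assumes "int_ideal I" "I \<noteq> {\<zero>}" shows "finite {M. maxi M \<and> I \<subseteq> M}"
  by (rule finite_subset[OF _ finite_overideals'[OF assms]]) (use maxi_int in auto)

text \<open>If \<open>x\<close> fails at the new \<open>P\<close>, some \<open>y\<close> of
  \<open>B \<cdot> fiprod T\<close> outside \<open>B \<cdot> P\<close> is added: this repairs
  \<open>P\<close> and changes nothing modulo the products with the old primes. Such a
  \<open>y\<close> exists, since otherwise \<open>B\<close> could be cancelled and \<open>P\<close>
  would belong to \<open>T\<close>. The lemma is applied to the inverse of an ideal and to a maximal
  ideal.\<close>

lemma avoidance:
  assumes B: "fracid B"
  shows "finite T \<Longrightarrow> (\<And>P. P \<in> T \<Longrightarrow> maxi P) \<Longrightarrow> \<exists>x\<in>B. \<forall>P\<in>T. x \<notin> B \<cdot> P"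
proof (induct T rule: finite_induct)
  case empty
  then show ?case using submod_zero[OF fracid_submod[OF B]] by blast
next
  case (insert P T)
  note Bs = fracid_submod[OF B]
  have P: "maxi P" using insert by auto
  have BP: "submod (B \<cdot> N)" "B \<cdot> N \<subseteq> B" if "maxi N" for N
    using submod_prod[OF Bs maxi_submod[OF that]] prod_mono[OF subset_refl maxi_subset[OF that], of B]
      prod_R_right[OF Bs] by auto
  obtain x where x: "x \<in> B" "\<forall>N\<in>T. x \<notin> B \<cdot> N" using insert by auto
  show ?case
  proof (cases "x \<in> B \<cdot> P")
    case False
    then show ?thesis using x by blast
  next
    case True
    have T: "int_ideal (fiprod T)" using fiprod_int insert by auto
    have "\<not> B \<cdot> fiprod T \<subseteq> B \<cdot> P"
      using prod_subset_cancel[OF B int_ideal_submod[OF T] maxi_submod[OF P]]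
        fiprod_subset_maxi[OF P] insert by blast
    then obtain y where y: "y \<in> B \<cdot> fiprod T" "y \<notin> B \<cdot> P" by blast
    have yN: "y \<in> B \<cdot> N" if "N \<in> T" for N
      using prod_mono[OF subset_refl fiprod_subset[OF insert(1) _ that], of B] insert y by blast
    have "y \<in> B"
      using y prod_mono[of B B "fiprod T" R] prod_R_right[OF Bs] T unfolding int_ideal_def by auto
    note c = submod_carrier[OF Bs x(1)] submod_carrier[OF Bs this]
    have *: "x = (x \<oplus> y) \<ominus> y" "y = (x \<oplus> y) \<ominus> x" using c by algebra+
    have "x \<oplus> y \<notin> B \<cdot> P"
      using submod_diff[OF BP(1)[OF P] _ True, of "x \<oplus> y"] *(2) y by auto
    moreover have "x \<oplus> y \<notin> B \<cdot> N" if "N \<in> T" for N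
      using submod_diff[OF BP(1) _ yN[OF that], of "x \<oplus> y"] *(1) x that insert by auto
    moreover have "x \<oplus> y \<in> B" using submod_add[OF Bs x(1) \<open>y \<in> B\<close>] .
    ultimately show ?thesis by blast
  qed
qed

lemma maxi_ex: "\<exists>P. maxi P"
proof -
  obtain a where a: "a \<in> R" "a \<noteq> \<zero>" "inv a \<notin> R" using R_not_field by blast
  have "\<one> \<notin> (\<lambda>b. b \<otimes> a) ` R"
  proof
    assume "\<one> \<in> (\<lambda>b. b \<otimes> a) ` R"
    then obtain b where "b \<in> R" "b \<otimes> a = \<one>" by (elim imageE) simp
    then show False
      using a R_carrier comm_inv_char[of a b] m_comm[of a b] by simp
  qed
  then have "(\<lambda>b. b \<otimes> a) ` R \<noteq> R" using R_one by auto
  moreover have "(\<lambda>b. b \<otimes> a) ` R \<noteq> {\<zero>}" using principal_mem[of a] a R_carrier by blast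
  ultimately show ?thesis
    using maxi_exists[OF int_ideal_principal[OF a(1)]] by blast
qed

text \<open>Take \<open>x\<close> in the inverse of \<open>I\<close> but in none of the products of
  that inverse with a \<open>P\<close> in \<open>T\<close>. If \<open>x I\<close> lay inside
  \<open>P\<close>, multiplying by the inverse of \<open>I\<close> would put \<open>x\<close> into
  such a product.\<close>

lemma coprime_representative:
  assumes I: "fracid I" and T: "finite T" "\<And>P. P \<in> T \<Longrightarrow> maxi P"
  shows "\<exists>x\<in>carrier F. x \<noteq> \<zero> \<and> int_ideal (((\<lambda>a. a \<otimes> x) ` R) \<cdot> I) \<and>
    (\<forall>P\<in>T. \<not> ((\<lambda>a. a \<otimes> x) ` R) \<cdot> I \<subseteq> P)"
proof -
  let ?B = "finv I"
  have B: "fracid ?B" using fracid_inv[OF I] .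
  note s = fracid_submod[OF I] fracid_submod[OF B]
  have IB: "I \<cdot> ?B = R" "?B \<cdot> I = R" using prod_inv[OF I] FI.l_inv[of I] I by auto
  \<comment> \<open>One further maximal ideal is avoided as well, which forces \<open>x0\<close> to
    be nonzero even when \<open>T\<close> is empty.\<close>
  obtain P0 where P0: "maxi P0" using maxi_ex by blast
  obtain x0 where x0: "x0 \<in> ?B" "\<forall>P\<in>insert P0 T. x0 \<notin> ?B \<cdot> P"
    using avoidance[OF B, of "insert P0 T"] T P0 by blast
  have x00: "x0 \<noteq> \<zero>"
    using submod_zero[OF submod_prod[OF s(2) maxi_submod[OF P0]]] x0(2) by blast
  have xc: "x0 \<in> carrier F" using submod_carrier[OF s(2) x0(1)] .
  let ?X = "(\<lambda>a. a \<otimes> x0) ` R"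
  note X = submod_principal[OF xc]
  have XB: "?X \<subseteq> ?B" using submod_mult[OF s(2) _ x0(1)] by auto
  have "?X \<cdot> I \<subseteq> R" using prod_mono[OF XB subset_refl, of I] IB by simp
  then have "int_ideal (?X \<cdot> I)" unfolding int_ideal_def using submod_prod[OF X s(1)] by simp
  moreover have "\<not> ?X \<cdot> I \<subseteq> P" if P: "P \<in> T" for P
  proof
    assume "?X \<cdot> I \<subseteq> P"
    then have "(?X \<cdot> I) \<cdot> ?B \<subseteq> P \<cdot> ?B" using prod_mono by blast
    moreover have "(?X \<cdot> I) \<cdot> ?B = ?X"
      using prod_assoc[OF X s] IB prod_R_right[OF X] by simp
    moreover have "P \<cdot> ?B = ?B \<cdot> P"
      using prod_comm[of P ?B] submod_subset[OF s(2)] submod_subset[OF maxi_submod[OF T(2)[OF P]]] by simp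
    ultimately have "x0 \<in> ?B \<cdot> P" using principal_mem[OF xc] by blast
    then show False using x0(2) P by blast
  qed
  ultimately show ?thesis using xc x00 by blast
qed

end

section \<open>Integral elements\<close>

context field
begin

abbreviation zmul :: "int \<Rightarrow> 'a" ("\<iota>") where
  "\<iota> n \<equiv> [n] \<cdot> \<one>"

lemma iota_closed [simp]: "\<iota> n \<in> carrier R"
  by simp

lemma iota_0: "\<iota> 0 = \<zero>"
  and iota_1: "\<iota> 1 = \<one>"
  and iota_add: "\<iota> (m + n) = \<iota> m \<oplus> \<iota> n"
  and iota_minus: "\<iota> (- n) = \<ominus> \<iota> n"
  by (simp_all add: add.int_pow_mult add.int_pow_neg) (simp add: add_pow_def)

lemma iota_mult: "\<iota> (m * n) = \<iota> m \<otimes> \<iota> n"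
  by (simp add: add_pow_ldistr_int add.int_pow_pow mult.commute)

lemma iota_diff: "\<iota> (m - n) = \<iota> m \<ominus> \<iota> n"
  using iota_add[of m "- n"] iota_minus[of n] by (simp add: a_minus_def)

text \<open>The additive group generated by \<open>S\<close>, in inductive form so that facts about
  integer combinations follow by induction, without families of coefficients.\<close>

inductive_set zspan :: "'a set \<Rightarrow> 'a set" for S where
  zero: "\<zero> \<in> zspan S"
| incl: "s \<in> S \<Longrightarrow> s \<in> zspan S"
| add: "x \<in> zspan S \<Longrightarrow> y \<in> zspan S \<Longrightarrow> x \<oplus> y \<in> zspan S"
| neg: "x \<in> zspan S \<Longrightarrow> \<ominus> x \<in> zspan S"

lemma zspan_carrier: "S \<subseteq> carrier R \<Longrightarrow> x \<in> zspan S \<Longrightarrow> x \<in> carrier R"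
  by (rotate_tac, induct rule: zspan.induct) auto

lemma zspan_diff: "x \<in> zspan S \<Longrightarrow> y \<in> zspan S \<Longrightarrow> x \<ominus> y \<in> zspan S"
  unfolding a_minus_def by (intro zspan.add zspan.neg)

lemma zspan_nat: "S \<subseteq> carrier R \<Longrightarrow> x \<in> zspan S \<Longrightarrow> \<iota> (int n) \<otimes> x \<in> zspan S"
proof (induct n)
  case 0
  then show ?case using zspan.zero zspan_carrier by (simp add: iota_0)
next
  case (Suc n)
  have x: "x \<in> carrier R" using Suc zspan_carrier by blast
  have "\<iota> (int (Suc n)) \<otimes> x = x \<oplus> \<iota> (int n) \<otimes> x"
    using x iota_add[of 1 "int n"] by (simp add: iota_1 l_distr)
  then show ?case using Suc zspan.add by metis
qed

lemma zspan_int: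
  assumes "S \<subseteq> carrier R" "x \<in> zspan S" shows "\<iota> n \<otimes> x \<in> zspan S"
proof -
  obtain m where "n = int m \<or> n = - int m" by (meson int_cases2)
  moreover have "\<iota> (- int m) \<otimes> x = \<ominus> (\<iota> (int m) \<otimes> x)"
    using zspan_carrier[OF assms] by (simp add: iota_minus l_minus)
  ultimately show ?thesis
    using zspan_nat[OF assms, of m] zspan.neg by metis
qed

lemma zspan_subset:
  assumes "x \<in> zspan S" "\<And>s. s \<in> S \<Longrightarrow> s \<in> zspan T" shows "x \<in> zspan T"
  using assms(1) by induct (auto intro: zspan.intros assms(2))

lemma zspan_mono: "S \<subseteq> T \<Longrightarrow> zspan S \<subseteq> zspan T"
  using zspan_subset zspan.incl by blast

lemma zspan_empty: "zspan {} = {\<zero>}"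
proof -
  have "x = \<zero>" if "x \<in> zspan {}" for x using that by induct auto
  then show ?thesis using zspan.zero by blast
qed

lemma zspan_insertE:
  assumes "x \<in> zspan (insert g S)" "g \<in> carrier R" "S \<subseteq> carrier R"
  obtains c r where "r \<in> zspan S" "x = \<iota> c \<otimes> g \<oplus> r"
proof -
  note car = zspan_carrier[OF assms(3)]
  have "\<exists>c. \<exists>r\<in>zspan S. x = \<iota> c \<otimes> g \<oplus> r"
    using assms(1)
  proof induct
    case zero
    show ?case using zspan.zero[of S] assms by (intro exI[of _ 0] bexI[of _ \<zero>]) (auto simp: iota_0)
  next
    case (incl s)
    show ?case
    proof (cases "s = g")
      case True
      then show ?thesis
        using zspan.zero[of S] assms by (intro exI[of _ 1] bexI[of _ \<zero>]) (auto simp: iota_1)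
    next
      case False
      then show ?thesis
        using zspan.incl[of s S] assms incl by (intro exI[of _ 0] bexI[of _ s]) (auto simp: iota_0)
    qed
  next
    case (add x y)
    then obtain c r c' r' where *: "r \<in> zspan S" "r' \<in> zspan S"
      "x = \<iota> c \<otimes> g \<oplus> r" "y = \<iota> c' \<otimes> g \<oplus> r'" by blast
    have "x \<oplus> y = \<iota> (c + c') \<otimes> g \<oplus> (r \<oplus> r')"
      unfolding *(3,4) iota_add using car[OF *(1)] car[OF *(2)] assms(2) iota_closed[of c] iota_closed[of c']
      by algebra
    then show ?case using zspan.add[OF *(1,2)] by blast
  next
    case (neg x)
    then obtain c r where *: "r \<in> zspan S" "x = \<iota> c \<otimes> g \<oplus> r" by blast
    have "\<ominus> x = \<iota> (- c) \<otimes> g \<oplus> \<ominus> r"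
      unfolding *(2) iota_minus using car[OF *(1)] assms(2) iota_closed[of c] by algebra
    then show ?case using zspan.neg[OF *(1)] by blast
  qed
  then show ?thesis using that by blast
qed

lemma zspan_mult:
  assumes "G \<subseteq> carrier R" "H \<subseteq> carrier R" "a \<in> zspan G" "b \<in> zspan H"
    and GH: "\<And>g h. g \<in> G \<Longrightarrow> h \<in> H \<Longrightarrow> g \<otimes> h \<in> zspan T"
  shows "a \<otimes> b \<in> zspan T"
proof -
  note car = zspan_carrier[OF assms(1)] zspan_carrier[OF assms(2)]
  have *: "g \<otimes> b \<in> zspan T" if g: "g \<in> G" for g
    using assms(4)
  proof induct
    case zero
    show ?case using g assms(1) zspan.zero by (simp add: subset_iff)
  next
    case (incl s)
    then show ?case using GH g by blast
  next
    case (add x y)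
    have "g \<otimes> (x \<oplus> y) = g \<otimes> x \<oplus> g \<otimes> y" using add car g assms(1) by (intro r_distr) auto
    then show ?case using add zspan.add by simp
  next
    case (neg x)
    have "g \<otimes> (\<ominus> x) = \<ominus> (g \<otimes> x)" using neg car g assms(1) by (intro r_minus) auto
    then show ?case using neg zspan.neg by simp
  qed
  note bc = car(2)[OF assms(4)]
  show ?thesis
    using assms(3)
  proof induct
    case zero
    show ?case using bc zspan.zero by simp
  next
    case (incl s)
    then show ?case using * by blast
  next
    case (add x y)
    have "(x \<oplus> y) \<otimes> b = x \<otimes> b \<oplus> y \<otimes> b" using add car bc by (intro l_distr) auto
    then show ?case using add zspan.add by simp
  next
    case (neg x)
    have "(\<ominus> x) \<otimes> b = \<ominus> (x \<otimes> b)" using neg car bc by (intro l_minus) auto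
    then show ?case using neg zspan.neg by simp
  qed
qed

text \<open>A nonzero subgroup is generated by its least positive element, by division with
  remainder. This is the arithmetic input of \<open>zspan_stabilises\<close>.\<close>

lemma int_subgroup_principal:
  fixes A :: "int set"
  assumes "0 \<in> A" and diff: "\<And>a b. a \<in> A \<Longrightarrow> b \<in> A \<Longrightarrow> a - b \<in> A"
  shows "\<exists>d\<in>A. \<forall>c\<in>A. d dvd c"
proof (cases "A = {0}")
  case False
  have neg: "- a \<in> A" if "a \<in> A" for a using diff[OF assms(1) that] by simp
  have plus: "a + b \<in> A" if "a \<in> A" "b \<in> A" for a b using diff[OF that(1) neg[OF that(2)]] by simp
  obtain a where "a \<in> A" "a \<noteq> 0" using False assms by blast
  then have "\<exists>n::nat. n > 0 \<and> int n \<in> A"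
    using neg by (cases "a > 0") (auto intro!: exI[of _ "nat \<bar>a\<bar>"])
  then obtain d where d: "d > 0 \<and> int d \<in> A" "\<And>m. m < d \<Longrightarrow> \<not> (m > 0 \<and> int m \<in> A)"
    using exists_least_iff[of "\<lambda>n::nat. n > 0 \<and> int n \<in> A"] by blast
  have natmul: "a * int k \<in> A" if "a \<in> A" for a k
    by (induct k) (use assms plus that in \<open>auto simp: algebra_simps\<close>)
  have mul: "a * k \<in> A" if "a \<in> A" for a k
    using natmul[OF that, of "nat k"] natmul[OF neg[OF that], of "nat (- k)"] by (cases "k \<ge> 0") auto
  have "int d dvd c" if c: "c \<in> A" for c
  proof -
    have "c mod int d = c - int d * (c div int d)" by (simp add: minus_mult_div_eq_mod)
    then have "c mod int d \<in> A" using diff[OF c mul] d by metis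
    moreover have "0 \<le> c mod int d" "c mod int d < int d" using d by auto
    ultimately have "c mod int d = 0"
      using d(2)[of "nat (c mod int d)"] by (cases "c mod int d = 0") (auto simp: nat_less_iff)
    then show ?thesis by auto
  qed
  then show ?thesis using d by blast
qed auto

text \<open>Finitely generated abelian groups are Noetherian, in the form needed for the powers of
  an element. Induction on the generators: the coefficients of \<open>g\<close> occurring in spans
  of \<open>u\<close> form an ideal generated by some \<open>d\<close>, realised by
  \<open>x\<close>. Subtracting multiples of \<open>x\<close> from \<open>u\<close> removes
  \<open>g\<close> and leaves a sequence in the span of \<open>G\<close>.\<close>

lemma zspan_stabilises:
  assumes "finite G" "G \<subseteq> carrier R" "\<And>k::nat. u k \<in> zspan G"
  shows "\<exists>k. u k \<in> zspan (u ` {..<k})"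
  using assms
proof (induct G arbitrary: u rule: finite_induct)
  case empty
  then have "u 0 \<in> zspan (u ` {..<0})" using zspan.zero by (simp add: zspan_empty)
  then show ?case by blast
next
  case (insert g G)
  have g: "g \<in> carrier R" and G: "G \<subseteq> carrier R" using insert by auto
  have uc: "u k \<in> carrier R" for k
    using insert(4,5) zspan_carrier by blast
  have uspan: "zspan (u ` T) \<subseteq> carrier R" for T
    using zspan_carrier[of "u ` T"] uc by blast
  have umono: "y \<in> zspan (u ` {..<K'})" if "K \<le> K'" "y \<in> zspan (u ` {..<K})" for K K' y
    using zspan_mono[of "u ` {..<K}" "u ` {..<K'}"] that by (auto simp: image_mono)
  define A where "A = {c. \<exists>K. \<exists>x\<in>zspan (u ` {..<K}). \<exists>r\<in>zspan G. x = \<iota> c \<otimes> g \<oplus> r}"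
  have "0 \<in> A"
    unfolding A_def using zspan.zero g by (force simp: iota_0)
  moreover have "a - b \<in> A" if ab: "a \<in> A" "b \<in> A" for a b
  proof -
    obtain K x r K' x' r' where *: "x \<in> zspan (u ` {..<K})" "r \<in> zspan G" "x = \<iota> a \<otimes> g \<oplus> r"
      "x' \<in> zspan (u ` {..<K'})" "r' \<in> zspan G" "x' = \<iota> b \<otimes> g \<oplus> r'"
      using ab unfolding A_def by blast
    let ?K = "max K K'"
    have "x \<in> zspan (u ` {..<?K})" "x' \<in> zspan (u ` {..<?K})"
      using umono *(1,4) max.cobounded1 max.cobounded2 by blast+
    then have "x \<ominus> x' \<in> zspan (u ` {..<?K})" by (rule zspan_diff)
    moreover have "x \<ominus> x' = \<iota> (a - b) \<otimes> g \<oplus> (r \<ominus> r')"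
      unfolding *(3,6) iota_diff
      using g zspan_carrier[OF G *(2)] zspan_carrier[OF G *(5)] iota_closed[of a] iota_closed[of b]
      by algebra
    ultimately show ?thesis unfolding A_def using zspan_diff[OF *(2,5)] by blast
  qed
  ultimately obtain d where d: "d \<in> A" "\<forall>c\<in>A. d dvd c"
    using int_subgroup_principal[of A] by blast
  then obtain K x r where x: "x \<in> zspan (u ` {..<K})" "r \<in> zspan G" "x = \<iota> d \<otimes> g \<oplus> r"
    unfolding A_def by blast
  have "\<exists>q. \<exists>s\<in>zspan G. u k = \<iota> q \<otimes> x \<oplus> s" for k
  proof -
    obtain c s where s: "s \<in> zspan G" "u k = \<iota> c \<otimes> g \<oplus> s"
      using zspan_insertE[OF insert(5) g G] by blast
    have "u k \<in> zspan (u ` {..<Suc k})" by (intro zspan.incl) auto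
    then have "c \<in> A" unfolding A_def using s by blast
    then obtain q where q: "c = d * q" using d by blast
    have "u k = \<iota> q \<otimes> x \<oplus> (s \<ominus> \<iota> q \<otimes> r)"
      unfolding s(2) x(3) q iota_mult
      using g zspan_carrier[OF G s(1)] zspan_carrier[OF G x(2)] iota_closed[of d] iota_closed[of q]
      by algebra
    moreover have "s \<ominus> \<iota> q \<otimes> r \<in> zspan G"
      using zspan_diff[OF s(1) zspan_int[OF G x(2)]] .
    ultimately show ?thesis by blast
  qed
  then obtain q s where qs: "\<And>k. s k \<in> zspan G" "\<And>k. u k = \<iota> (q k) \<otimes> x \<oplus> s k"
    by metis
  \<comment> \<open>The sequence is shifted by \<open>K\<close> because \<open>x\<close> lies in the
    span of the first \<open>K\<close> terms of \<open>u\<close>. Beyond them, passing between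
    \<open>s\<close> and \<open>u\<close> costs only multiples of \<open>x\<close>, which are
    already available.\<close>
  obtain k where k: "s (K + k) \<in> zspan ((\<lambda>i. s (K + i)) ` {..<k})"
    using insert(3)[OF G, of "\<lambda>i. s (K + i)"] qs by auto
  let ?U = "u ` {..<K + k}"
  have xU: "\<iota> n \<otimes> x \<in> zspan ?U" for n
    using zspan_int[of ?U x] uc umono[OF _ x(1), of "K + k"] by auto
  have xc: "x \<in> carrier R" using x(1) uspan by blast
  have s_eq: "s i = u i \<ominus> \<iota> (q i) \<otimes> x" for i
    unfolding qs(2)[of i] using zspan_carrier[OF G qs(1)[of i]] xc iota_closed[of "q i"] by algebra
  have "s (K + i) \<in> zspan ?U" if "i < k" for i
    unfolding s_eq by (rule zspan_diff[OF zspan.incl xU]) (use that in auto)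
  then have "s (K + k) \<in> zspan ?U"
    using zspan_subset[OF k] by auto
  then have "u (K + k) \<in> zspan ?U"
    unfolding qs(2)[of "K + k"] using zspan.add xU by blast
  then show ?case by blast
qed

text \<open>A monic integer equation of degree \<open>n\<close>, written without polynomials;
  \<open>integral_over_int_iff\<close> links it to \<open>integral_over_int\<close>. The case
  \<open>n = 0\<close> cannot occur, as 1 is not in the span of the empty set.\<close>

definition intg :: "'a \<Rightarrow> bool" where
  "intg x \<longleftrightarrow> x \<in> carrier R \<and> (\<exists>n::nat. x [^] n \<in> zspan ((\<lambda>i::nat. x [^] i) ` {..<n}))"

text \<open>All powers of \<open>x\<close> lie in the span of \<open>G\<close>, so
  \<open>zspan_stabilises\<close> supplies a monic relation. Together with its converse
  \<open>intgE\<close> this turns closure properties into statements about stable groups.\<close>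

lemma intgI:
  assumes G: "finite G" "G \<subseteq> carrier R" "\<one> \<in> zspan G"
    and x: "x \<in> carrier R" "\<And>g. g \<in> G \<Longrightarrow> x \<otimes> g \<in> zspan G"
  shows "intg x"
proof -
  have x1: "x \<in> zspan {x}" by (intro zspan.incl) simp
  have stable: "x \<otimes> y \<in> zspan G" if "y \<in> zspan G" for y
    by (rule zspan_mult[OF _ G(2) x1 that]) (use x in auto)
  have "x [^] (k::nat) \<in> zspan G" for k
  proof (induct k)
    case 0
    then show ?case using G by simp
  next
    case (Suc k)
    then show ?case using stable[OF Suc] x(1) by (simp add: m_comm)
  qed
  then show ?thesis
    unfolding intg_def using zspan_stabilises[OF G(1,2), of "\<lambda>k. x [^] k"] x by blast
qed

lemma intgE:
  assumes "intg x"
  obtains G where "finite G" "G \<subseteq> carrier R" "\<one> \<in> zspan G" "\<And>y. y \<in> zspan G \<Longrightarrow> x \<otimes> y \<in> zspan G"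
proof -
  obtain n :: nat where n: "x [^] n \<in> zspan ((\<lambda>i::nat. x [^] i) ` {..<n})" and x: "x \<in> carrier R"
    using assms unfolding intg_def by blast
  let ?G = "(\<lambda>i::nat. x [^] i) ` {..<n}"
  have G: "?G \<subseteq> carrier R" using x by auto
  have "n \<noteq> 0"
    using n by (intro notI) (simp add: zspan_empty)
  then have "\<one> \<in> ?G" by (intro image_eqI[of _ _ 0]) auto
  then have 1: "\<one> \<in> zspan ?G" by (rule zspan.incl)
  have g: "x \<otimes> g \<in> zspan ?G" if "g \<in> ?G" for g
  proof -
    obtain i where i: "i < n" "g = x [^] i" using \<open>g \<in> ?G\<close> by auto
    have "x \<otimes> g = x [^] Suc i" using i x by (simp add: m_comm)
    then show ?thesis
    proof (cases "Suc i = n")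
      case False
      then have "x [^] Suc i \<in> ?G" using i(1) by (intro imageI) simp
      then show ?thesis unfolding \<open>x \<otimes> g = x [^] Suc i\<close> by (rule zspan.incl)
    qed (use n in simp)
  qed
  have x1: "x \<in> zspan {x}" by (intro zspan.incl) simp
  have stable: "x \<otimes> y \<in> zspan ?G" if "y \<in> zspan ?G" for y
    by (rule zspan_mult[OF _ G x1 that]) (use x g in auto)
  show ?thesis using that[OF _ G 1 stable] by auto
qed

lemma zspan_products:
  assumes "finite G" "G \<subseteq> carrier R" "finite H" "H \<subseteq> carrier R"
  obtains T where "finite T" "T \<subseteq> carrier R" "\<And>g h. g \<in> zspan G \<Longrightarrow> h \<in> zspan H \<Longrightarrow> g \<otimes> h \<in> zspan T"
    "\<And>t. t \<in> T \<Longrightarrow> \<exists>g\<in>G. \<exists>h\<in>H. t = g \<otimes> h"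
proof
  let ?T = "(\<lambda>(g, h). g \<otimes> h) ` (G \<times> H)"
  show "finite ?T" "?T \<subseteq> carrier R" using assms by auto
  show "\<exists>g\<in>G. \<exists>h\<in>H. t = g \<otimes> h" if "t \<in> ?T" for t using that by auto
  show "g \<otimes> h \<in> zspan ?T" if "g \<in> zspan G" "h \<in> zspan H" for g h
    by (rule zspan_mult[OF assms(2,4) that]) (auto intro!: zspan.incl)
qed

lemma intg_add_mult:
  assumes "intg x" "intg y" shows "intg (x \<oplus> y)" "intg (x \<otimes> y)"
proof -
  obtain G where G: "finite G" "G \<subseteq> carrier R" "\<one> \<in> zspan G" "\<And>z. z \<in> zspan G \<Longrightarrow> x \<otimes> z \<in> zspan G"
    using intgE[OF assms(1)] by blast
  obtain H where H: "finite H" "H \<subseteq> carrier R" "\<one> \<in> zspan H" "\<And>z. z \<in> zspan H \<Longrightarrow> y \<otimes> z \<in> zspan H"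
    using intgE[OF assms(2)] by blast
  obtain T where T: "finite T" "T \<subseteq> carrier R" "\<And>g h. g \<in> zspan G \<Longrightarrow> h \<in> zspan H \<Longrightarrow> g \<otimes> h \<in> zspan T"
    "\<And>t. t \<in> T \<Longrightarrow> \<exists>g\<in>G. \<exists>h\<in>H. t = g \<otimes> h"
    using zspan_products[OF G(1,2) H(1,2)] by blast
  have xy: "x \<in> carrier R" "y \<in> carrier R" using assms unfolding intg_def by auto
  have 1: "\<one> \<in> zspan T" using T(3)[OF G(3) H(3)] by simp
  have t: "x \<otimes> t \<in> zspan T \<and> y \<otimes> t \<in> zspan T \<and> (x \<otimes> y) \<otimes> t \<in> zspan T" if tT: "t \<in> T" for t
  proof -
    obtain g h where gh: "g \<in> G" "h \<in> H" "t = g \<otimes> h" using T(4)[OF tT] by blast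
    have c: "g \<in> carrier R" "h \<in> carrier R" using gh G(2) H(2) by auto
    have z: "g \<in> zspan G" "h \<in> zspan H" using gh zspan.incl by auto
    have "x \<otimes> t = (x \<otimes> g) \<otimes> h" "y \<otimes> t = g \<otimes> (y \<otimes> h)" "(x \<otimes> y) \<otimes> t = (x \<otimes> g) \<otimes> (y \<otimes> h)"
      unfolding gh(3) using c xy by algebra+
    then show ?thesis using T(3) G(4)[OF z(1)] H(4)[OF z(2)] z by simp
  qed
  show "intg (x \<otimes> y)" using intgI[OF T(1,2) 1] t xy by simp
  have "(x \<oplus> y) \<otimes> s = x \<otimes> s \<oplus> y \<otimes> s" if "s \<in> T" for s
    using xy T(2) that by (intro l_distr) auto
  then show "intg (x \<oplus> y)" using intgI[OF T(1,2) 1, of "x \<oplus> y"] t xy zspan.add by simp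
qed

lemma intg_iota: "intg (\<iota> n)"
proof (rule intgI[of "{\<one>}"])
  show "\<one> \<in> zspan {\<one>}" by (intro zspan.incl) simp
  then show "\<iota> n \<otimes> g \<in> zspan {\<one>}" if "g \<in> {\<one>}" for g
    using that zspan_int[of "{\<one>}" \<one> n] by simp
qed auto

lemma intg_carrier: "intg x \<Longrightarrow> x \<in> carrier R"
  unfolding intg_def by simp

lemma intg_minus: "intg x \<Longrightarrow> intg (\<ominus> x)"
  using intg_add_mult(2)[OF intg_iota[of "- 1"], of x] intg_carrier[of x]
  by (simp add: iota_minus iota_1 l_minus)

lemma intg_subring: "subring {x. intg x} R"
proof (rule subringI)
  show "\<one> \<in> {x. intg x}" using intg_iota[of 1] by (simp add: iota_1)
qed (use intg_carrier intg_minus intg_add_mult in auto)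

text \<open>\<open>x\<close> is a root of the monic polynomial \<open>X^j - X^i - c\<close>, where
  \<open>c\<close> is integral. The group spanned by the products \<open>x^t h\<close>, with
  \<open>t < j\<close> and \<open>h\<close> among generators of a group stable under
  \<open>c\<close>, is then stable under \<open>x\<close>.\<close>

lemma intg_of_power_difference:
  fixes i j :: nat
  assumes x: "x \<in> carrier R" and ij: "i < j" and c: "intg (x [^] j \<ominus> x [^] i)"
  shows "intg x"
proof -
  let ?c = "x [^] j \<ominus> x [^] i"
  obtain H where H: "finite H" "H \<subseteq> carrier R" "\<one> \<in> zspan H" "\<And>z. z \<in> zspan H \<Longrightarrow> ?c \<otimes> z \<in> zspan H"
    using intgE[OF c] by blast
  let ?G = "(\<lambda>t::nat. x [^] t) ` {..<j}"
  have G: "finite ?G" "?G \<subseteq> carrier R" using x by auto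
  have Gi: "x [^] t \<in> zspan ?G" if "t < j" for t :: nat
    using that by (intro zspan.incl) auto
  obtain T where T: "finite T" "T \<subseteq> carrier R" "\<And>g h. g \<in> zspan ?G \<Longrightarrow> h \<in> zspan H \<Longrightarrow> g \<otimes> h \<in> zspan T"
    "\<And>t. t \<in> T \<Longrightarrow> \<exists>g\<in>?G. \<exists>h\<in>H. t = g \<otimes> h"
    using zspan_products[OF G H(1,2)] by blast
  have G1: "\<one> \<in> zspan ?G" using Gi[of 0] ij by simp
  have 1: "\<one> \<in> zspan T" using T(3)[OF G1 H(3)] by simp
  show ?thesis
  proof (rule intgI[OF T(1,2) 1 x])
    fix g assume "g \<in> T"
    then obtain t h where th: "t < j" "h \<in> H" "g = x [^] t \<otimes> h" using T(4) by blast
    have hc: "h \<in> carrier R" and hz: "h \<in> zspan H" using th H(2) zspan.incl by auto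
    have xg: "x \<otimes> g = x [^] Suc t \<otimes> h" using th hc x by (simp add: m_ac)
    show "x \<otimes> g \<in> zspan T"
    proof (cases "Suc t < j")
      case True
      then show ?thesis unfolding xg using T(3)[OF Gi hz] by blast
    next
      case False
      then have "Suc t = j" using th by simp
      \<comment> \<open>The factor 1 presents \<open>?c \<otimes> h\<close> as a product of an
        element of the span of powers with one of the span of \<open>H\<close>, as
        \<open>T(3)\<close> expects.\<close>
      moreover have "x [^] j \<otimes> h = x [^] i \<otimes> h \<oplus> \<one> \<otimes> (?c \<otimes> h)"
        using hc nat_pow_closed[OF x, of i] nat_pow_closed[OF x, of j] by algebra
      ultimately show ?thesis
        using xg T(3)[OF Gi[OF ij] hz] T(3)[OF G1 H(4)[OF hz]] zspan.add by simp
    qed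
  qed
qed

end

section \<open>The integers of a number field satisfy the axioms of
  \<open>dedekind_subring\<close>\<close>

locale num_field = field R for R (structure) +
  assumes char0: "inj (\<lambda>n::int. [n] \<cdot> \<one>)"
    and findim: "finite_dimension (generate_field R {}) (carrier R)"
begin

abbreviation ZI :: "'a set" where "ZI \<equiv> {x. intg x}"

lemma iota_eq_0: "\<iota> n = \<zero> \<longleftrightarrow> n = 0"
  using injD[OF char0, of n 0] by (auto simp: iota_0)

text \<open>The field generated by the empty set is the prime field, and fractions of integers are
  closed under every clause of its generation. Inversion swaps numerator and denominator, so there
  the numerator has to be nonzero.\<close>

lemma prime_field_fraction:
  "k \<in> generate_field R {} \<Longrightarrow> \<exists>a b. b \<noteq> 0 \<and> \<iota> b \<otimes> k = \<iota> a"
proof (induct rule: generate_field.induct)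
  case one
  show ?case by (rule exI[of _ 1], rule exI[of _ 1]) (simp add: iota_1)
next
  case (incl h)
  then show ?case by simp
next
  case (a_inv h)
  have h: "h \<in> carrier R" using a_inv generate_field_in_carrier[of "{}" h] by blast
  obtain a b where "b \<noteq> 0" "\<iota> b \<otimes> h = \<iota> a" using a_inv by blast
  then show ?case
    using h by (intro exI[of _ "- a"] exI[of _ b]) (simp add: iota_minus r_minus)
next
  case (m_inv h)
  have h: "h \<in> carrier R" using m_inv generate_field_in_carrier[of "{}" h] by blast
  obtain a b where ab: "b \<noteq> 0" "\<iota> b \<otimes> h = \<iota> a" using m_inv by blast
  have i: "inv h \<in> carrier R" "h \<otimes> inv h = \<one>" using h m_inv field_Units by auto
  have "a \<noteq> 0"
  proof
    assume "a = 0"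
    then show False using ab h m_inv integral[of "\<iota> b" h] by (simp add: iota_0 iota_eq_0)
  qed
  moreover have "\<iota> a \<otimes> inv h = \<iota> b"
    unfolding ab(2)[symmetric] using h i by (simp add: m_assoc)
  ultimately show ?case by blast
next
  case (eng_add h1 h2)
  have h: "h1 \<in> carrier R" "h2 \<in> carrier R"
    using eng_add generate_field_in_carrier[of "{}"] by blast+
  obtain a b c d where ab: "b \<noteq> 0" "\<iota> b \<otimes> h1 = \<iota> a" "d \<noteq> 0" "\<iota> d \<otimes> h2 = \<iota> c" using eng_add by blast
  have "\<iota> (b * d) \<otimes> (h1 \<oplus> h2) = \<iota> d \<otimes> (\<iota> b \<otimes> h1) \<oplus> \<iota> b \<otimes> (\<iota> d \<otimes> h2)"
    unfolding iota_mult using h iota_closed[of b] iota_closed[of d] by algebra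
  also have "\<dots> = \<iota> (d * a + b * c)"
    unfolding ab(2,4) iota_mult iota_add ..
  finally show ?case using ab by (metis mult_eq_0_iff)
next
  case (eng_mult h1 h2)
  have h: "h1 \<in> carrier R" "h2 \<in> carrier R"
    using eng_mult generate_field_in_carrier[of "{}"] by blast+
  obtain a b c d where ab: "b \<noteq> 0" "\<iota> b \<otimes> h1 = \<iota> a" "d \<noteq> 0" "\<iota> d \<otimes> h2 = \<iota> c" using eng_mult by blast
  have "\<iota> (b * d) \<otimes> (h1 \<otimes> h2) = (\<iota> b \<otimes> h1) \<otimes> (\<iota> d \<otimes> h2)"
    unfolding iota_mult using h iota_closed[of b] iota_closed[of d] by algebra
  also have "\<dots> = \<iota> (a * c)"
    unfolding ab(2,4) iota_mult ..
  finally show ?case using ab by (metis mult_eq_0_iff)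
qed

lemma common_denominator:
  "set Ks \<subseteq> generate_field R {} \<Longrightarrow> \<exists>b cs. b \<noteq> 0 \<and> map (\<lambda>k. \<iota> b \<otimes> k) Ks = map \<iota> cs"
proof (induct Ks)
  case Nil
  show ?case by (intro exI[of _ 1] exI[of _ "[]"]) simp
next
  case (Cons k Ks)
  have kc: "k \<in> carrier R" "set Ks \<subseteq> carrier R"
    using Cons(2) generate_field_in_carrier[of "{}"] by auto
  obtain b cs where b: "b \<noteq> 0" "map (\<lambda>k. \<iota> b \<otimes> k) Ks = map \<iota> cs" using Cons by auto
  obtain a d where a: "d \<noteq> 0" "\<iota> d \<otimes> k = \<iota> a" using Cons(2) prime_field_fraction[of k] by auto
  have "map (\<lambda>k. \<iota> (d * b) \<otimes> k) Ks = map (\<lambda>x. \<iota> d \<otimes> x) (map (\<lambda>k. \<iota> b \<otimes> k) Ks)"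
    using kc by (auto simp: iota_mult m_assoc)
  also have "\<dots> = map \<iota> (map (\<lambda>c. d * c) cs)"
    unfolding b(2) by (simp add: iota_mult)
  finally have 1: "map (\<lambda>k. \<iota> (d * b) \<otimes> k) Ks = map \<iota> (map (\<lambda>c. d * c) cs)" .
  have "\<iota> (d * b) \<otimes> k = \<iota> b \<otimes> (\<iota> d \<otimes> k)"
    unfolding iota_mult using kc iota_closed[of b] iota_closed[of d] by algebra
  also have "\<dots> = \<iota> (b * a)" unfolding a(2) iota_mult ..
  finally have "map (\<lambda>k. \<iota> (d * b) \<otimes> k) (k # Ks) = map \<iota> ((b * a) # map (\<lambda>c. d * c) cs)"
    using 1 by simp
  moreover have "d * b \<noteq> 0" using a b by simp
  ultimately show ?case by blast
qed

text \<open>\<open>n\<close> is the degree over the prime field: longer lists are dependent over it,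
  and clearing denominators makes the coefficients integers.\<close>

lemma relation_exists:
  "\<exists>n. \<forall>Us. set Us \<subseteq> carrier R \<longrightarrow> length Us > n \<longrightarrow>
    (\<exists>cs. length cs = length Us \<and> (\<exists>c\<in>set cs. c \<noteq> 0) \<and> combine (map \<iota> cs) Us = \<zero>)"
proof -
  let ?Q = "generate_field R {}"
  have Q: "subfield ?Q R" using generate_field_is_subfield[of "{}"] by simp
  have Qc: "?Q \<subseteq> carrier R" using subfieldE(3)[OF Q] .
  obtain n where n: "dimension n ?Q (carrier R)" using findim by auto
  have "\<exists>cs. length cs = length Us \<and> (\<exists>c\<in>set cs. c \<noteq> 0) \<and> combine (map \<iota> cs) Us = \<zero>"
    if Us: "set Us \<subseteq> carrier R" "length Us > n" for Us
  proof -
    have "\<not> independent ?Q Us"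
      using independent_length_le_dimension[OF Q n _ Us(1)] Us(2) by auto
    then obtain Ks where Ks: "length Ks = length Us" "combine Ks Us = \<zero>" "set Ks \<subseteq> ?Q" "set Ks \<noteq> {\<zero>}"
      using dependent_imp_non_trivial_combine[OF Q Us(1)] by blast
    have "set Ks \<noteq> {}" using Us Ks by auto
    then have "\<not> set Ks \<subseteq> {\<zero>}" using Ks(4) by (metis subset_singletonD)
    then obtain k where k: "k \<in> set Ks" "k \<noteq> \<zero>" by blast
    obtain b cs where b: "b \<noteq> 0" "map (\<lambda>k. \<iota> b \<otimes> k) Ks = map \<iota> cs"
      using common_denominator[OF Ks(3)] by blast
    have "\<iota> b \<otimes> k \<in> set (map \<iota> cs)" using k(1) unfolding b(2)[symmetric] by auto
    moreover have "\<iota> b \<otimes> k \<noteq> \<zero>"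
      using integral[of "\<iota> b" k] k b Ks(3) Qc iota_eq_0 by auto
    ultimately have "\<exists>c\<in>set cs. c \<noteq> 0" using iota_eq_0 by auto
    moreover have "combine (map \<iota> cs) Us = \<zero>"
      using combine_r_distr[of Ks Us "\<iota> b"] Ks Us Qc b(2) by auto
    moreover have "length cs = length Us" using Ks(1) b(2) by (metis length_map)
    ultimately show ?thesis by blast
  qed
  then show ?thesis by blast
qed

text \<open>Meant for the division \<open>e = e mod p + p * (e div p)\<close> carried out on all
  coefficients at once; with \<open>f\<close> zero it becomes \<open>combine_scale\<close>.\<close>

lemma combine_linear:
  "set Us \<subseteq> carrier R \<Longrightarrow>
    combine (map (\<lambda>e. \<iota> (f e + p * g e)) es) Us =
    combine (map (\<lambda>e. \<iota> (f e)) es) Us \<oplus> \<iota> p \<otimes> combine (map (\<lambda>e. \<iota> (g e)) es) Us"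
proof (induct es arbitrary: Us)
  case Nil
  then show ?case by simp
next
  case (Cons e es)
  show ?case
  proof (cases Us)
    case Nil
    then show ?thesis by simp
  next
    case (Cons u Vs)
    define W Y Z where "W = combine (map (\<lambda>e. \<iota> (f e + p * g e)) es) Vs"
      and "Y = combine (map (\<lambda>e. \<iota> (f e)) es) Vs" and "Z = combine (map (\<lambda>e. \<iota> (g e)) es) Vs"
    have V: "set Vs \<subseteq> carrier R" "u \<in> carrier R" using Cons Cons.prems by auto
    have c: "Y \<in> carrier R" "Z \<in> carrier R"
      unfolding Y_def Z_def using V by (auto intro!: combine_in_carrier)
    have "W = Y \<oplus> \<iota> p \<otimes> Z" unfolding W_def Y_def Z_def using Cons.hyps[OF V(1)] .
    then have "\<iota> (f e + p * g e) \<otimes> u \<oplus> W = (\<iota> (f e) \<otimes> u \<oplus> Y) \<oplus> \<iota> p \<otimes> (\<iota> (g e) \<otimes> u \<oplus> Z)"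
      unfolding iota_add iota_mult
      using c V(2) iota_closed[of p] iota_closed[of "f e"] iota_closed[of "g e"] by algebra
    then show ?thesis unfolding Cons W_def Y_def Z_def by simp
  qed
qed

lemma combine_zero: "set Us \<subseteq> carrier R \<Longrightarrow> combine (map (\<lambda>e. \<zero>) es) Us = \<zero>"
proof (induct es arbitrary: Us)
  case (Cons e es)
  then show ?case by (cases Us) auto
qed simp

lemma combine_scale:
  assumes "set Us \<subseteq> carrier R"
  shows "combine (map (\<lambda>e. \<iota> (p * g e)) es) Us = \<iota> p \<otimes> combine (map (\<lambda>e. \<iota> (g e)) es) Us"
proof -
  have "combine (map (\<lambda>e. \<iota> (g e)) es) Us \<in> carrier R"
    using assms by (intro combine_in_carrier) auto
  then show ?thesis
    using combine_linear[OF assms, of "\<lambda>_. 0" p g es] by (simp add: iota_0 combine_zero[OF assms])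
qed

text \<open>The powers are listed in descending order, so the head of \<open>cs\<close> belongs to
  the highest power; zero heads are dropped until a nonzero leading coefficient appears.\<close>

lemma algebraic_relation:
  assumes a: "a \<in> carrier R"
  shows "length cs = m \<Longrightarrow> \<exists>c\<in>set cs. c \<noteq> 0 \<Longrightarrow>
    combine (map \<iota> cs) (map (\<lambda>i::nat. a [^] i) (rev [0..<m])) = \<zero> \<Longrightarrow>
    \<exists>k c ds. c \<noteq> 0 \<and> length ds = k \<and>
      \<iota> c \<otimes> a [^] k \<oplus> combine (map \<iota> ds) (map (\<lambda>i::nat. a [^] i) (rev [0..<k])) = \<zero>"
proof (induct m arbitrary: cs)
  case 0
  then show ?case by simp
next
  case (Suc m)
  obtain c ds where cs: "cs = c # ds" using Suc(2) by (cases cs) auto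
  have ds: "length ds = m" using Suc(2) cs by simp
  let ?P = "map (\<lambda>i::nat. a [^] i) (rev [0..<m])"
  have eq: "\<iota> c \<otimes> a [^] m \<oplus> combine (map \<iota> ds) ?P = \<zero>"
    using Suc(4) cs by simp
  show ?case
  proof (cases "c = 0")
    case True
    have "combine (map \<iota> ds) ?P \<in> carrier R" using a by (intro combine_in_carrier) auto
    then have "combine (map \<iota> ds) ?P = \<zero>" using eq a True by (simp add: iota_0)
    then show ?thesis using Suc(1)[OF ds] Suc(3) True cs by auto
  next
    case False
    then show ?thesis using ds eq by blast
  qed
qed

lemma iota_power:
  assumes "a \<in> carrier R" shows "\<iota> (c ^ k) \<otimes> a [^] k = (\<iota> c \<otimes> a) [^] (k::nat)"
proof (induct k)
  case (Suc k)
  have "\<iota> (c ^ Suc k) \<otimes> a [^] Suc k = (\<iota> (c ^ k) \<otimes> a [^] k) \<otimes> (\<iota> c \<otimes> a)"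
    using assms iota_mult[of c "c ^ k"] by (simp add: m_ac)
  then show ?case using Suc by simp
qed (simp add: iota_1)

text \<open>The factor \<open>c^m\<close> provides \<open>c^i\<close> for every power
  \<open>a^i\<close> with \<open>i\<close> at most \<open>m\<close>, which turns powers of
  \<open>a\<close> into integer multiples of powers of \<open>b\<close>.\<close>

lemma scaled_combination:
  assumes a: "a \<in> carrier R" and b: "b = \<iota> c \<otimes> a"
  shows "length ds = Suc m \<Longrightarrow>
    \<iota> (c ^ m) \<otimes> combine (map \<iota> ds) (map (\<lambda>i::nat. a [^] i) (rev [0..<Suc m]))
      \<in> zspan ((\<lambda>i::nat. b [^] i) ` {..<Suc m})"
proof (induct m arbitrary: ds)
  case 0
  then obtain d where "ds = [d]" by (auto simp: length_Suc_conv)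
  moreover have "\<iota> d \<otimes> \<one> \<in> zspan {\<one>}"
    by (rule zspan_int) (auto intro: zspan.incl)
  ultimately show ?case by (simp add: iota_1 lessThan_Suc)
next
  case (Suc m)
  obtain d es where ds: "ds = d # es" "length es = Suc m" using Suc(2) by (cases ds) auto
  let ?G = "(\<lambda>i::nat. b [^] i) ` {..<Suc (Suc m)}"
  have bc: "b \<in> carrier R" using a b by simp
  have G: "?G \<subseteq> carrier R" using bc by auto
  define Z where "Z = combine (map \<iota> es) (map (\<lambda>i::nat. a [^] i) (rev [0..<Suc m]))"
  have Zc: "Z \<in> carrier R"
    unfolding Z_def using a by (intro combine_in_carrier) auto
  have "\<iota> (c ^ m) \<otimes> Z \<in> zspan ((\<lambda>i::nat. b [^] i) ` {..<Suc m})"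
    unfolding Z_def using Suc(1)[OF ds(2)] .
  then have "\<iota> (c ^ m) \<otimes> Z \<in> zspan ?G"
    by (rule subsetD[OF zspan_mono, rotated]) (intro image_mono, auto)
  then have 1: "\<iota> c \<otimes> (\<iota> (c ^ m) \<otimes> Z) \<in> zspan ?G" by (rule zspan_int[OF G])
  have 2: "\<iota> d \<otimes> b [^] Suc m \<in> zspan ?G"
    by (rule zspan_int[OF G], rule zspan.incl, rule imageI) simp
  have "\<iota> (c ^ Suc m) \<otimes> (\<iota> d \<otimes> a [^] Suc m \<oplus> Z) =
      \<iota> d \<otimes> (\<iota> (c ^ Suc m) \<otimes> a [^] Suc m) \<oplus> \<iota> (c ^ Suc m) \<otimes> Z"
    using Zc a iota_closed[of d] iota_closed[of "c ^ Suc m"] nat_pow_closed[OF a, of "Suc m"]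
    by algebra
  also have "\<iota> (c ^ Suc m) \<otimes> a [^] Suc m = b [^] Suc m"
    unfolding b by (rule iota_power[OF a])
  also have "\<iota> (c ^ Suc m) \<otimes> Z = \<iota> c \<otimes> (\<iota> (c ^ m) \<otimes> Z)"
    using Zc by (simp add: iota_mult m_assoc)
  finally have "\<iota> (c ^ Suc m) \<otimes> (\<iota> d \<otimes> a [^] Suc m \<oplus> Z) \<in> zspan ?G"
    using zspan.add[OF 2 1] by (simp only:)
  moreover have "combine (map \<iota> ds) (map (\<lambda>i::nat. a [^] i) (rev [0..<Suc (Suc m)])) =
      \<iota> d \<otimes> a [^] Suc m \<oplus> Z"
    unfolding ds(1) Z_def by (simp del: nat_pow_Suc)
  ultimately show ?case by (simp only:)
qed

text \<open>If \<open>c\<close> is the leading coefficient of an integer relation of degree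
  \<open>k\<close> for \<open>a\<close>, then multiplying the relation by \<open>c^(k-1)\<close>
  makes it monic in \<open>c a\<close>.\<close>

lemma integral_multiple:
  assumes a: "a \<in> carrier R" shows "\<exists>c. c \<noteq> 0 \<and> intg (\<iota> c \<otimes> a)"
proof -
  obtain n where n: "\<forall>Us. set Us \<subseteq> carrier R \<longrightarrow> length Us > n \<longrightarrow>
    (\<exists>cs. length cs = length Us \<and> (\<exists>c\<in>set cs. c \<noteq> 0) \<and> combine (map \<iota> cs) Us = \<zero>)"
    using relation_exists by blast
  have "\<exists>cs. length cs = Suc n \<and> (\<exists>c\<in>set cs. c \<noteq> 0) \<and>
      combine (map \<iota> cs) (map (\<lambda>i::nat. a [^] i) (rev [0..<Suc n])) = \<zero>"
    using n[rule_format, of "map (\<lambda>i::nat. a [^] i) (rev [0..<Suc n])"] a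
    by (auto simp del: upt_Suc)
  then obtain k c ds where r: "c \<noteq> 0" "length ds = k"
      "\<iota> c \<otimes> a [^] k \<oplus> combine (map \<iota> ds) (map (\<lambda>i::nat. a [^] i) (rev [0..<k])) = \<zero>"
    using algebraic_relation[OF a] by blast
  have "k \<noteq> 0"
  proof
    assume "k = 0"
    then have "\<iota> c = \<zero>" using r by simp
    then show False using r iota_eq_0 by simp
  qed
  then obtain m where m: "k = Suc m" by (cases k) auto
  define b Z where "b = \<iota> c \<otimes> a"
    and "Z = combine (map \<iota> ds) (map (\<lambda>i::nat. a [^] i) (rev [0..<Suc m]))"
  have bc: "b \<in> carrier R" unfolding b_def using a by simp
  have Zc: "Z \<in> carrier R"
    unfolding Z_def using a by (intro combine_in_carrier) auto
  have 0: "\<iota> c \<otimes> a [^] k \<oplus> Z = \<zero>" using r(3) m unfolding Z_def by simp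
  have Zs: "\<iota> (c ^ m) \<otimes> Z \<in> zspan ((\<lambda>i::nat. b [^] i) ` {..<k})"
    unfolding Z_def m using scaled_combination[OF a b_def] r(2) m by blast
  define A where "A = a [^] k"
  have Ac: "A \<in> carrier R" unfolding A_def using a by simp
  have "b [^] k = \<iota> (c ^ m) \<otimes> (\<iota> c \<otimes> A)"
    unfolding b_def iota_power[OF a, symmetric] A_def m using a by (simp add: iota_mult m_ac)
  also have "\<dots> = \<iota> (c ^ m) \<otimes> (\<iota> c \<otimes> A \<oplus> Z) \<ominus> \<iota> (c ^ m) \<otimes> Z"
    using Ac Zc iota_closed[of c] iota_closed[of "c ^ m"] by algebra
  also have "\<dots> = \<ominus> (\<iota> (c ^ m) \<otimes> Z)"
    using 0 Zc unfolding A_def by (simp add: a_minus_def)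
  finally have "b [^] k \<in> zspan ((\<lambda>i::nat. b [^] i) ` {..<k})"
    using zspan.neg[OF Zs] by simp
  then have "intg b" unfolding intg_def using bc by blast
  then show ?thesis using r(1) unfolding b_def by blast
qed

lemma ZI_closed: "intg x \<Longrightarrow> intg y \<Longrightarrow> intg (x \<oplus> y)" "intg x \<Longrightarrow> intg y \<Longrightarrow> intg (x \<otimes> y)"
  "intg x \<Longrightarrow> intg y \<Longrightarrow> intg (x \<ominus> y)" "intg \<zero>" "intg \<one>"
  using intg_add_mult intg_minus intg_iota[of 0] intg_iota[of 1]
  by (auto simp: a_minus_def iota_0 iota_1)

text \<open>For prime \<open>p\<close> this is linear independence of the residue classes modulo
  \<open>p\<close> over the field with \<open>p\<close> elements, phrased in the ring of integers
  itself.\<close>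

definition pfree :: "int \<Rightarrow> 'a list \<Rightarrow> bool" where
  "pfree p Us \<longleftrightarrow> set Us \<subseteq> ZI \<and>
    (\<forall>cs. length cs = length Us \<longrightarrow> (\<exists>y\<in>ZI. combine (map \<iota> cs) Us = \<iota> p \<otimes> y) \<longrightarrow> (\<forall>c\<in>set cs. p dvd c))"

lemma ZI_carrier: "set Us \<subseteq> ZI \<Longrightarrow> set Us \<subseteq> carrier R"
  using intg_carrier by auto

lemma combine_intg: "set Us \<subseteq> ZI \<Longrightarrow> intg (combine (map \<iota> cs) Us)"
proof (induct cs arbitrary: Us)
  case Nil
  then show ?case using ZI_closed by simp
next
  case (Cons c cs)
  then show ?case using ZI_closed intg_iota by (cases Us) auto
qed

text \<open>Descent: the coefficients of a relation are all divisible by \<open>p\<close>, and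
  dividing them by \<open>p\<close> leaves a relation again, since \<open>p\<close> is nonzero in
  the field. Each round contributes one factor \<open>p\<close>.\<close>

lemma pfree_relation_dvd:
  assumes p: "prime p" and free: "pfree p Us"
  shows "length cs = length Us \<Longrightarrow> combine (map \<iota> cs) Us = \<zero> \<Longrightarrow> \<forall>c\<in>set cs. p ^ k dvd c"
proof (induct k arbitrary: cs)
  case 0
  then show ?case by simp
next
  case (Suc k)
  note U = ZI_carrier[of Us]
  have UZ: "set Us \<subseteq> ZI" using free unfolding pfree_def by blast
  have "combine (map \<iota> cs) Us = \<iota> p \<otimes> \<zero>" using Suc by simp
  then have dvd: "\<forall>c\<in>set cs. p dvd c"
    using free Suc(2) ZI_closed(4) unfolding pfree_def by blast
  define ds where "ds = map (\<lambda>c. c div p) cs"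
  have "map (\<lambda>c. \<iota> (p * (c div p))) cs = map \<iota> cs"
    using dvd by (intro map_cong) auto
  moreover have "map (\<lambda>c. \<iota> (c div p)) cs = map \<iota> ds" unfolding ds_def by simp
  ultimately have "\<iota> p \<otimes> combine (map \<iota> ds) Us = \<zero>"
    using combine_scale[OF U[OF UZ], of p "\<lambda>c. c div p" cs] Suc(3) by (simp only:)
  moreover have "combine (map \<iota> ds) Us \<in> carrier R"
    using combine_intg[OF UZ] intg_carrier by blast
  moreover have "\<iota> p \<noteq> \<zero>" using p iota_eq_0 by auto
  ultimately have "combine (map \<iota> ds) Us = \<zero>"
    using integral[of "\<iota> p"] by auto
  then have "\<forall>d\<in>set ds. p ^ k dvd d" using Suc(1)[of ds] Suc(2) ds_def by simp
  then show ?case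
    unfolding ds_def using dvd p by (auto simp: mult_dvd_mono elim!: dvdE dest!: bspec)
qed

lemma pfree_relation_zero:
  assumes p: "prime p" and free: "pfree p Us"
    and cs: "length cs = length Us" "combine (map \<iota> cs) Us = \<zero>" and c: "c \<in> set cs"
  shows "c = 0"
proof (rule ccontr)
  assume "c \<noteq> 0"
  \<comment> \<open>The exponent \<open>|c|\<close> is already too large: \<open>p^|c|\<close> is at
    least \<open>2^|c|\<close>, which exceeds \<open>|c|\<close>.\<close>
  have "p ^ nat \<bar>c\<bar> dvd c" using pfree_relation_dvd[OF p free cs] c by blast
  then have "\<bar>p ^ nat \<bar>c\<bar>\<bar> \<le> \<bar>c\<bar>" using \<open>c \<noteq> 0\<close> dvd_imp_le_int by blast
  moreover have "p \<ge> 2" using p prime_ge_2_int by blast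
  moreover have "(2::int) ^ nat \<bar>c\<bar> \<le> p ^ nat \<bar>c\<bar>" using \<open>p \<ge> 2\<close> by (intro power_mono) auto
  moreover have "\<bar>c\<bar> < 2 ^ nat \<bar>c\<bar>"
    using of_nat_less_two_power[of "nat \<bar>c\<bar>", where 'a = int] by simp
  ultimately show False by linarith
qed

text \<open>Lists independent modulo \<open>p\<close> are independent over the integers, so
  \<open>n\<close> bounds their length. A longest one spans everything modulo \<open>p\<close>, and
  coefficients from 0 to \<open>p - 1\<close> suffice.\<close>

lemma prime_quotient_finite:
  assumes p: "prime (p::int)"
  shows "\<exists>S. finite S \<and> S \<subseteq> ZI \<and> (\<forall>x\<in>ZI. \<exists>s\<in>S. \<exists>r\<in>ZI. x = s \<oplus> \<iota> p \<otimes> r)"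
proof -
  obtain n where n: "\<forall>Us. set Us \<subseteq> carrier R \<longrightarrow> length Us > n \<longrightarrow>
    (\<exists>cs. length cs = length Us \<and> (\<exists>c\<in>set cs. c \<noteq> 0) \<and> combine (map \<iota> cs) Us = \<zero>)"
    using relation_exists by blast
  have bound: "length Us \<le> n" if "pfree p Us" for Us
  proof (rule ccontr)
    assume "\<not> ?thesis"
    moreover have "set Us \<subseteq> carrier R" using that ZI_carrier unfolding pfree_def by blast
    ultimately obtain cs where "length cs = length Us" "\<exists>c\<in>set cs. c \<noteq> 0" "combine (map \<iota> cs) Us = \<zero>"
      using n[rule_format, of Us] by (auto simp: not_le)
    then show False using pfree_relation_zero[OF p that] by blast
  qed
  have "pfree p []" unfolding pfree_def by simp
  then have "\<exists>Us. pfree p Us \<and> (\<forall>Vs. pfree p Vs \<longrightarrow> length Vs \<le> length Us)"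
    by (rule ex_has_greatest_nat[where b = "Suc n"]) (intro allI impI le_imp_less_Suc bound)
  then obtain Us where Us: "pfree p Us" "\<And>Vs. pfree p Vs \<Longrightarrow> length Vs \<le> length Us"
    by (elim exE conjE) simp
  have UZ: "set Us \<subseteq> ZI" using Us(1) unfolding pfree_def by blast
  note Uc = ZI_carrier[OF UZ]
  define S where "S = (\<lambda>cs. combine (map \<iota> cs) Us) ` {cs. set cs \<subseteq> {0..<p} \<and> length cs = length Us}"
  have "finite S"
    unfolding S_def by (intro finite_imageI finite_lists_length_eq) simp
  moreover have "S \<subseteq> ZI" unfolding S_def using combine_intg[OF UZ] by auto
  moreover have "\<exists>s\<in>S. \<exists>r\<in>ZI. x = s \<oplus> \<iota> p \<otimes> r" if x: "x \<in> ZI" for x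
  proof -
    have "\<not> pfree p (x # Us)" using Us(2)[of "x # Us"] by auto
    then obtain cs y where cs: "length cs = length (x # Us)" "y \<in> ZI"
      "combine (map \<iota> cs) (x # Us) = \<iota> p \<otimes> y" "\<not> (\<forall>c\<in>set cs. p dvd c)"
      using x UZ unfolding pfree_def by auto
    obtain c ds where cd: "cs = c # ds" "length ds = length Us" using cs(1) by (cases cs) auto
    define Y where "Y = combine (map \<iota> ds) Us"
    have c: "x \<in> carrier R" "y \<in> carrier R" "Y \<in> carrier R"
      unfolding Y_def using x cs(2) intg_carrier combine_intg[OF UZ] by auto
    have eq: "\<iota> c \<otimes> x \<oplus> Y = \<iota> p \<otimes> y" using cs(3) unfolding cd(1) Y_def by simp
    \<comment> \<open>If \<open>p\<close> divided \<open>c\<close>, the term in \<open>x\<close>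
      could be absorbed into the right-hand side, and independence of \<open>Us\<close> would make
      \<open>p\<close> divide the remaining coefficients too.\<close>
    have "\<not> p dvd c"
    proof
      assume "p dvd c"
      then obtain k where k: "c = p * k" by blast
      have "Y = \<iota> p \<otimes> y \<ominus> \<iota> c \<otimes> x"
        unfolding eq[symmetric] using c iota_closed[of c] by algebra
      also have "\<dots> = \<iota> p \<otimes> (y \<ominus> \<iota> k \<otimes> x)"
        unfolding k iota_mult using c iota_closed[of p] iota_closed[of k] by algebra
      finally have "Y = \<iota> p \<otimes> (y \<ominus> \<iota> k \<otimes> x)" .
      moreover have "y \<ominus> \<iota> k \<otimes> x \<in> ZI" using ZI_closed intg_iota x cs(2) by simp
      ultimately have "\<forall>c\<in>set ds. p dvd c"
        using Us(1) cd(2) unfolding pfree_def Y_def by blast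
      then show False using cs(4) cd(1) \<open>p dvd c\<close> by simp
    qed
    then have "coprime c p" using p by (metis prime_imp_coprime coprime_commute)
    then obtain u v where uv: "u * c + v * p = 1" using bezout_int[of c p] by (auto simp: coprime_iff_gcd_eq_1)
    \<comment> \<open>\<open>u\<close> inverts \<open>c\<close> modulo \<open>p\<close>, so
      \<open>x\<close> is congruent to \<open>- u\<close> times \<open>Y\<close>; \<open>es\<close>
      holds the coefficients of that combination, which are then reduced modulo
      \<open>p\<close>.\<close>
    define es where "es = map (\<lambda>d. (- u) * d) ds"
    have Es: "combine (map \<iota> es) Us = \<iota> (- u) \<otimes> Y"
      using combine_scale[OF Uc, of "- u" "\<lambda>d. d" ds] unfolding es_def Y_def by (simp add: comp_def)
    define s t where "s = combine (map \<iota> (map (\<lambda>e. e mod p) es)) Us"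
      and "t = combine (map \<iota> (map (\<lambda>e. e div p) es)) Us"
    have st: "combine (map \<iota> es) Us = s \<oplus> \<iota> p \<otimes> t"
      using combine_linear[OF Uc, of "\<lambda>e. e mod p" p "\<lambda>e. e div p" es] unfolding s_def t_def
      by (simp add: comp_def)
    have stZ: "s \<in> ZI" "t \<in> ZI"  unfolding s_def t_def mem_Collect_eq by (rule combine_intg[OF UZ])+
    have "x = \<iota> (u * c + v * p) \<otimes> x" using uv c by (simp add: iota_1)
    also have "\<dots> = \<iota> u \<otimes> (\<iota> c \<otimes> x \<oplus> Y) \<oplus> \<iota> (- u) \<otimes> Y \<oplus> \<iota> p \<otimes> (\<iota> v \<otimes> x)"
      unfolding iota_add iota_mult iota_minus
      using c iota_closed[of u] iota_closed[of c] iota_closed[of v] iota_closed[of p] by algebra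
    also have "\<dots> = \<iota> u \<otimes> (\<iota> p \<otimes> y) \<oplus> (s \<oplus> \<iota> p \<otimes> t) \<oplus> \<iota> p \<otimes> (\<iota> v \<otimes> x)"
      unfolding eq Es[symmetric] st ..
    also have "\<dots> = s \<oplus> \<iota> p \<otimes> (\<iota> u \<otimes> y \<oplus> t \<oplus> \<iota> v \<otimes> x)"
      using c iota_closed[of u] iota_closed[of v] iota_closed[of p]
        intg_carrier[of s] intg_carrier[of t] stZ by (simp only: mem_Collect_eq) algebra
    finally have "x = s \<oplus> \<iota> p \<otimes> (\<iota> u \<otimes> y \<oplus> t \<oplus> \<iota> v \<otimes> x)" .
    moreover have "\<iota> u \<otimes> y \<oplus> t \<oplus> \<iota> v \<otimes> x \<in> ZI" using ZI_closed intg_iota x cs(2) stZ by simp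
    moreover have "s \<in> S"
      unfolding S_def s_def using p cd(2) prime_gt_0_int[OF p] es_def
      by (intro imageI) auto
    ultimately show ?thesis by blast
  qed
  ultimately show ?thesis by blast
qed

text \<open>Induction along prime factors: for \<open>n = p * m\<close>, the sums of
  \<open>s\<close> and \<open>m\<close> times \<open>t\<close> represent everything modulo
  \<open>n\<close>, with \<open>s\<close> running over representatives modulo \<open>m\<close> and
  \<open>t\<close> over those modulo \<open>p\<close>.\<close>

lemma int_quotient_finite:
  "n > 0 \<Longrightarrow> \<exists>S. finite S \<and> S \<subseteq> ZI \<and> (\<forall>x\<in>ZI. \<exists>s\<in>S. \<exists>r\<in>ZI. x = s \<oplus> \<iota> (int n) \<otimes> r)"
proof (induct n rule: less_induct)
  case (less n)
  show ?case
  proof (cases "n = 1")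
    case True
    have "\<forall>x\<in>ZI. x = \<zero> \<oplus> \<iota> (int n) \<otimes> x" using True intg_carrier by (simp add: iota_1)
    then show ?thesis
      using ZI_closed(4) by (intro exI[of _ "{\<zero>}"]) auto
  next
    case False
    then obtain p where p: "prime p" "p dvd n" using prime_factor_nat by blast
    then obtain m where m: "n = p * m" by blast
    have "m > 0" "m < n" using m less(2) prime_gt_1_nat[OF p(1)] by auto
    then obtain S where S: "finite S" "S \<subseteq> ZI" "\<forall>x\<in>ZI. \<exists>s\<in>S. \<exists>r\<in>ZI. x = s \<oplus> \<iota> (int m) \<otimes> r"
      using less(1)[of m] by blast
    have "prime (int p)" using p by simp
    obtain T where T: "finite T" "T \<subseteq> ZI" "\<forall>x\<in>ZI. \<exists>s\<in>T. \<exists>r\<in>ZI. x = s \<oplus> \<iota> (int p) \<otimes> r"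
      using prime_quotient_finite[OF \<open>prime (int p)\<close>] by (elim exE conjE) simp
    let ?S = "(\<lambda>(s, t). s \<oplus> \<iota> (int m) \<otimes> t) ` (S \<times> T)"
    have "\<exists>s\<in>?S. \<exists>r\<in>ZI. x = s \<oplus> \<iota> (int n) \<otimes> r" if x: "x \<in> ZI" for x
    proof -
      obtain s r where s: "s \<in> S" "r \<in> ZI" "x = s \<oplus> \<iota> (int m) \<otimes> r" using S(3) x by blast
      obtain t q where t: "t \<in> T" "q \<in> ZI" "r = t \<oplus> \<iota> (int p) \<otimes> q" using T(3) s(2) by blast
      have c: "s \<in> carrier R" "t \<in> carrier R" "q \<in> carrier R"
        using s t S T intg_carrier by auto
      have "x = (s \<oplus> \<iota> (int m) \<otimes> t) \<oplus> \<iota> (int p * int m) \<otimes> q"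
        unfolding s(3) t(3) iota_mult using c iota_closed[of "int m"] iota_closed[of "int p"] by algebra
      then have "x = (s \<oplus> \<iota> (int m) \<otimes> t) \<oplus> \<iota> (int n) \<otimes> q" unfolding m by simp
      moreover have "s \<oplus> \<iota> (int m) \<otimes> t \<in> ?S" using s(1) t(1) by force
      ultimately show ?thesis using t(2) by (intro bexI[of _ "s \<oplus> \<iota> (int m) \<otimes> t"] bexI[of _ q])
    qed
    moreover have "finite ?S" using S T by simp
    moreover have "?S \<subseteq> ZI"
    proof clarsimp
      fix s t assume "s \<in> S" "t \<in> T"
      then have "intg s" "intg t" using S(2) T(2) by auto
      then show "intg (s \<oplus> \<iota> (int m) \<otimes> t)" by (intro ZI_closed(1,2) intg_iota)
    qed
    ultimately show ?thesis by blast
  qed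
qed

text \<open>Up to sign, the constant term of a monic relation of least degree for \<open>a\<close>
  is the desired multiple. It is nonzero, for otherwise cancelling \<open>a\<close> would leave a
  shorter monic relation.\<close>

lemma divides_integer:
  assumes "intg a" "a \<noteq> \<zero>" shows "\<exists>b\<in>ZI. \<exists>n::nat. n > 0 \<and> a \<otimes> b = \<iota> (int n)"
proof -
  note ac = intg_carrier[OF assms(1)]
  have "\<exists>n::nat. a [^] n \<in> zspan ((\<lambda>i::nat. a [^] i) ` {..<n})"
    using assms(1) unfolding intg_def by blast
  then obtain n :: nat where n: "a [^] n \<in> zspan ((\<lambda>i::nat. a [^] i) ` {..<n})"
    and min: "\<And>m. m < n \<Longrightarrow> a [^] m \<notin> zspan ((\<lambda>i::nat. a [^] i) ` {..<m})"
    using exists_least_iff[of "\<lambda>n::nat. a [^] n \<in> zspan ((\<lambda>i::nat. a [^] i) ` {..<n})"] by blast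
  have "n \<noteq> 0" using n by (intro notI) (simp add: zspan_empty)
  then obtain m where m: "n = Suc m" by (cases n) auto
  let ?G = "(\<lambda>i::nat. a [^] i) ` {..<m}"
  have G: "?G \<subseteq> carrier R" using ac by auto
  let ?H = "(\<lambda>g. a \<otimes> g) ` ?G"
  \<comment> \<open>Splitting off the exponent 0 isolates the constant term; the remaining powers
    are all multiples of \<open>a\<close>.\<close>
  have "(\<lambda>i::nat. a [^] i) ` {..<n} = insert \<one> ?H"
  proof -
    have "{..<n} = insert 0 (Suc ` {..<m})" unfolding m by (rule lessThan_Suc_eq_insert_0)
    then show ?thesis using ac by (auto simp: image_image m_comm)
  qed
  then have an: "a [^] n \<in> zspan (insert \<one> ?H)" using n by (simp only:)
  have Hc: "?H \<subseteq> carrier R" using ac by auto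
  obtain c r where r: "r \<in> zspan ?H" "a [^] n = \<iota> c \<otimes> \<one> \<oplus> r"
    by (rule zspan_insertE[OF an one_closed Hc])
  have "\<exists>y\<in>zspan ?G. z = a \<otimes> y" if "z \<in> zspan ?H" for z
    using that
  proof induct
    case zero
    show ?case using ac zspan.zero by (intro bexI[of _ \<zero>]) auto
  next
    case (incl s)
    then obtain g where "g \<in> ?G" "s = a \<otimes> g" by (rule imageE)
    then show ?case by (intro bexI[of _ g] zspan.incl)
  next
    case (add x y)
    then obtain x' y' where *: "x' \<in> zspan ?G" "y' \<in> zspan ?G" "x = a \<otimes> x'" "y = a \<otimes> y'" by blast
    have "x \<oplus> y = a \<otimes> (x' \<oplus> y')"
      unfolding *(3,4) using ac zspan_carrier[OF G *(1)] zspan_carrier[OF G *(2)] by algebra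
    then show ?case using zspan.add[OF *(1,2)] by blast
  next
    case (neg x)
    then obtain x' where *: "x' \<in> zspan ?G" "x = a \<otimes> x'" by blast
    have "\<ominus> x = a \<otimes> (\<ominus> x')" unfolding *(2) using ac zspan_carrier[OF G *(1)] by algebra
    then show ?case using zspan.neg[OF *(1)] by blast
  qed
  then obtain y where y: "y \<in> zspan ?G" "r = a \<otimes> y" using r(1) by blast
  note yc = zspan_carrier[OF G y(1)]
  have powI: "intg (a [^] (i::nat))" for i
    by (induct i) (use ZI_closed assms(1) in auto)
  have "intg y" using y(1)
    by induct (use powI ZI_closed intg_minus in auto)
  define b where "b = a [^] m \<ominus> y"
  have bI: "intg b" unfolding b_def using ZI_closed(3)[OF powI \<open>intg y\<close>] .
  have ab: "a \<otimes> b = \<iota> c"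
  proof -
    have "a \<otimes> a [^] m = \<iota> c \<oplus> a \<otimes> y" using r(2) y(2) ac unfolding m by (simp add: m_comm)
    moreover have "a \<otimes> b = a \<otimes> a [^] m \<ominus> a \<otimes> y"
      unfolding b_def using ac yc nat_pow_closed[OF ac, of m] by algebra
    moreover have "(\<iota> c \<oplus> a \<otimes> y) \<ominus> a \<otimes> y = \<iota> c" using ac yc iota_closed[of c] by algebra
    ultimately show ?thesis by simp
  qed
  have "c \<noteq> 0"
  proof
    assume "c = 0"
    then have "b = \<zero>" using ab integral[of a b] ac bI intg_carrier assms(2) by (auto simp: iota_0)
    then have "a [^] m = y"
      unfolding b_def using ac yc by (simp add: r_right_minus_eq)
    then show False using min[of m] y(1) m by simp
  qed
  show ?thesis
  proof (cases "c > 0")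
    case True
    then show ?thesis using ab bI by (intro bexI[of _ b] exI[of _ "nat c"]) auto
  next
    case False
    have "a \<otimes> (\<ominus> b) = \<iota> (- c)" using ab ac intg_carrier[OF bI] by (simp add: r_minus iota_minus)
    then show ?thesis
      using False \<open>c \<noteq> 0\<close> bI intg_minus by (intro bexI[of _ "\<ominus> b"] exI[of _ "nat (- c)"]) auto
  qed
qed

lemma quotient_finite:
  assumes "a \<in> ZI" "a \<noteq> \<zero>"
  shows "\<exists>S. finite S \<and> S \<subseteq> ZI \<and> (\<forall>x\<in>ZI. \<exists>s\<in>S. \<exists>r\<in>ZI. x = s \<oplus> a \<otimes> r)"
proof -
  obtain b n where b: "b \<in> ZI" "(n::nat) > 0" "a \<otimes> b = \<iota> (int n)"
    using divides_integer assms by blast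
  obtain S where S: "finite S" "S \<subseteq> ZI" "\<forall>x\<in>ZI. \<exists>s\<in>S. \<exists>r\<in>ZI. x = s \<oplus> \<iota> (int n) \<otimes> r"
    using int_quotient_finite[OF b(2)] by blast
  have "\<exists>s\<in>S. \<exists>r\<in>ZI. x = s \<oplus> a \<otimes> r" if x: "x \<in> ZI" for x
  proof -
    obtain s r where s: "s \<in> S" "r \<in> ZI" "x = s \<oplus> \<iota> (int n) \<otimes> r" using S(3) x by blast
    have "x = s \<oplus> a \<otimes> (b \<otimes> r)"
      unfolding s(3) b(3)[symmetric] using b(1) assms(1) s(2) intg_carrier by (simp add: m_assoc)
    then show ?thesis using s b ZI_closed(2) by blast
  qed
  then show ?thesis using S by blast
qed

lemma ZI_completely_closed:
  assumes x: "x \<in> carrier R" and a: "a \<in> ZI" "a \<noteq> \<zero>" "\<And>k::nat. a \<otimes> x [^] k \<in> ZI"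
  shows "x \<in> ZI"
proof -
  have "\<exists>i j::nat. i < j \<and> (\<exists>t\<in>ZI. a \<otimes> x [^] i \<ominus> a \<otimes> x [^] j = a \<otimes> t)"
    by (rule pigeonhole_mod[OF intg_subring a(1) quotient_finite[OF a(1,2)]]) (rule a(3))
  then obtain i j :: nat and t where ij: "i < j" and t: "t \<in> ZI" "a \<otimes> x [^] i \<ominus> a \<otimes> x [^] j = a \<otimes> t" by blast
  have c: "t \<in> carrier R" "a \<in> carrier R" using t a intg_carrier by auto
  note xc = nat_pow_closed[OF x, of i] nat_pow_closed[OF x, of j]
  have "a \<otimes> (x [^] j \<ominus> x [^] i) = \<ominus> (a \<otimes> x [^] i \<ominus> a \<otimes> x [^] j)" using c xc by algebra
  also have "\<dots> = a \<otimes> (\<ominus> t)" unfolding t(2) using c by algebra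
  finally have "x [^] j \<ominus> x [^] i = \<ominus> t"
    using m_lcancel[of a "x [^] j \<ominus> x [^] i" "\<ominus> t"] c xc a(2) by simp
  then have "intg (x [^] j \<ominus> x [^] i)" using intg_minus t by simp
  then show ?thesis using intg_of_power_difference[OF x ij] by simp
qed

text \<open>A monic relation of degree \<open>m + 1\<close> for 1/2, multiplied by
  \<open>2^m\<close>, would make 1/2 an ordinary integer. This shows that the ring of integers is
  not a field.\<close>

lemma half_not_intg: "\<not> intg (inv (\<iota> 2))"
proof
  let ?h = "inv (\<iota> 2)"
  have h: "?h \<in> carrier R" "\<iota> 2 \<otimes> ?h = \<one>" using field_Units iota_eq_0[of 2] by auto
  assume "intg ?h"
  then obtain n :: nat where n: "?h [^] n \<in> zspan ((\<lambda>i::nat. ?h [^] i) ` {..<n})"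
    unfolding intg_def by blast
  have "n \<noteq> 0" using n by (intro notI) (simp add: zspan_empty)
  then obtain m where m: "n = Suc m" by (cases n) auto
  have pow: "\<iota> (2 ^ k) \<otimes> ?h [^] k = \<one>" for k :: nat
    using iota_power[OF h(1), of 2 k] h(2) by simp
  have "\<exists>c. \<iota> (2 ^ m) \<otimes> z = \<iota> c" if "z \<in> zspan ((\<lambda>i::nat. ?h [^] i) ` {..<n})" for z
    using that
  proof induct
    case zero
    show ?case by (rule exI[of _ 0]) (simp add: iota_0)
  next
    case (incl s)
    then obtain i where i: "i < n" "s = ?h [^] i" by blast
    have "(2::int) ^ m = 2 ^ (m - i) * 2 ^ i" using i m by (simp flip: power_add)
    then have "\<iota> (2 ^ m) \<otimes> s = \<iota> (2 ^ (m - i)) \<otimes> (\<iota> (2 ^ i) \<otimes> s)"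
      using i(2) h(1) by (simp add: iota_mult m_assoc)
    then show ?case using pow[of i] i(2) by auto
  next
    case (add x y)
    have "x \<in> carrier R" "y \<in> carrier R"
      using add zspan_carrier[of "(\<lambda>i::nat. ?h [^] i) ` {..<n}"] h(1) by blast+
    then have *: "\<iota> (2 ^ m) \<otimes> (x \<oplus> y) = \<iota> (2 ^ m) \<otimes> x \<oplus> \<iota> (2 ^ m) \<otimes> y" by (simp add: r_distr)
    obtain c d where "\<iota> (2 ^ m) \<otimes> x = \<iota> c" "\<iota> (2 ^ m) \<otimes> y = \<iota> d" using add by blast
    then show ?case unfolding * by (intro exI[of _ "c + d"]) (simp only: iota_add)
  next
    case (neg x)
    have "x \<in> carrier R"
      using neg zspan_carrier[of "(\<lambda>i::nat. ?h [^] i) ` {..<n}"] h(1) by blast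
    then have *: "\<iota> (2 ^ m) \<otimes> (\<ominus> x) = \<ominus> (\<iota> (2 ^ m) \<otimes> x)" by (simp add: r_minus)
    obtain c where "\<iota> (2 ^ m) \<otimes> x = \<iota> c" using neg by blast
    then show ?case unfolding * by (intro exI[of _ "- c"]) (simp only: iota_minus)
  qed
  then obtain c where c: "\<iota> (2 ^ m) \<otimes> ?h [^] n = \<iota> c" using n by blast
  have "\<one> = \<iota> 2 \<otimes> (\<iota> (2 ^ m) \<otimes> ?h [^] n)"
    using pow[of n] iota_mult[of 2 "2 ^ m"] h(1) unfolding m by (simp add: m_assoc)
  then have "\<iota> 1 = \<iota> (2 * c)" unfolding c iota_mult iota_1 by simp
  then have "1 = 2 * c" using injD[OF char0] by blast
  then show False by presburger
qed

lemma dedekind_ZI: "dedekind_subring R ZI"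
proof (intro dedekind_subring.intro dedekind_subring_axioms.intro field_axioms)
  show "subring ZI R" by (rule intg_subring)
  show "\<exists>d\<in>ZI. d \<noteq> \<zero> \<and> d \<otimes> x \<in> ZI" if "x \<in> carrier R" for x
    using integral_multiple[OF that] iota_eq_0 intg_iota by blast
  show "\<exists>S. finite S \<and> S \<subseteq> ZI \<and> (\<forall>x\<in>ZI. \<exists>s\<in>S. \<exists>r\<in>ZI. x = s \<oplus> a \<otimes> r)" if "a \<in> ZI" "a \<noteq> \<zero>" for a
    using quotient_finite that by blast
  show "x \<in> ZI" if "x \<in> carrier R" "a \<in> ZI" "a \<noteq> \<zero>" "\<And>k::nat. a \<otimes> x [^] k \<in> ZI" for x a
    using ZI_completely_closed that by blast
  show "\<exists>a\<in>ZI. a \<noteq> \<zero> \<and> inv a \<notin> ZI"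
    using half_not_intg iota_eq_0[of 2] intg_iota[of 2] by auto
qed

end

section \<open>Monic integer polynomials and spans of powers\<close>

context field
begin

lemma eval_zspan:
  assumes x: "x \<in> carrier R"
  shows "set p \<subseteq> range \<iota> \<Longrightarrow> eval p x \<in> zspan ((\<lambda>i::nat. x [^] i) ` {..<length p})"
proof (induct p)
  case Nil
  show ?case using zspan.zero by simp
next
  case (Cons a p)
  let ?G = "(\<lambda>i::nat. x [^] i) ` {..<length (a # p)}"
  obtain c where c: "a = \<iota> c" using Cons(2) by auto
  have "x [^] length p \<in> zspan ?G" by (intro zspan.incl imageI) simp
  then have "\<iota> c \<otimes> x [^] length p \<in> zspan ?G" by (rule zspan_int[rotated]) (use x in auto)
  moreover have "eval p x \<in> zspan ?G"
    using Cons zspan_mono[of "(\<lambda>i::nat. x [^] i) ` {..<length p}" ?G] by (auto simp: image_mono)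
  ultimately show ?case using zspan.add c by simp
qed

text \<open>The length is exactly \<open>n\<close>, leading zeros being allowed, so that putting
  \<open>\<one>\<close> in front yields a monic polynomial of degree \<open>n\<close>.\<close>

lemma zspan_eval:
  assumes x: "x \<in> carrier R"
  shows "z \<in> zspan ((\<lambda>i::nat. x [^] i) ` {..<n}) \<Longrightarrow>
    \<exists>p. set p \<subseteq> range \<iota> \<and> length p = n \<and> eval p x = z"
proof (induct n arbitrary: z)
  case 0
  then show ?case by (simp add: zspan_empty)
next
  case (Suc n)
  have "(\<lambda>i::nat. x [^] i) ` {..<Suc n} = insert (x [^] n) ((\<lambda>i::nat. x [^] i) ` {..<n})"
    by (auto simp: lessThan_Suc)
  then obtain c r where r: "r \<in> zspan ((\<lambda>i::nat. x [^] i) ` {..<n})" "z = \<iota> c \<otimes> x [^] n \<oplus> r"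
    using zspan_insertE[of z "x [^] n" "(\<lambda>i::nat. x [^] i) ` {..<n}"] Suc(2) x
    by (metis (no_types, lifting) image_subsetI nat_pow_closed)
  obtain p where p: "set p \<subseteq> range \<iota>" "length p = n" "eval p x = r" using Suc(1)[OF r(1)] by blast
  then show ?case using r(2) by (intro exI[of _ "\<iota> c # p"]) auto
qed

lemma integral_over_int_iff:
  assumes x: "x \<in> carrier R" shows "integral_over_int R x \<longleftrightarrow> intg x"
proof
  assume "integral_over_int R x"
  then obtain p where p: "polynomial (range \<iota>) p" "p \<noteq> []" "lead_coeff p = \<one>" "eval p x = \<zero>"
    unfolding integral_over_int_def by blast
  obtain q where q: "p = \<one> # q" using p(2,3) by (cases p) auto
  have "set q \<subseteq> range \<iota>" using p(1) q unfolding polynomial_def by simp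
  then have E: "eval q x \<in> zspan ((\<lambda>i::nat. x [^] i) ` {..<length q})" by (rule eval_zspan[OF x])
  have c: "eval q x \<in> carrier R" by (rule zspan_carrier[OF _ E]) (use x in auto)
  have "x [^] length q \<oplus> eval q x = \<zero>" using p(4) q x by simp
  then have "x [^] length q = \<ominus> eval q x" using c x by (intro sum_zero_eq_neg) auto
  then have "x [^] length q \<in> zspan ((\<lambda>i::nat. x [^] i) ` {..<length q})"
    using zspan.neg[OF E] by simp
  then show "intg x" unfolding intg_def using x by blast
next
  assume "intg x"
  then obtain n :: nat where n: "x [^] n \<in> zspan ((\<lambda>i::nat. x [^] i) ` {..<n})"
    unfolding intg_def by blast
  obtain q where q: "set q \<subseteq> range \<iota>" "length q = n" "eval q x = \<ominus> (x [^] n)"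
    using zspan_eval[OF x zspan.neg[OF n]] by blast
  have "\<one> \<in> range \<iota>" using iota_1 by (metis rangeI)
  then have "polynomial (range \<iota>) (\<one> # q)" unfolding polynomial_def using q by simp
  moreover have "eval (\<one> # q) x = \<zero>" using q x by (simp add: r_neg)
  ultimately show "integral_over_int R x"
    unfolding integral_over_int_def by (intro exI[of _ "\<one> # q"]) simp
qed

lemma integers_eq: "integers R = {x. intg x}"
  unfolding ring_of_integers_def using integral_over_int_iff intg_carrier by auto

end

lemma number_field_num_field: "number_field L \<Longrightarrow> num_field L"
  unfolding number_field_def num_field_def num_field_axioms_def by blast

section \<open>Ideals of the subring as ideals in HOL-Algebra\<close>

context dedekind_subring
begin

lemma subring_minus: "x \<in> R \<Longrightarrow> \<ominus>\<^bsub>F\<lparr>carrier := R\<rparr>\<^esub> x = \<ominus> x"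
proof -
  assume x: "x \<in> R"
  have "subgroup R (add_monoid F)" using R_subring subring.axioms(1) by blast
  then show ?thesis
    using add.m_inv_consistent[of R x] x by (simp add: a_inv_def)
qed

lemma R_ring: "ring (F\<lparr>carrier := R\<rparr>)"
  using subring_is_ring[OF R_subring] .

lemma R_cring: "cring (F\<lparr>carrier := R\<rparr>)"
  using subcring_iff[of R] subcringI'[OF R_subring] subringE(1)[OF R_subring] by blast

lemma ideal_iff: "ideal J (F\<lparr>carrier := R\<rparr>) \<longleftrightarrow> int_ideal J"
proof
  assume "ideal J (F\<lparr>carrier := R\<rparr>)"
  then interpret J: ideal J "F\<lparr>carrier := R\<rparr>" .
  have JR: "J \<subseteq> R" using J.a_subset by simp
  then show "int_ideal J"
    unfolding int_ideal_def submod_def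
    using additive_subgroup.zero_closed[OF J.is_additive_subgroup]
      additive_subgroup.a_closed[OF J.is_additive_subgroup] J.I_l_closed R_carrier by auto
next
  assume J: "int_ideal J"
  then have s: "submod J" "J \<subseteq> R" unfolding int_ideal_def by auto
  show "ideal J (F\<lparr>carrier := R\<rparr>)"
  proof (rule idealI)
    show "ring (F\<lparr>carrier := R\<rparr>)" by (rule R_ring)
    show "subgroup J (add_monoid (F\<lparr>carrier := R\<rparr>))"
    proof (rule subgroup.intro)
      fix x assume "x \<in> J"
      then show "inv\<^bsub>add_monoid (F\<lparr>carrier := R\<rparr>)\<^esub> x \<in> J"
        using subring_minus[of x] submod_minus[OF s(1)] s(2) unfolding a_inv_def by auto
    qed (use s submod_zero submod_add in auto)
  next
    fix a x assume "a \<in> J" "x \<in> carrier (F\<lparr>carrier := R\<rparr>)"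
    then show "x \<otimes>\<^bsub>F\<lparr>carrier := R\<rparr>\<^esub> a \<in> J" "a \<otimes>\<^bsub>F\<lparr>carrier := R\<rparr>\<^esub> x \<in> J"
      using submod_mult[OF s(1)] submod_carrier[OF s(1)] R_carrier m_comm[of a x] by auto
  qed
qed

lemma maximalideal_iff: "maximalideal M (F\<lparr>carrier := R\<rparr>) \<longleftrightarrow> maxi M"
proof
  assume "maximalideal M (F\<lparr>carrier := R\<rparr>)"
  then interpret M: maximalideal M "F\<lparr>carrier := R\<rparr>" .
  show "maxi M"
    unfolding maxi_def
  proof (intro conjI allI impI)
    show "int_ideal M" using M.ideal_axioms ideal_iff by blast
    show "M \<noteq> R" using M.I_notcarr by auto
    fix J assume "int_ideal J" "M \<subseteq> J"
    then show "J = M \<or> J = R"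
      using M.I_maximal[of J] ideal_iff[of J] unfolding int_ideal_def by simp
  qed
next
  assume M: "maxi M"
  show "maximalideal M (F\<lparr>carrier := R\<rparr>)"
  proof (rule maximalidealI)
    show "ideal M (F\<lparr>carrier := R\<rparr>)" using M ideal_iff unfolding maxi_def by blast
    show "carrier (F\<lparr>carrier := R\<rparr>) \<noteq> M" using M unfolding maxi_def by auto
    show "J = M \<or> J = carrier (F\<lparr>carrier := R\<rparr>)" if "ideal J (F\<lparr>carrier := R\<rparr>)" "M \<subseteq> J" for J
      using M that ideal_iff unfolding maxi_def by simp
  qed
qed

lemma fracid_iff:
  assumes "R = integers F" shows "fractional_ideal F I \<longleftrightarrow> fracid I"
  unfolding fractional_ideal_def assms[symmetric] fracid_def submod_iff by blast

lemma fractional_ideals_eq: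
  assumes "R = integers F" shows "fractional_ideals F = FI"
  unfolding fractional_ideals_def FI_def assms[symmetric] using fracid_iff[OF assms] by presburger

text \<open>Let \<open>a\<close> be a nonzero element of \<open>P\<close> and \<open>r\<close> in
  \<open>J\<close> but not in \<open>P\<close>. Two powers of \<open>r\<close> agree modulo
  \<open>a\<close>, so some \<open>r^i (1 - r^(n+1))\<close> lies in \<open>P\<close>. No power of
  \<open>r\<close> does, so \<open>1 - r^(n+1)\<close> is in \<open>P\<close>, hence in
  \<open>J\<close>, and \<open>J\<close> contains 1.\<close>

lemma prime_maxi:
  assumes P: "int_ideal P" "P \<noteq> {\<zero>}" "\<one> \<notin> P" and
    prime: "\<And>x y. x \<in> R \<Longrightarrow> y \<in> R \<Longrightarrow> x \<otimes> y \<in> P \<Longrightarrow> x \<in> P \<or> y \<in> P"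
  shows "maxi P"
  unfolding maxi_def
proof (intro conjI allI impI)
  show "int_ideal P" by fact
  show "P \<noteq> R" using P(3) R_one by blast
  fix J assume J: "int_ideal J" "P \<subseteq> J"
  note Ps = int_ideal_submod[OF P(1)] and Js = int_ideal_submod[OF J(1)]
  have PR: "P \<subseteq> R" and JR: "J \<subseteq> R" using P J unfolding int_ideal_def by auto
  show "J = P \<or> J = R"
  proof (rule disjCI)
    assume "J \<noteq> R"
    show "J = P"
    proof (rule ccontr)
      assume "J \<noteq> P"
      then obtain r where r: "r \<in> J" "r \<notin> P" using J by blast
      have rR: "r \<in> R" using r JR by blast
      note rc = R_carrier[OF rR]
      have rk: "r [^] (k::nat) \<in> R" for k
        by (induct k) (use R_one R_mult rR in auto)
      have rk': "r [^] (k::nat) \<notin> P" for k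
      proof (induct k)
        case 0
        show ?case using P(3) by simp
      next
        case (Suc k)
        then show ?case using prime[OF rk rR] r by auto
      qed
      obtain a where a: "a \<in> P" "a \<noteq> \<zero>" using P(2) submod_zero[OF Ps] by blast
      have aR: "a \<in> R" using a PR by blast
      have "\<exists>i j::nat. i < j \<and> (\<exists>t\<in>R. r [^] i \<ominus> r [^] j = a \<otimes> t)"
        by (rule pigeonhole_mod[OF R_subring aR R_finite_quotient[OF aR a(2)]]) (rule rk)
      then obtain i j :: nat and t where ij: "i < j" and t: "t \<in> R" "r [^] i \<ominus> r [^] j = a \<otimes> t" by blast
      obtain n where n: "j = Suc n + i"
        using ij by (metis less_iff_Suc_add add.commute add_Suc_right)
      define u v where "u = r [^] Suc n" and "v = r [^] i"
      have uv: "u \<in> carrier F" "v \<in> carrier F" "u \<in> R" "v \<in> R"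
        unfolding u_def v_def using rc rk by blast+
      have rj: "r [^] j = u \<otimes> v"
        unfolding u_def v_def n using nat_pow_mult[OF rc, of "Suc n" i] by (simp only:)
      have "v \<otimes> (\<one> \<ominus> u) = v \<ominus> u \<otimes> v" using uv by algebra
      also have "\<dots> = t \<otimes> a"
        using t(2) R_carrier[OF t(1)] R_carrier[OF aR] unfolding rj v_def[symmetric] by (simp add: m_comm)
      also have "\<dots> \<in> P" using submod_mult[OF Ps t(1) a(1)] .
      finally have "v \<otimes> (\<one> \<ominus> u) \<in> P" .
      then have "\<one> \<ominus> u \<in> P"
        using prime[OF uv(4) submod_diff[OF submod_R R_one uv(3)]] rk' unfolding v_def by blast
      then have 1: "\<one> \<ominus> u \<in> J" using J by blast
      have 2: "u \<in> J" unfolding u_def using submod_mult[OF Js rk r(1)] by simp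
      have "(\<one> \<ominus> u) \<oplus> u = \<one>" using uv by algebra
      then have "\<one> \<in> J" using submod_add[OF Js 1 2] by simp
      then show False using int_ideal_eq_R[OF J(1)] \<open>J \<noteq> R\<close> by blast
    qed
  qed
qed

end

lemma ring_of_integers_eq: "ring_of_integers L = L\<lparr>carrier := integers L\<rparr>"
  unfolding ring_of_integers_def by simp

lemma ideal_prod_restrict: "ideal_prod (L\<lparr>carrier := K\<rparr>) I J = ideal_prod L I J"
proof
  show "ideal_prod (L\<lparr>carrier := K\<rparr>) I J \<subseteq> ideal_prod L I J"
  proof
    fix x assume "x \<in> ideal_prod (L\<lparr>carrier := K\<rparr>) I J"
    then show "x \<in> ideal_prod L I J"
      by induct (auto intro: ideal_prod.intros)
  qed
  show "ideal_prod L I J \<subseteq> ideal_prod (L\<lparr>carrier := K\<rparr>) I J"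
  proof
    fix x assume "x \<in> ideal_prod L I J"
    then show "x \<in> ideal_prod (L\<lparr>carrier := K\<rparr>) I J"
    proof induct
      case (prod i j)
      then show ?case using ideal_prod.prod[of i I j J "L\<lparr>carrier := K\<rparr>"] by simp
    next
      case (sum x y)
      then show ?case using ideal_prod.sum[of x "L\<lparr>carrier := K\<rparr>" I J y] by simp
    qed
  qed
qed

section \<open>Galois extensions\<close>

locale galois_ext = num_field L for L (structure) +
  fixes K :: "'a set"
  assumes subfield_K: "subfield K L"
    and num_field_K: "num_field (L\<lparr>carrier := K\<rparr>)"
    and galois: "finite_galois_extension L K"
begin

abbreviation A :: "'a set" where "A \<equiv> integers L"
abbreviation B :: "'a set" where "B \<equiv> integers (L\<lparr>carrier := K\<rparr>)"

lemma A_eq: "A = ZI"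
  by (rule integers_eq)

lemma dedA: "dedekind_subring L A"
  using dedekind_ZI unfolding A_eq .

lemma dedB: "dedekind_subring (L\<lparr>carrier := K\<rparr>) B"
proof -
  interpret KF: num_field "L\<lparr>carrier := K\<rparr>" by (rule num_field_K)
  show ?thesis using KF.dedekind_ZI unfolding KF.integers_eq .
qed

sublocale LD: dedekind_subring L A
  by (rule dedA)

text \<open>The rewrites express everything about \<open>K\<close> through the operations of
  \<open>L\<close>, so that ideals of both rings can be compared and multiplied as subsets of
  \<open>carrier L\<close>.\<close>

sublocale KD: dedekind_subring "L\<lparr>carrier := K\<rparr>" B
  rewrites "mult (L\<lparr>carrier := K\<rparr>) = mult L"
    and "add (L\<lparr>carrier := K\<rparr>) = add L"
    and "one (L\<lparr>carrier := K\<rparr>) = one L"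
    and "zero (L\<lparr>carrier := K\<rparr>) = zero L"
    and "carrier (L\<lparr>carrier := K\<rparr>) = K"
    and "ideal_prod (L\<lparr>carrier := K\<rparr>) = ideal_prod L"
  using dedB by (auto simp: ideal_prod_restrict fun_eq_iff)

lemma K_sub: "subring K L" "K \<subseteq> carrier L"
  using subfieldE(1)[OF subfield_K] subfieldE(3)[OF subfield_K] by auto

lemma iota_K: "[n] \<cdot>\<^bsub>L\<lparr>carrier := K\<rparr>\<^esub> \<one> = [n] \<cdot> \<one>" for n :: int
proof -
  have "subgroup K (add_monoid L)" using K_sub(1) subring.axioms(1) by blast
  then have "\<one> [^]\<^bsub>add_monoid L\<^esub> n = \<one> [^]\<^bsub>(add_monoid L)\<lparr>carrier := K\<rparr>\<^esub> n"
    using add.int_pow_consistent[of K \<one> n] subringE(3)[OF K_sub(1)]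
    by (simp add: add_pow_def)
  then show ?thesis unfolding add_pow_def by simp
qed

text \<open>Integrality refers to the field only through the image of the integers and the
  evaluation of polynomials, and both agree in \<open>K\<close> and \<open>L\<close>.\<close>

lemma B_eq: "B = A \<inter> K"
proof -
  have *: "(\<lambda>n::int. [n] \<cdot>\<^bsub>L\<lparr>carrier := K\<rparr>\<^esub> \<one>\<^bsub>L\<lparr>carrier := K\<rparr>\<^esub>) = (\<lambda>n. [n] \<cdot> \<one>)"
    using iota_K by (simp add: fun_eq_iff)
  have "integral_over_int (L\<lparr>carrier := K\<rparr>) x \<longleftrightarrow> integral_over_int L x" for x
    unfolding integral_over_int_def eval_consistent[OF K_sub(1)] polynomial_def * by simp
  then show ?thesis
    unfolding ring_of_integers_def using K_sub(2) by auto
qed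

lemma BA: "B \<subseteq> A" "B \<subseteq> K"
  unfolding B_eq by auto

text \<open>Fixing the values outside the carrier makes each automorphism a single function, as is
  required for the set to be finite and for sums over it to run over automorphisms.\<close>

definition Gal :: "('a \<Rightarrow> 'a) set" where
  "Gal = {\<sigma> \<in> ring_iso L L. \<sigma> \<in> extensional (carrier L) \<and> (\<forall>k\<in>K. \<sigma> k = k)}"

lemma Gal_hom:
  assumes "\<sigma> \<in> Gal"
  shows "x \<in> carrier L \<Longrightarrow> \<sigma> x \<in> carrier L"
    and "x \<in> carrier L \<Longrightarrow> y \<in> carrier L \<Longrightarrow> \<sigma> (x \<oplus> y) = \<sigma> x \<oplus> \<sigma> y"
    and "x \<in> carrier L \<Longrightarrow> y \<in> carrier L \<Longrightarrow> \<sigma> (x \<otimes> y) = \<sigma> x \<otimes> \<sigma> y"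
    and "\<sigma> \<one> = \<one>" and "bij_betw \<sigma> (carrier L) (carrier L)"
    and "k \<in> K \<Longrightarrow> \<sigma> k = k"
  using assms ring_iso_memE[of \<sigma> L L] unfolding Gal_def by auto

lemma Gal_ring_hom: "\<sigma> \<in> Gal \<Longrightarrow> ring_hom_cring L L \<sigma>"
  by (intro ring_hom_cring.intro ring_hom_cring_axioms.intro is_cring)
    (simp add: Gal_def ring_iso_def)

lemma Gal_zero: "\<sigma> \<in> Gal \<Longrightarrow> \<sigma> \<zero> = \<zero>"
  using ring_hom_cring.hom_zero[OF Gal_ring_hom] by blast

lemma Gal_minus: "\<sigma> \<in> Gal \<Longrightarrow> x \<in> carrier L \<Longrightarrow> \<sigma> (\<ominus> x) = \<ominus> \<sigma> x"
  using ring_hom_cring.hom_a_inv[OF Gal_ring_hom] by blast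

lemma Gal_diff: "\<sigma> \<in> Gal \<Longrightarrow> x \<in> carrier L \<Longrightarrow> y \<in> carrier L \<Longrightarrow> \<sigma> (x \<ominus> y) = \<sigma> x \<ominus> \<sigma> y"
  unfolding a_minus_def using Gal_hom(2)[of \<sigma> x "\<ominus> y"] Gal_minus[of \<sigma> y] by simp

lemma Gal_inj: "\<sigma> \<in> Gal \<Longrightarrow> x \<in> carrier L \<Longrightarrow> y \<in> carrier L \<Longrightarrow> \<sigma> x = \<sigma> y \<Longrightarrow> x = y"
  using Gal_hom(5) unfolding bij_betw_def inj_on_def by blast

lemma GalI:
  assumes "\<sigma> \<in> ring_iso L L" "\<forall>k\<in>K. \<sigma> k = k" shows "restrict \<sigma> (carrier L) \<in> Gal"
proof -
  have "restrict \<sigma> (carrier L) \<in> ring_iso L L"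
    by (rule ring_iso_restrict[OF assms(1)]) simp
  then show ?thesis unfolding Gal_def using assms(2) K_sub(2) by auto
qed

definition gid :: "'a \<Rightarrow> 'a" where "gid = restrict id (carrier L)"

lemma gid_Gal: "gid \<in> Gal"
  unfolding gid_def by (rule GalI) (auto intro!: ring_iso_memI)

lemma gid_simp: "x \<in> carrier L \<Longrightarrow> gid x = x"
  unfolding gid_def by simp

lemma compose_Gal:
  assumes "\<sigma> \<in> Gal" "\<tau> \<in> Gal" shows "compose (carrier L) \<sigma> \<tau> \<in> Gal"
proof -
  have "\<sigma> \<circ> \<tau> \<in> ring_iso L L"
    using bij_betw_trans[OF Gal_hom(5)[OF assms(2)] Gal_hom(5)[OF assms(1)]]
    by (intro ring_iso_memI) (simp_all add: Gal_hom[OF assms(1)] Gal_hom[OF assms(2)])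
  moreover have "\<forall>k\<in>K. (\<sigma> \<circ> \<tau>) k = k" by (simp add: Gal_hom(6)[OF assms(1)] Gal_hom(6)[OF assms(2)])
  ultimately have "restrict (\<sigma> \<circ> \<tau>) (carrier L) \<in> Gal" by (rule GalI)
  moreover have "restrict (\<sigma> \<circ> \<tau>) (carrier L) = compose (carrier L) \<sigma> \<tau>"
    unfolding compose_def by auto
  ultimately show ?thesis by simp
qed

definition ginv :: "('a \<Rightarrow> 'a) \<Rightarrow> 'a \<Rightarrow> 'a" where
  "ginv \<sigma> = restrict (inv_into (carrier L) \<sigma>) (carrier L)"

lemma ginv_simp:
  assumes "\<sigma> \<in> Gal" "x \<in> carrier L" shows "\<sigma> (ginv \<sigma> x) = x" "ginv \<sigma> (\<sigma> x) = x"
proof -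
  have b: "bij_betw \<sigma> (carrier L) (carrier L)" using Gal_hom(5) assms by blast
  show "\<sigma> (ginv \<sigma> x) = x"
    unfolding ginv_def using assms(2) bij_betw_inv_into_right[OF b] by simp
  show "ginv \<sigma> (\<sigma> x) = x"
    unfolding ginv_def using assms Gal_hom(1) bij_betw_inv_into_left[OF b] by simp
qed

lemma ginv_Gal:
  assumes "\<sigma> \<in> Gal" shows "ginv \<sigma> \<in> Gal"
proof -
  have "\<sigma> \<in> ring_iso L L" using assms unfolding Gal_def by blast
  then have "inv_into (carrier L) \<sigma> \<in> ring_iso L L" by (rule ring_iso_set_sym[OF is_ring])
  moreover have "\<forall>k\<in>K. inv_into (carrier L) \<sigma> k = k"
  proof
    fix k assume k: "k \<in> K"
    have "k \<in> carrier L" using k K_sub(2) by blast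
    then show "inv_into (carrier L) \<sigma> k = k"
      using ginv_simp(2)[OF assms, of k] Gal_hom(6)[OF assms k] unfolding ginv_def by simp
  qed
  ultimately show ?thesis unfolding ginv_def by (rule GalI)
qed

lemma Gal_eqI: "\<sigma> \<in> Gal \<Longrightarrow> \<tau> \<in> Gal \<Longrightarrow> (\<And>x. x \<in> carrier L \<Longrightarrow> \<sigma> x = \<tau> x) \<Longrightarrow> \<sigma> = \<tau>"
  unfolding Gal_def by (blast intro: extensionalityI)

lemma compose_bij:
  assumes \<tau>: "\<tau> \<in> Gal" shows "bij_betw (compose (carrier L) \<tau>) Gal Gal"
proof (rule bij_betw_byWitness[where f' = "compose (carrier L) (ginv \<tau>)"])
  show "\<forall>\<sigma>\<in>Gal. compose (carrier L) (ginv \<tau>) (compose (carrier L) \<tau> \<sigma>) = \<sigma>"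
  proof
    fix \<sigma> assume \<sigma>: "\<sigma> \<in> Gal"
    show "compose (carrier L) (ginv \<tau>) (compose (carrier L) \<tau> \<sigma>) = \<sigma>"
      by (rule Gal_eqI[OF compose_Gal[OF ginv_Gal[OF \<tau>] compose_Gal[OF \<tau> \<sigma>]] \<sigma>])
        (simp add: compose_def ginv_simp[OF \<tau>] Gal_hom(1)[OF \<sigma>])
  qed
  show "\<forall>\<sigma>\<in>Gal. compose (carrier L) \<tau> (compose (carrier L) (ginv \<tau>) \<sigma>) = \<sigma>"
  proof
    fix \<sigma> assume \<sigma>: "\<sigma> \<in> Gal"
    show "compose (carrier L) \<tau> (compose (carrier L) (ginv \<tau>) \<sigma>) = \<sigma>"
      by (rule Gal_eqI[OF compose_Gal[OF \<tau> compose_Gal[OF ginv_Gal[OF \<tau>] \<sigma>]] \<sigma>])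
        (simp add: compose_def ginv_simp[OF \<tau>] Gal_hom(1)[OF \<sigma>])
  qed
qed (use compose_Gal ginv_Gal \<tau> in auto)

lemma fixed_in_K:
  assumes "x \<in> carrier L" "\<And>\<sigma>. \<sigma> \<in> Gal \<Longrightarrow> \<sigma> x = x" shows "x \<in> K"
proof -
  have "\<sigma> x = x" if "\<sigma> \<in> ring_iso L L" "\<forall>k\<in>K. \<sigma> k = k" for \<sigma>
    using assms(2)[OF GalI[OF that]] assms(1) by simp
  then have "x \<in> {x \<in> carrier L. \<forall>\<sigma> \<in> ring_iso L L. (\<forall>k\<in>K. \<sigma> k = k) \<longrightarrow> \<sigma> x = x}"
    using assms(1) by blast
  then show ?thesis using galois unfolding finite_galois_extension_def by blast
qed

lemma eval_Gal:
  assumes "\<sigma> \<in> Gal" "x \<in> carrier L" "set p \<subseteq> K" shows "eval p (\<sigma> x) = \<sigma> (eval p x)"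
  using assms(3)
proof (induct p)
  case Nil
  then show ?case using Gal_zero[OF assms(1)] by simp
next
  case (Cons a p)
  have a: "a \<in> K" "a \<in> carrier L" using Cons K_sub(2) by auto
  have p: "eval p x \<in> carrier L" using Cons(2) K_sub(2) assms(2) eval_in_carrier by auto
  have pow: "\<sigma> (x [^] (n::nat)) = \<sigma> x [^] n" for n
    by (induct n) (simp_all add: Gal_hom[OF assms(1)] assms(2))
  have "\<sigma> (a \<otimes> x [^] length p \<oplus> eval p x) = a \<otimes> \<sigma> x [^] length p \<oplus> \<sigma> (eval p x)"
    using Gal_hom(2,3)[OF assms(1)] Gal_hom(6)[OF assms(1) a(1)] a p assms(2) pow by simp
  then show ?case using Cons by simp
qed

lemma int_range_K: "range (\<lambda>n::int. [n] \<cdot> \<one>) \<subseteq> K"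
proof -
  have "[n] \<cdot>\<^bsub>L\<lparr>carrier := K\<rparr>\<^esub> \<one> \<in> K" for n :: int
    by (rule KD.iota_closed)
  then show ?thesis unfolding iota_K by blast
qed

lemma integral_poly:
  assumes "x \<in> A"
  obtains p where "p \<noteq> []" "set p \<subseteq> K" "p \<in> carrier (poly_ring L)" "eval p x = \<zero>"
proof -
  have "integral_over_int L x" using assms unfolding ring_of_integers_def by simp
  then obtain p where p: "polynomial (range (\<lambda>n::int. [n] \<cdot> \<one>)) p" "p \<noteq> []" "eval p x = \<zero>"
    unfolding integral_over_int_def by blast
  have "set p \<subseteq> K" using p int_range_K unfolding polynomial_def by blast
  moreover have "p \<in> carrier (poly_ring L)"
    using p \<open>set p \<subseteq> K\<close> K_sub(2) unfolding univ_poly_carrier[symmetric] polynomial_def by auto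
  ultimately show ?thesis using that p by blast
qed

lemma Gal_A:
  assumes "\<sigma> \<in> Gal" "x \<in> A" shows "\<sigma> x \<in> A"
proof -
  have xc: "x \<in> carrier L" using assms(2) LD.R_carrier by blast
  have "integral_over_int L x" using assms unfolding ring_of_integers_def by simp
  then obtain p where p: "polynomial (range (\<lambda>n::int. [n] \<cdot> \<one>)) p" "p \<noteq> []" "lead_coeff p = \<one>" "eval p x = \<zero>"
    unfolding integral_over_int_def by blast
  have "set p \<subseteq> K" using p int_range_K unfolding polynomial_def by blast
  then have "eval p (\<sigma> x) = \<zero>" using eval_Gal[OF assms(1) xc] p(4) Gal_zero[OF assms(1)] by simp
  then have "integral_over_int L (\<sigma> x)" unfolding integral_over_int_def using p by blast
  then show ?thesis unfolding ring_of_integers_def using Gal_hom(1)[OF assms(1) xc] by simp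
qed

text \<open>Some nonzero integer multiple \<open>c v\<close> is a root of a nonzero polynomial over
  \<open>K\<close>, and the finitely many roots of that polynomial include all conjugates of
  \<open>c v\<close>.\<close>

lemma finite_orbit:
  assumes v: "v \<in> carrier L" shows "finite ((\<lambda>\<sigma>. \<sigma> v) ` Gal)"
proof -
  obtain c :: int where c: "c \<noteq> 0" "intg ([c] \<cdot> \<one> \<otimes> v)" using integral_multiple[OF v] by blast
  let ?c = "[c] \<cdot> \<one>"
  have cK: "?c \<in> K" "?c \<in> carrier L"
    by (rule subsetD[OF int_range_K rangeI], rule iota_closed)
  have c0: "?c \<noteq> \<zero>" unfolding iota_eq_0 by (rule c(1))
  obtain p where p: "p \<noteq> []" "set p \<subseteq> K" "p \<in> carrier (poly_ring L)" "eval p (?c \<otimes> v) = \<zero>"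
    by (rule integral_poly[of "?c \<otimes> v"]) (use c(2) in \<open>simp add: A_eq\<close>)
  have "(\<lambda>\<sigma>. ?c \<otimes> \<sigma> v) ` Gal \<subseteq> {x. is_root p x}"
  proof clarify
    fix \<sigma> assume \<sigma>: "\<sigma> \<in> Gal"
    have "?c \<otimes> \<sigma> v = \<sigma> (?c \<otimes> v)" using Gal_hom(3)[OF \<sigma> cK(2) v] Gal_hom(6)[OF \<sigma> cK(1)] by simp
    moreover have "eval p (\<sigma> (?c \<otimes> v)) = \<zero>"
      using eval_Gal[OF \<sigma> _ p(2), of "?c \<otimes> v"] p(4) Gal_zero[OF \<sigma>] cK v by simp
    ultimately show "is_root p (?c \<otimes> \<sigma> v)"
      unfolding is_root_def using p(1) Gal_hom(1)[OF \<sigma>] cK v by simp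
  qed
  then have "finite ((\<lambda>\<sigma>. ?c \<otimes> \<sigma> v) ` Gal)"
    using finite_number_of_roots[OF p(3)] finite_subset by blast
  moreover have "(\<lambda>\<sigma>. ?c \<otimes> \<sigma> v) ` Gal = (\<lambda>y. ?c \<otimes> y) ` ((\<lambda>\<sigma>. \<sigma> v) ` Gal)" by blast
  moreover have "inj_on (\<lambda>y. ?c \<otimes> y) ((\<lambda>\<sigma>. \<sigma> v) ` Gal)"
  proof (rule inj_onI)
    fix y z assume yz: "y \<in> (\<lambda>\<sigma>. \<sigma> v) ` Gal" "z \<in> (\<lambda>\<sigma>. \<sigma> v) ` Gal" "?c \<otimes> y = ?c \<otimes> z"
    have "y \<in> carrier L" "z \<in> carrier L" using yz(1,2) Gal_hom(1) v by auto
    then show "y = z" using m_lcancel[of ?c y z] cK c0 yz(3) by blast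
  qed
  ultimately show ?thesis using finite_imageD by metis
qed

lemma combine_Gal:
  assumes \<sigma>: "\<sigma> \<in> Gal"
  shows "set Ks \<subseteq> K \<Longrightarrow> set Vs \<subseteq> carrier L \<Longrightarrow> \<sigma> (combine Ks Vs) = combine Ks (map \<sigma> Vs)"
proof (induct Ks arbitrary: Vs)
  case Nil
  then show ?case using Gal_zero[OF \<sigma>] by simp
next
  case (Cons k Ks)
  show ?case
  proof (cases Vs)
    case Nil
    then show ?thesis using Gal_zero[OF \<sigma>] by simp
  next
    case (Cons v Vs')
    have c: "k \<in> K" "k \<in> carrier L" "set Ks \<subseteq> carrier L" "v \<in> carrier L" "set Vs' \<subseteq> carrier L"
      using Cons.prems Cons K_sub(2) by auto
    have "combine Ks Vs' \<in> carrier L" using c by (intro combine_in_carrier) auto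
    then show ?thesis
      using Cons.hyps[of Vs'] Cons.prems c Gal_hom(2,3)[OF \<sigma>] Gal_hom(6)[OF \<sigma> c(1)] unfolding Cons by simp
  qed
qed

text \<open>An automorphism is determined by its values on a basis over \<open>K\<close>, and each
  of these values lies in a finite orbit.\<close>

lemma finite_Gal: "finite Gal"
proof -
  obtain n where "dimension n K (carrier L)"
    using galois unfolding finite_galois_extension_def by auto
  then obtain Vs where Vs: "set Vs \<subseteq> carrier L" "Span K Vs = carrier L"
    using exists_base[OF subfield_K] by blast
  have "inj_on (\<lambda>\<sigma>. restrict \<sigma> (set Vs)) Gal"
  proof (rule inj_onI)
    fix \<sigma> \<tau> assume st: "\<sigma> \<in> Gal" "\<tau> \<in> Gal" "restrict \<sigma> (set Vs) = restrict \<tau> (set Vs)"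
    have eq: "map \<sigma> Vs = map \<tau> Vs" using st(3) by (auto dest: fun_cong split: if_splits simp: restrict_def)
    show "\<sigma> = \<tau>"
    proof (rule Gal_eqI[OF st(1,2)])
      fix x assume "x \<in> carrier L"
      then obtain Ks where Ks: "set Ks \<subseteq> K" "x = combine Ks Vs"
        using Vs(2) Span_eq_combine_set[OF subfield_K Vs(1)] by blast
      show "\<sigma> x = \<tau> x"
        unfolding Ks(2) combine_Gal[OF st(1) Ks(1) Vs(1)] combine_Gal[OF st(2) Ks(1) Vs(1)] eq ..
    qed
  qed
  moreover have "(\<lambda>\<sigma>. restrict \<sigma> (set Vs)) ` Gal \<subseteq> PiE (set Vs) (\<lambda>v. (\<lambda>\<sigma>. \<sigma> v) ` Gal)"
    by auto
  moreover have "finite (PiE (set Vs) (\<lambda>v. (\<lambda>\<sigma>. \<sigma> v) ` Gal))"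
    using finite_orbit Vs(1) by (intro finite_PiE) auto
  ultimately show ?thesis using finite_imageD finite_subset by metis
qed

text \<open>Composition with \<open>\<tau>\<close> permutes \<open>Gal\<close>, so the sum is fixed
  by every \<open>\<tau>\<close>, and the Galois hypothesis puts it into \<open>K\<close>. The norm
  is treated alike.\<close>

lemma trace_in_K:
  assumes x: "x \<in> carrier L" shows "(\<Oplus>\<sigma>\<in>Gal. \<sigma> x) \<in> K"
proof (rule fixed_in_K)
  show "(\<Oplus>\<sigma>\<in>Gal. \<sigma> x) \<in> carrier L" using Gal_hom(1) x by (intro finsum_closed) auto
  fix \<tau> assume \<tau>: "\<tau> \<in> Gal"
  interpret T: ring_hom_cring L L \<tau> by (rule Gal_ring_hom[OF \<tau>])
  have "\<tau> (\<Oplus>\<sigma>\<in>Gal. \<sigma> x) = (\<Oplus>\<sigma>\<in>Gal. (\<tau> \<circ> (\<lambda>\<sigma>. \<sigma> x)) \<sigma>)"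
    using T.hom_finsum[of "\<lambda>\<sigma>. \<sigma> x" Gal] Gal_hom(1) x by (simp add: Pi_def comp_def)
  also have "\<dots> = (\<Oplus>\<sigma>\<in>Gal. compose (carrier L) \<tau> \<sigma> x)"
    using x Gal_hom(1) \<tau> by (intro finsum_cong) (auto simp: compose_def simp_implies_def)
  also have "\<dots> = (\<Oplus>\<sigma>\<in>compose (carrier L) \<tau> ` Gal. \<sigma> x)"
    using compose_bij[OF \<tau>] compose_Gal[OF \<tau>] Gal_hom(1) x
    by (subst finsum_reindex) (auto simp: bij_betw_def)
  also have "compose (carrier L) \<tau> ` Gal = Gal" using compose_bij[OF \<tau>] by (simp add: bij_betw_def)
  finally show "\<tau> (\<Oplus>\<sigma>\<in>Gal. \<sigma> x) = (\<Oplus>\<sigma>\<in>Gal. \<sigma> x)" .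
qed

lemma norm_in_K:
  assumes x: "x \<in> carrier L" shows "(\<Otimes>\<sigma>\<in>Gal. \<sigma> x) \<in> K"
proof (rule fixed_in_K)
  show "(\<Otimes>\<sigma>\<in>Gal. \<sigma> x) \<in> carrier L" using Gal_hom(1) x by (intro finprod_closed) auto
  fix \<tau> assume \<tau>: "\<tau> \<in> Gal"
  interpret T: ring_hom_cring L L \<tau> by (rule Gal_ring_hom[OF \<tau>])
  have "\<tau> (\<Otimes>\<sigma>\<in>Gal. \<sigma> x) = (\<Otimes>\<sigma>\<in>Gal. (\<tau> \<circ> (\<lambda>\<sigma>. \<sigma> x)) \<sigma>)"
    using T.hom_finprod[of "\<lambda>\<sigma>. \<sigma> x" Gal] Gal_hom(1) x by (simp add: Pi_def comp_def)
  also have "\<dots> = (\<Otimes>\<sigma>\<in>Gal. compose (carrier L) \<tau> \<sigma> x)"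
    using x Gal_hom(1) \<tau> by (intro finprod_cong) (auto simp: compose_def simp_implies_def)
  also have "\<dots> = (\<Otimes>\<sigma>\<in>compose (carrier L) \<tau> ` Gal. \<sigma> x)"
    using compose_bij[OF \<tau>] compose_Gal[OF \<tau>] Gal_hom(1) x
    by (subst finprod_reindex) (auto simp: bij_betw_def)
  also have "compose (carrier L) \<tau> ` Gal = Gal" using compose_bij[OF \<tau>] by (simp add: bij_betw_def)
  finally show "\<tau> (\<Otimes>\<sigma>\<in>Gal. \<sigma> x) = (\<Otimes>\<sigma>\<in>Gal. \<sigma> x)" .
qed

section \<open>Primes above a prime of \<open>K\<close> and the action of the Galois group\<close>

definition above :: "'a set \<Rightarrow> 'a set set" where
  "above P = {M. LD.maxi M \<and> M \<inter> B = P}"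

lemma B_carrier: "x \<in> B \<Longrightarrow> x \<in> carrier L"
  using BA(1) LD.R_carrier by blast

lemma KD_int_idealI:
  assumes "P \<subseteq> B" "\<zero> \<in> P" "\<And>x y. x \<in> P \<Longrightarrow> y \<in> P \<Longrightarrow> x \<oplus> y \<in> P" "\<And>a x. a \<in> B \<Longrightarrow> x \<in> P \<Longrightarrow> a \<otimes> x \<in> P"
  shows "KD.int_ideal P"
  unfolding KD.int_ideal_def KD.submod_def
  by (intro conjI ballI) (use assms subset_trans[OF assms(1) BA(2)] in simp_all)

text \<open>The substantial point is that the contraction is nonzero: a nonzero \<open>a\<close> in
  \<open>M\<close> divides a positive integer, which lies in both \<open>M\<close> and
  \<open>B\<close>. Maximality then comes from \<open>prime_maxi\<close>.\<close>

lemma below_maxi: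
  assumes M: "LD.maxi M" shows "KD.maxi (M \<inter> B)"
proof (rule KD.prime_maxi)
  note Ms = LD.maxi_submod[OF M]
  show "KD.int_ideal (M \<inter> B)"
    using LD.submod_zero[OF Ms] KD.R_zero LD.submod_add[OF Ms] KD.R_add LD.submod_mult[OF Ms] KD.R_mult BA(1)
    by (intro KD_int_idealI) auto
  show "\<one> \<notin> M \<inter> B" using LD.maxi_one[OF M] by blast
  show "x \<in> M \<inter> B \<or> y \<in> M \<inter> B" if "x \<in> B" "y \<in> B" "x \<otimes> y \<in> M \<inter> B" for x y
    using LD.maxi_prime[OF M, of x y] that BA(1) by blast
  obtain a where a: "a \<in> M" "a \<noteq> \<zero>" using LD.maxi_nonzero[OF M] LD.submod_zero[OF Ms] by blast
  have "intg a" using a(1) LD.maxi_subset[OF M] A_eq by blast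
  then obtain b and n :: nat where b: "b \<in> ZI" "n > 0" "a \<otimes> b = [int n] \<cdot> \<one>"
    using divides_integer[OF _ a(2)] by blast
  have ac: "a \<in> carrier L" "b \<in> carrier L" using a b LD.submod_carrier[OF Ms] intg_carrier by auto
  have "b \<otimes> a \<in> M" using LD.submod_mult[OF Ms _ a(1)] b(1) A_eq by blast
  then have "[int n] \<cdot> \<one> \<in> M" using b(3) ac by (simp add: m_comm)
  moreover have "[int n] \<cdot> \<one> \<in> B"
    unfolding B_eq A_eq using intg_iota[of "int n"] subsetD[OF int_range_K rangeI, of "int n"] by blast
  moreover have "[int n] \<cdot> \<one> \<noteq> \<zero>" using iota_eq_0[of "int n"] b(2) by simp
  ultimately show "M \<inter> B \<noteq> {\<zero>}" by blast
qed

lemma above_prime: "M \<in> above P \<Longrightarrow> KD.maxi P"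
  using below_maxi unfolding above_def by blast

lemma extend_props:
  assumes P: "KD.int_ideal P" "P \<noteq> {\<zero>}"
  shows "LD.int_ideal (P \<cdot> A)" "P \<cdot> A \<noteq> {\<zero>}" "P \<subseteq> P \<cdot> A"
proof -
  have PB: "P \<subseteq> B" "P \<subseteq> carrier L" and Ac: "A \<subseteq> carrier L" and Pz: "\<zero> \<in> P"
    using P BA(1) LD.R_carrier KD.submod_zero unfolding KD.int_ideal_def by blast+
  have eq: "P \<cdot> A = A \<cdot> P" using LD.prod_comm[OF PB(2) Ac] .
  have "LD.submod (A \<cdot> P)" using LD.submod_prod'[OF LD.submod_R PB(2)] Pz by blast
  moreover have "A \<cdot> P \<subseteq> A" using LD.prod_least[OF LD.submod_R, of A P] LD.R_mult PB(1) BA(1) by blast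
  ultimately show "LD.int_ideal (P \<cdot> A)" unfolding eq LD.int_ideal_def by blast
  show sub: "P \<subseteq> P \<cdot> A"
  proof
    fix x assume x: "x \<in> P"
    then have "x \<otimes> \<one> \<in> P \<cdot> A" by (rule ideal_prod.prod[OF _ LD.R_one])
    then show "x \<in> P \<cdot> A" using x PB(2) by auto
  qed
  show "P \<cdot> A \<noteq> {\<zero>}" using sub P(2) Pz by blast
qed

text \<open>If \<open>M\<close> contains the extension of \<open>P\<close>, its contraction contains
  \<open>P\<close>, and both are maximal. In this form the primes above \<open>P\<close> become the
  primes dividing \<open>P \<cdot> A\<close>.\<close>

lemma extend_subset_iff:
  assumes P: "KD.maxi P" and M: "LD.maxi M" shows "P \<cdot> A \<subseteq> M \<longleftrightarrow> M \<inter> B = P"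
proof
  assume *: "P \<cdot> A \<subseteq> M"
  have "P \<subseteq> M \<inter> B"
    using extend_props(3)[OF KD.maxi_int[OF P] KD.maxi_nonzero[OF P]] * KD.maxi_subset[OF P] by blast
  then show "M \<inter> B = P" using KD.maxi_eqI[OF P below_maxi[OF M]] by blast
next
  assume *: "M \<inter> B = P"
  show "P \<cdot> A \<subseteq> M"
  proof (rule LD.prod_least[OF LD.maxi_submod[OF M]])
    fix i j assume ij: "i \<in> P" "j \<in> A"
    then have "j \<otimes> i \<in> M" using * LD.submod_mult[OF LD.maxi_submod[OF M], of j i] by blast
    moreover have "i \<in> carrier L" "j \<in> carrier L" using ij * B_carrier LD.R_carrier by blast+
    ultimately show "i \<otimes> j \<in> M" by (simp add: m_comm)
  qed
qed

lemma finite_above: "KD.maxi P \<Longrightarrow> finite (above P)"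
proof -
  assume P: "KD.maxi P"
  note E = extend_props[OF KD.maxi_int[OF P] KD.maxi_nonzero[OF P]]
  have "above P \<subseteq> {M. LD.maxi M \<and> P \<cdot> A \<subseteq> M}" unfolding above_def using extend_subset_iff[OF P] by blast
  then show ?thesis using LD.finite_maxi_above[OF E(1,2)] finite_subset by blast
qed

lemma Gal_image_int:
  assumes \<sigma>: "\<sigma> \<in> Gal" and I: "LD.int_ideal I" shows "LD.int_ideal (\<sigma> ` I)"
proof -
  have IA: "I \<subseteq> A" and Is: "LD.submod I" using I unfolding LD.int_ideal_def by auto
  note c = LD.submod_carrier[OF Is]
  have "\<sigma> ` I \<subseteq> A" using Gal_A[OF \<sigma>] IA by blast
  moreover have "\<zero> \<in> \<sigma> ` I" using LD.submod_zero[OF Is] Gal_zero[OF \<sigma>] by (metis imageI)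
  moreover have "\<sigma> x \<oplus> \<sigma> y \<in> \<sigma> ` I" if "x \<in> I" "y \<in> I" for x y
    using Gal_hom(2)[OF \<sigma> c c, OF that] LD.submod_add[OF Is that] by (metis imageI)
  moreover have "a \<otimes> \<sigma> x \<in> \<sigma> ` I" if "a \<in> A" "x \<in> I" for a x
  proof -
    have ac: "a \<in> carrier L" using that LD.R_carrier by blast
    have "ginv \<sigma> a \<in> A" using Gal_A[OF ginv_Gal[OF \<sigma>] that(1)] .
    then have "ginv \<sigma> a \<otimes> x \<in> I" using LD.submod_mult[OF Is _ that(2)] by blast
    moreover have "\<sigma> (ginv \<sigma> a \<otimes> x) = a \<otimes> \<sigma> x"
      using Gal_hom(3)[OF \<sigma> Gal_hom(1)[OF ginv_Gal[OF \<sigma>] ac] c[OF that(2)]] ginv_simp(1)[OF \<sigma> ac] by simp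
    ultimately show ?thesis by (metis imageI)
  qed
  ultimately show ?thesis
    unfolding LD.int_ideal_def LD.submod_def using LD.R_carrier by blast
qed

lemma Gal_image_inverse:
  assumes "\<sigma> \<in> Gal" "I \<subseteq> carrier L" shows "\<sigma> ` ginv \<sigma> ` I = I" "ginv \<sigma> ` \<sigma> ` I = I"
proof -
  have "\<sigma> (ginv \<sigma> x) = x" "ginv \<sigma> (\<sigma> x) = x" if "x \<in> I" for x
    using ginv_simp[OF assms(1)] that assms(2) by blast+
  then show "\<sigma> ` ginv \<sigma> ` I = I" "ginv \<sigma> ` \<sigma> ` I = I" by (simp_all add: image_image)
qed

lemma Gal_image_maxi:
  assumes \<sigma>: "\<sigma> \<in> Gal" and M: "LD.maxi M" shows "LD.maxi (\<sigma> ` M)"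
  unfolding LD.maxi_def
proof (intro conjI allI impI)
  have Mc: "M \<subseteq> carrier L" using LD.maxi_submod[OF M] LD.submod_subset by blast
  show int: "LD.int_ideal (\<sigma> ` M)" using Gal_image_int[OF \<sigma> LD.maxi_int[OF M]] .
  show "\<sigma> ` M \<noteq> A"
  proof
    assume "\<sigma> ` M = A"
    then obtain m where m: "m \<in> M" "\<sigma> m = \<one>" using LD.R_one by (metis imageE)
    then have "m = \<one>" using Gal_inj[OF \<sigma>, of m \<one>] Mc Gal_hom(4)[OF \<sigma>] by auto
    then show False using m LD.maxi_one[OF M] by simp
  qed
  fix J assume J: "LD.int_ideal J" "\<sigma> ` M \<subseteq> J"
  have Jc: "J \<subseteq> carrier L" using LD.int_ideal_submod[OF J(1)] LD.submod_subset by blast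
  have "ginv \<sigma> ` \<sigma> ` M \<subseteq> ginv \<sigma> ` J" using J(2) by (rule image_mono)
  then have "M \<subseteq> ginv \<sigma> ` J" unfolding Gal_image_inverse(2)[OF \<sigma> Mc] .
  then have "ginv \<sigma> ` J = M \<or> ginv \<sigma> ` J = A"
    using M Gal_image_int[OF ginv_Gal[OF \<sigma>] J(1)] unfolding LD.maxi_def by blast
  then show "J = \<sigma> ` M \<or> J = A"
  proof
    assume "ginv \<sigma> ` J = M"
    then show ?thesis using Gal_image_inverse(1)[OF \<sigma> Jc] by auto
  next
    assume *: "ginv \<sigma> ` J = A"
    then obtain j where j: "j \<in> J" "ginv \<sigma> j = \<one>" using LD.R_one by (metis imageE)
    then have "j = \<one>" using ginv_simp(1)[OF \<sigma>, of j] Jc Gal_hom(4)[OF \<sigma>] by auto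
    then show ?thesis using LD.int_ideal_eq_R[OF J(1)] j by blast
  qed
qed

lemma Gal_above:
  assumes \<sigma>: "\<sigma> \<in> Gal" and M: "M \<in> above P" shows "\<sigma> ` M \<in> above P"
proof -
  have Mx: "LD.maxi M" and MB: "M \<inter> B = P" using M unfolding above_def by auto
  have Mc: "M \<subseteq> carrier L" using LD.maxi_submod[OF Mx] LD.submod_subset by blast
  have fixd: "\<sigma> x = x" if "x \<in> B" for x using Gal_hom(6)[OF \<sigma>] that BA(2) by blast
  have "\<sigma> ` M \<inter> B = M \<inter> B"
  proof
    show "\<sigma> ` M \<inter> B \<subseteq> M \<inter> B"
    proof
      fix y assume "y \<in> \<sigma> ` M \<inter> B"
      then obtain x where x: "x \<in> M" "y = \<sigma> x" "y \<in> B" by blast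
      then have "\<sigma> y = \<sigma> x" using fixd by simp
      then have "y = x" using Gal_inj[OF \<sigma>] x B_carrier Mc by blast
      then show "y \<in> M \<inter> B" using x by blast
    qed
    show "M \<inter> B \<subseteq> \<sigma> ` M \<inter> B" using fixd by force
  qed
  then show ?thesis using Gal_image_maxi[OF \<sigma> Mx] MB unfolding above_def by blast
qed

text \<open>\<open>M\<close> and \<open>N\<close> are comaximal: from \<open>1 = m + r z\<close>
  with \<open>m\<close> in \<open>M\<close> and \<open>z\<close> in \<open>N\<close> one gets
  \<open>x = m x + x (r z)\<close>, a sum of two products of the right kind.\<close>

lemma maxi_inter_prod:
  assumes M: "LD.maxi M" and N: "LD.maxi N" and "M \<noteq> N" and x: "x \<in> M" "x \<in> N"
  shows "x \<in> M \<cdot> N"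
proof -
  note Ms = LD.maxi_submod[OF M] and Ns = LD.maxi_submod[OF N]
  obtain z where z: "z \<in> N" "z \<notin> M" using assms LD.maxi_eqI[OF N M] by blast
  have zA: "z \<in> A" using z LD.maxi_subset[OF N] by blast
  obtain m r where mr: "m \<in> M" "r \<in> A" "\<one> = m \<oplus> r \<otimes> z" using LD.maxi_comax[OF M zA z(2)] by blast
  have c: "m \<in> carrier L" "r \<in> carrier L" "z \<in> carrier L" "x \<in> carrier L"
    using mr z x LD.submod_carrier[OF Ms] LD.submod_carrier[OF Ns] LD.R_carrier by blast+
  have "x = \<one> \<otimes> x" using c by simp
  also have "\<dots> = m \<otimes> x \<oplus> x \<otimes> (r \<otimes> z)" unfolding mr(3) using c by algebra
  also have "\<dots> \<in> M \<cdot> N"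
    using ideal_prod.sum[OF ideal_prod.prod[OF mr(1) x(2)] ideal_prod.prod[OF x(1) LD.submod_mult[OF Ns mr(2) z(1)]]] .
  finally show ?thesis .
qed

text \<open>If \<open>M'\<close> is not a conjugate of \<open>M\<close>, choose \<open>x\<close> in
  \<open>M'\<close> outside all conjugates of \<open>M\<close>. Its norm lies in \<open>M'\<close>
  and in \<open>K\<close>, hence in \<open>P\<close> and so in \<open>M\<close>. By primality some
  \<open>\<sigma> x\<close> is in \<open>M\<close>, which puts \<open>x\<close> into a conjugate of
  \<open>M\<close> after all.\<close>

lemma Gal_transitive:
  assumes M: "M \<in> above P" and M': "M' \<in> above P" shows "\<exists>\<sigma>\<in>Gal. \<sigma> ` M = M'"
proof (rule ccontr)
  assume no: "\<not> ?thesis"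
  have Mx: "LD.maxi M" "M \<inter> B = P" and Mx': "LD.maxi M'" "M' \<inter> B = P"
    using M M' unfolding above_def by auto
  let ?T = "(\<lambda>\<sigma>. \<sigma> ` M) ` Gal"
  have T: "finite ?T" "\<And>N. N \<in> ?T \<Longrightarrow> LD.maxi N" using finite_Gal Gal_image_maxi[OF _ Mx(1)] by auto
  \<comment> \<open>Avoidance is applied with the fractional ideal \<open>M'\<close> and gives an
    \<open>x\<close> of \<open>M'\<close> outside each product \<open>M' \<cdot> N\<close>; by
    \<open>maxi_inter_prod\<close> it is then outside \<open>N\<close> itself.\<close>
  obtain x where x: "x \<in> M'" "\<forall>N\<in>?T. x \<notin> M' \<cdot> N"
    using LD.avoidance[OF LD.maxi_fracid[OF Mx'(1)] T] by blast
  have xN: "x \<notin> \<sigma> ` M" if "\<sigma> \<in> Gal" for \<sigma>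
  proof
    assume "x \<in> \<sigma> ` M"
    then have "x \<in> M' \<cdot> (\<sigma> ` M)"
      using maxi_inter_prod[OF Mx'(1) T(2)] x(1) no that by blast
    then show False using x(2) that by blast
  qed
  have xA: "x \<in> A" using x LD.maxi_subset[OF Mx'(1)] by blast
  note xc = LD.R_carrier[OF xA]
  let ?n = "\<Otimes>\<sigma>\<in>Gal. \<sigma> x"
  have "?n \<in> A" by (rule LD.R_finprod[OF finite_Gal]) (rule Gal_A[OF _ xA])
  then have nB: "?n \<in> B" unfolding B_eq using norm_in_K[OF xc] by blast
  have "?n \<in> M'"
  proof -
    have "?n = (\<Otimes>\<sigma>\<in>insert gid (Gal - {gid}). \<sigma> x)" using gid_Gal by (simp add: insert_absorb)
    also have "\<dots> = gid x \<otimes> (\<Otimes>\<sigma>\<in>Gal - {gid}. \<sigma> x)"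
      using finite_Gal Gal_hom(1) xc gid_Gal by (intro finprod_insert) auto
    also have "\<dots> = (\<Otimes>\<sigma>\<in>Gal - {gid}. \<sigma> x) \<otimes> x"
      using Gal_hom(1) xc by (subst m_comm) (auto simp: gid_simp intro!: finprod_closed)
    also have "\<dots> \<in> M'"
    proof (rule LD.submod_mult[OF LD.maxi_submod[OF Mx'(1)] _ x(1)])
      show "(\<Otimes>\<sigma>\<in>Gal - {gid}. \<sigma> x) \<in> A"
        by (rule LD.R_finprod) (use finite_Gal Gal_A xA in auto)
    qed
    finally show ?thesis .
  qed
  then have "?n \<in> M" using nB Mx Mx' by blast
  then have "\<not> (\<forall>\<sigma>\<in>Gal. \<sigma> x \<in> A - M)"
    using LD.maxi_finprod_notin[OF Mx(1) finite_Gal, of "\<lambda>\<sigma>. \<sigma> x"] by fast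
  then obtain \<sigma> where \<sigma>: "\<sigma> \<in> Gal" "\<sigma> x \<in> M"
    using Gal_A[OF _ xA] by blast
  then have "x \<in> ginv \<sigma> ` M" using ginv_simp(2)[OF \<sigma>(1) xc] by (metis imageI)
  then show False using xN[OF ginv_Gal[OF \<sigma>(1)]] by blast
qed

subsection \<open>Finiteness of ramification\<close>

text \<open>The functions on the Galois group of the form \<open>\<sigma> \<mapsto> \<Sum>\<^sub>j \<sigma>(w\<^sub>j) v\<^sub>j\<close> with integral \<open>w\<^sub>j, v\<^sub>j\<close>.
  They include one vanishing exactly off the identity, which plays the role of the discriminant.\<close>

inductive sep :: "(('a \<Rightarrow> 'a) \<Rightarrow> 'a) \<Rightarrow> bool" where
  base: "w \<in> A \<Longrightarrow> v \<in> A \<Longrightarrow> (\<And>\<sigma>. \<sigma> \<in> Gal \<Longrightarrow> f \<sigma> = \<sigma> w \<otimes> v) \<Longrightarrow> sep f"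
| add: "sep g \<Longrightarrow> sep h \<Longrightarrow> (\<And>\<sigma>. \<sigma> \<in> Gal \<Longrightarrow> f \<sigma> = g \<sigma> \<oplus> h \<sigma>) \<Longrightarrow> sep f"

lemma sep_A: "sep f \<Longrightarrow> \<sigma> \<in> Gal \<Longrightarrow> f \<sigma> \<in> A"
proof (induct rule: sep.induct)
  case (base w v f)
  then show ?case using LD.R_mult[OF Gal_A[OF base(4) base(1)] base(2)] by simp
next
  case (add g h f)
  then show ?case using LD.R_add by simp
qed

text \<open>Multiplication by a single term \<open>\<sigma> a \<otimes> b\<close> preserves the
  shape of such a sum, and a factor \<open>\<tau> \<alpha> \<ominus> \<sigma> \<alpha>\<close>
  consists of two such terms.\<close>

lemma sep_scale:
  assumes "a \<in> A" "b \<in> A"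
  shows "sep f \<Longrightarrow> sep (\<lambda>\<sigma>. (\<sigma> a \<otimes> b) \<otimes> f \<sigma>)"
proof (induct rule: sep.induct)
  case (base w v f)
  show ?case
  proof (rule sep.base[of "a \<otimes> w" "b \<otimes> v"])
    show "a \<otimes> w \<in> A" "b \<otimes> v \<in> A" using base assms LD.R_mult by blast+
    fix \<sigma> assume \<sigma>: "\<sigma> \<in> Gal"
    have c: "a \<in> carrier L" "w \<in> carrier L" "b \<in> carrier L" "v \<in> carrier L"
      using assms base LD.R_carrier by blast+
    have "(\<sigma> a \<otimes> b) \<otimes> (\<sigma> w \<otimes> v) = (\<sigma> a \<otimes> \<sigma> w) \<otimes> (b \<otimes> v)"
      using Gal_hom(1)[OF \<sigma> c(1)] Gal_hom(1)[OF \<sigma> c(2)] c(3,4) by algebra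
    then show "(\<sigma> a \<otimes> b) \<otimes> f \<sigma> = \<sigma> (a \<otimes> w) \<otimes> (b \<otimes> v)"
      using base(3)[OF \<sigma>] Gal_hom(3)[OF \<sigma> c(1,2)] by simp
  qed
next
  case (add g h f)
  show ?case
  proof (rule sep.add[OF add(2,4)])
    fix \<sigma> assume \<sigma>: "\<sigma> \<in> Gal"
    have "g \<sigma> \<in> carrier L" "h \<sigma> \<in> carrier L" "\<sigma> a \<in> carrier L" "b \<in> carrier L"
      using sep_A[OF add(1) \<sigma>] sep_A[OF add(3) \<sigma>] assms Gal_A[OF \<sigma>] LD.R_carrier by blast+
    then show "(\<sigma> a \<otimes> b) \<otimes> f \<sigma> = (\<sigma> a \<otimes> b) \<otimes> g \<sigma> \<oplus> (\<sigma> a \<otimes> b) \<otimes> h \<sigma>"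
      using add(5)[OF \<sigma>] by (simp add: r_distr)
  qed
qed

lemma Gal_moves_integer:
  assumes \<tau>: "\<tau> \<in> Gal" "\<tau> \<noteq> gid" shows "\<exists>\<alpha>\<in>A. \<tau> \<alpha> \<noteq> \<alpha>"
proof (rule ccontr)
  assume "\<not> ?thesis"
  then have fixd: "\<tau> \<alpha> = \<alpha>" if "\<alpha> \<in> A" for \<alpha> using that by blast
  have "\<tau> x = gid x" if x: "x \<in> carrier L" for x
  proof -
    obtain d where d: "d \<in> A" "d \<noteq> \<zero>" "d \<otimes> x \<in> A" using LD.R_fractions[OF x] by blast
    have dc: "d \<in> carrier L" using LD.R_carrier[OF d(1)] .
    have "d \<otimes> \<tau> x = d \<otimes> x" using fixd[OF d(3)] Gal_hom(3)[OF \<tau>(1) dc x] fixd[OF d(1)] by simp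
    then show ?thesis using m_lcancel[OF d(2) dc] Gal_hom(1)[OF \<tau>(1) x] x by (simp add: gid_simp)
  qed
  then show False using Gal_eqI[OF \<tau>(1) gid_Gal] \<tau>(2) by blast
qed

text \<open>The function is the product, over \<open>\<tau>\<close> in \<open>S\<close>, of the
  factors \<open>\<tau> \<alpha> \<ominus> \<sigma> \<alpha>\<close>, where \<open>\<alpha>\<close>
  is an integer moved by \<open>\<tau>\<close>. The factor of \<open>\<tau>\<close> vanishes at
  \<open>\<tau>\<close>, and none vanishes at \<open>gid\<close>.\<close>

lemma sep_vanishing:
  "finite S \<Longrightarrow> S \<subseteq> Gal - {gid} \<Longrightarrow> \<exists>f. sep f \<and> (\<forall>\<sigma>\<in>S. f \<sigma> = \<zero>) \<and> f gid \<noteq> \<zero>"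
proof (induct S rule: finite_induct)
  case empty
  have "sep (\<lambda>\<sigma>. \<sigma> \<one> \<otimes> \<one>)" by (rule sep.base[OF LD.R_one LD.R_one]) simp
  moreover have "gid \<one> \<otimes> \<one> \<noteq> \<zero>" by (simp add: gid_simp)
  ultimately show ?case by blast
next
  case (insert \<tau> S)
  then obtain f where f: "sep f" "\<forall>\<sigma>\<in>S. f \<sigma> = \<zero>" "f gid \<noteq> \<zero>" by auto
  have \<tau>: "\<tau> \<in> Gal" "\<tau> \<noteq> gid" using insert by auto
  obtain \<alpha> where \<alpha>: "\<alpha> \<in> A" "\<tau> \<alpha> \<noteq> \<alpha>" using Gal_moves_integer[OF \<tau>] by blast
  note \<alpha>c = LD.R_carrier[OF \<alpha>(1)]
  \<comment> \<open>The new factor is written as \<open>\<sigma> \<one>\<close> times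
    \<open>\<tau> \<alpha>\<close> plus \<open>\<sigma> (\<ominus> \<alpha>)\<close> times
    \<open>\<one>\<close>, to fit \<open>sep_scale\<close>.\<close>
  let ?f = "\<lambda>\<sigma>. (\<sigma> \<one> \<otimes> \<tau> \<alpha>) \<otimes> f \<sigma> \<oplus> (\<sigma> (\<ominus> \<alpha>) \<otimes> \<one>) \<otimes> f \<sigma>"
  have f': "?f \<sigma> = (\<tau> \<alpha> \<ominus> \<sigma> \<alpha>) \<otimes> f \<sigma>" if \<sigma>: "\<sigma> \<in> Gal" for \<sigma>
  proof -
    have c: "f \<sigma> \<in> carrier L" "\<sigma> \<alpha> \<in> carrier L" "\<tau> \<alpha> \<in> carrier L"
      using sep_A[OF f(1) \<sigma>] LD.R_carrier Gal_hom(1) \<sigma> \<tau> \<alpha>c by blast+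
    show ?thesis
      unfolding Gal_hom(4)[OF \<sigma>] Gal_minus[OF \<sigma> \<alpha>c] using c by algebra
  qed
  have "sep ?f"
    by (rule sep.add[OF sep_scale[OF LD.R_one Gal_A[OF \<tau>(1) \<alpha>(1)] f(1)]
          sep_scale[OF LD.R_minus[OF \<alpha>(1)] LD.R_one f(1)]]) simp
  moreover have "?f \<sigma> = \<zero>" if "\<sigma> \<in> insert \<tau> S" for \<sigma>
  proof (cases "\<sigma> = \<tau>")
    case True
    then show ?thesis
      using f'[OF \<tau>(1)] LD.R_carrier[OF sep_A[OF f(1) \<tau>(1)]] r_right_minus_eq[OF Gal_hom(1)[OF \<tau>(1) \<alpha>c] Gal_hom(1)[OF \<tau>(1) \<alpha>c]]
      by simp
  next
    case False
    then have s: "\<sigma> \<in> S" "\<sigma> \<in> Gal" using that insert by auto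
    then show ?thesis using f'[OF s(2)] f(2) Gal_hom(1)[OF s(2) \<alpha>c] Gal_hom(1)[OF \<tau>(1) \<alpha>c] by simp
  qed
  moreover have "?f gid \<noteq> \<zero>"
  proof -
    have c: "f gid \<in> carrier L" "\<tau> \<alpha> \<in> carrier L"
      using sep_A[OF f(1) gid_Gal] LD.R_carrier Gal_hom(1)[OF \<tau>(1) \<alpha>c] by blast+
    have "\<tau> \<alpha> \<ominus> \<alpha> \<noteq> \<zero>" using \<alpha>(2) c(2) \<alpha>c by (simp add: r_right_minus_eq)
    then have "(\<tau> \<alpha> \<ominus> \<alpha>) \<otimes> f gid \<noteq> \<zero>" using integral[of "\<tau> \<alpha> \<ominus> \<alpha>" "f gid"] f(3) c \<alpha>c by auto
    then show ?thesis using f'[OF gid_Gal] \<alpha>c by (simp add: gid_simp)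
  qed
  ultimately show ?case by (intro exI[of _ ?f]) blast
qed

lemma finsum_submod:
  assumes "LD.submod N" shows "finite S \<Longrightarrow> (\<And>s. s \<in> S \<Longrightarrow> g s \<in> N) \<Longrightarrow> (\<Oplus>s\<in>S. g s) \<in> N"
proof (induct S rule: finite_induct)
  case empty
  then show ?case using LD.submod_zero[OF assms] by simp
next
  case (insert x S)
  then have "(\<Oplus>s\<in>insert x S. g s) = g x \<oplus> (\<Oplus>s\<in>S. g s)"
    using LD.submod_carrier[OF assms] by (intro finsum_insert) auto
  then show ?case using insert LD.submod_add[OF assms] by auto
qed

text \<open>For a basic \<open>f\<close> the sum is the trace of \<open>x w\<close> times
  \<open>v\<close>. Since \<open>x\<close> lies in every prime above \<open>P\<close>, all its
  conjugates lie in \<open>M\<close>; the trace is thus in \<open>M\<close> and in \<open>K\<close>,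
  hence in \<open>P\<close>.\<close>

lemma sep_trace:
  assumes M: "M \<in> above P" and x: "x \<in> A" "\<And>N. N \<in> above P \<Longrightarrow> x \<in> N"
  shows "sep f \<Longrightarrow> (\<Oplus>\<sigma>\<in>Gal. \<sigma> x \<otimes> f \<sigma>) \<in> P \<cdot> A"
proof (induct rule: sep.induct)
  case (base w v f)
  have Mx: "LD.maxi M" "M \<inter> B = P" using M unfolding above_def by auto
  have c: "x \<in> carrier L" "w \<in> carrier L" "v \<in> carrier L" using base x LD.R_carrier by blast+
  have "(\<Oplus>\<sigma>\<in>Gal. \<sigma> x \<otimes> f \<sigma>) = (\<Oplus>\<sigma>\<in>Gal. \<sigma> (x \<otimes> w) \<otimes> v)"
  proof (rule finsum_cong')
    fix \<sigma> assume \<sigma>: "\<sigma> \<in> Gal"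
    show "\<sigma> x \<otimes> f \<sigma> = \<sigma> (x \<otimes> w) \<otimes> v"
      unfolding base(3)[OF \<sigma>] Gal_hom(3)[OF \<sigma> c(1,2)]
      using Gal_hom(1)[OF \<sigma> c(1)] Gal_hom(1)[OF \<sigma> c(2)] c(3) by (simp add: m_assoc)
  qed (use Gal_hom(1) c in auto)
  also have "\<dots> = (\<Oplus>\<sigma>\<in>Gal. \<sigma> (x \<otimes> w)) \<otimes> v"
    using finsum_ldistr[OF finite_Gal c(3), of "\<lambda>\<sigma>. \<sigma> (x \<otimes> w)"] Gal_hom(1) c by (simp add: Pi_def)
  also have "\<dots> \<in> P \<cdot> A"
  proof (rule ideal_prod.prod[OF _ base(2)])
    have m: "\<sigma> (x \<otimes> w) \<in> M" if \<sigma>: "\<sigma> \<in> Gal" for \<sigma>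
    proof -
      have "x \<in> ginv \<sigma> ` M" using x(2)[OF Gal_above[OF ginv_Gal[OF \<sigma>] M]] .
      then obtain m where "m \<in> M" "x = ginv \<sigma> m" by blast
      then have "\<sigma> x \<in> M" using ginv_simp(1)[OF \<sigma>] LD.submod_carrier[OF LD.maxi_submod[OF Mx(1)]] by simp
      then have "\<sigma> w \<otimes> \<sigma> x \<in> M"
        using LD.submod_mult[OF LD.maxi_submod[OF Mx(1)] Gal_A[OF \<sigma> base(1)]] by blast
      then show ?thesis
        using Gal_hom(3)[OF \<sigma> c(1,2)] Gal_hom(1)[OF \<sigma> c(1)] Gal_hom(1)[OF \<sigma> c(2)] by (simp add: m_comm)
    qed
    have "(\<Oplus>\<sigma>\<in>Gal. \<sigma> (x \<otimes> w)) \<in> M" using finsum_submod[OF LD.maxi_submod[OF Mx(1)] finite_Gal m] .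
    moreover have "(\<Oplus>\<sigma>\<in>Gal. \<sigma> (x \<otimes> w)) \<in> K" using trace_in_K c by simp
    ultimately show "(\<Oplus>\<sigma>\<in>Gal. \<sigma> (x \<otimes> w)) \<in> P"
      using Mx LD.maxi_subset[OF Mx(1)] unfolding B_eq by blast
  qed
  finally show ?case .
next
  case (add g h f)
  have c: "\<sigma> x \<in> carrier L" "g \<sigma> \<in> carrier L" "h \<sigma> \<in> carrier L" if "\<sigma> \<in> Gal" for \<sigma>
    using sep_A[OF add(1) that] sep_A[OF add(3) that] Gal_A[OF that x(1)] LD.R_carrier by blast+
  have "(\<Oplus>\<sigma>\<in>Gal. \<sigma> x \<otimes> f \<sigma>) = (\<Oplus>\<sigma>\<in>Gal. \<sigma> x \<otimes> g \<sigma> \<oplus> \<sigma> x \<otimes> h \<sigma>)"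
    using c add(5) by (intro finsum_cong') (auto simp: r_distr)
  also have "\<dots> = (\<Oplus>\<sigma>\<in>Gal. \<sigma> x \<otimes> g \<sigma>) \<oplus> (\<Oplus>\<sigma>\<in>Gal. \<sigma> x \<otimes> h \<sigma>)"
    using c by (intro finsum_addf) auto
  finally show ?case using ideal_prod.sum[OF add(2,4)] by simp
qed

text \<open>For an \<open>f\<close> vanishing off \<open>gid\<close> the sum in
  \<open>sep_trace\<close> collapses to \<open>x\<close> times \<open>f gid\<close>, so
  \<open>f gid\<close> serves as \<open>d\<close> for all \<open>P\<close> at once.\<close>

lemma different_exists:
  "\<exists>d\<in>A. d \<noteq> \<zero> \<and> (\<forall>P M x. M \<in> above P \<longrightarrow> x \<in> A \<longrightarrow> (\<forall>N\<in>above P. x \<in> N) \<longrightarrow> d \<otimes> x \<in> P \<cdot> A)"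
proof -
  obtain f where f: "sep f" "\<forall>\<sigma>\<in>Gal - {gid}. f \<sigma> = \<zero>" "f gid \<noteq> \<zero>"
    using sep_vanishing[of "Gal - {gid}"] finite_Gal by blast
  have "f gid \<otimes> x \<in> P \<cdot> A" if "M \<in> above P" "x \<in> A" "\<forall>N\<in>above P. x \<in> N" for P M x
  proof -
    have xc: "x \<in> carrier L" "f gid \<in> carrier L" using that LD.R_carrier sep_A[OF f(1) gid_Gal] by blast+
    have "(\<Oplus>\<sigma>\<in>Gal. \<sigma> x \<otimes> f \<sigma>) = (\<Oplus>\<sigma>\<in>Gal. if gid = \<sigma> then x \<otimes> f \<sigma> else \<zero>)"
    proof (rule finsum_cong')
      fix \<sigma> assume \<sigma>: "\<sigma> \<in> Gal"
      show "\<sigma> x \<otimes> f \<sigma> = (if gid = \<sigma> then x \<otimes> f \<sigma> else \<zero>)"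
        using f(2) \<sigma> Gal_hom(1)[OF \<sigma> xc(1)] xc(1) by (auto simp: gid_simp)
    qed (use xc sep_A[OF f(1)] LD.R_carrier in auto)
    also have "\<dots> = x \<otimes> f gid"
      using finsum_singleton[OF gid_Gal finite_Gal, of "\<lambda>\<sigma>. x \<otimes> f \<sigma>"] xc sep_A[OF f(1)] LD.R_carrier by (simp add: Pi_def)
    finally show ?thesis
      using sep_trace[OF that(1,2) _ f(1)] that(3) xc by (simp add: m_comm)
  qed
  then show ?thesis using f(3) sep_A[OF f(1) gid_Gal] by blast
qed

text \<open>Were \<open>d\<close> outside \<open>M\<close>, writing \<open>1 = m + r d\<close> would
  give \<open>x = m x + r (d x)\<close>, an element of \<open>M \<cdot> M\<close>, for each
  \<open>x\<close> in the product of the primes above \<open>P\<close>. Cancelling one factor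
  \<open>M\<close> leaves the product of the other primes inside \<open>M\<close>, which is
  impossible.\<close>

lemma ramified_contains_different:
  assumes d: "d \<in> A" "\<And>P M x. M \<in> above P \<Longrightarrow> x \<in> A \<Longrightarrow> (\<forall>N\<in>above P. x \<in> N) \<Longrightarrow> d \<otimes> x \<in> P \<cdot> A"
    and M: "M \<in> above P" and ram: "P \<cdot> A \<subseteq> M \<cdot> M"
  shows "d \<in> M"
proof (rule ccontr)
  assume dM: "d \<notin> M"
  have Mx: "LD.maxi M" using M unfolding above_def by auto
  note Ms = LD.maxi_submod[OF Mx]
  let ?S = "above P"
  have S: "finite ?S" "\<And>N. N \<in> ?S \<Longrightarrow> LD.maxi N"
    using finite_above[OF above_prime[OF M]] unfolding above_def by auto
  let ?Q = "LD.fiprod ?S"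
  obtain m r where mr: "m \<in> M" "r \<in> A" "\<one> = m \<oplus> r \<otimes> d" using LD.maxi_comax[OF Mx d(1) dM] by blast
  have QM: "?Q \<subseteq> M \<cdot> M"
  proof
    fix x assume x: "x \<in> ?Q"
    have xN: "x \<in> N" if "N \<in> ?S" for N using LD.fiprod_subset[OF S that] x by blast
    have xA: "x \<in> A" using LD.maxi_subset[OF Mx] xN[OF M] by blast
    have dx: "d \<otimes> x \<in> M \<cdot> M" using d(2)[OF M xA] xN ram by blast
    have c: "m \<in> carrier L" "r \<in> carrier L" "d \<in> carrier L" "x \<in> carrier L"
      using mr d xA LD.submod_carrier[OF Ms] LD.R_carrier by blast+
    have "x = \<one> \<otimes> x" using c by simp
    also have "\<dots> = m \<otimes> x \<oplus> r \<otimes> (d \<otimes> x)" unfolding mr(3) using c by algebra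
    also have "\<dots> \<in> M \<cdot> M"
      using ideal_prod.sum[OF ideal_prod.prod[OF mr(1) xN[OF M]] LD.submod_mult[OF LD.submod_prod[OF Ms Ms] mr(2) dx]] .
    finally show "x \<in> M \<cdot> M" .
  qed
  let ?Q' = "LD.fiprod (?S - {M})"
  have S': "finite (?S - {M})" "\<And>N. N \<in> ?S - {M} \<Longrightarrow> LD.maxi N" using S by auto
  have "?Q = M \<cdot> ?Q'"
    using LD.fiprod_insert[of "?S - {M}" M] S M by (simp add: insert_absorb)
  then have "?Q' \<subseteq> M"
    using LD.prod_subset_cancel[OF LD.maxi_fracid[OF Mx] LD.int_ideal_submod Ms] QM LD.fiprod_int[OF S'] by auto
  then show False using LD.fiprod_subset_maxi[OF Mx S'] by blast
qed

end

section \<open>Residue fields, residue degrees and Ostrowski ideals\<close>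

lemma ring_of_integers_sel [simp]:
  "mult (ring_of_integers L) = mult L" "add (ring_of_integers L) = add L"
  "one (ring_of_integers L) = one L" "zero (ring_of_integers L) = zero L"
  unfolding ring_of_integers_def by simp_all

text \<open>In each step of the dimension, the pairs \<open>(c, e)\<close> correspond bijectively to
  the elements \<open>c v + e\<close>, because \<open>v\<close> lies outside
  \<open>E\<close>.\<close>

lemma (in ring) card_dimension:
  "dimension n k E \<Longrightarrow> subfield k R \<Longrightarrow> finite k \<Longrightarrow> finite E \<and> card E = card k ^ n"
proof (induct n k E rule: dimension.induct)
  case (zero_dim k)
  show ?case by simp
next
  case (Suc_dim v E n k)
  note k = Suc_dim.prems
  have kc: "k \<subseteq> carrier R" using subfieldE(3)[OF k(1)] .
  have ksub: "subring k R" using subfieldE(1)[OF k(1)] .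
  note props = space_subgroup_props[OF k(1) Suc_dim(3)]
  let ?f = "\<lambda>(c, e). c \<otimes> v \<oplus> e"
  have img: "line_extension k v E = ?f ` (k \<times> E)"
    using line_extension_mem_iff[of _ k v E] by force
  have "inj_on ?f (k \<times> E)"
  proof (rule inj_onI, clarify)
    fix c e c' e' assume *: "c \<in> k" "e \<in> E" "c' \<in> k" "e' \<in> E" "c \<otimes> v \<oplus> e = c' \<otimes> v \<oplus> e'"
    have car: "c \<in> carrier R" "c' \<in> carrier R" "e \<in> carrier R" "e' \<in> carrier R"
      using * kc props(1) by auto
    have "(c \<ominus> c') \<otimes> v = (c \<otimes> v \<oplus> e) \<ominus> c' \<otimes> v \<ominus> e"
      using car Suc_dim(1) by algebra
    also have "\<dots> = e' \<ominus> e" unfolding *(5) using car Suc_dim(1) by algebra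
    also have "\<dots> \<in> E" using props(3,4) * by (simp add: a_minus_def)
    finally have E: "(c \<ominus> c') \<otimes> v \<in> E" .
    have "c = c'"
    proof (rule ccontr)
      assume "c \<noteq> c'"
      then have "c \<ominus> c' \<noteq> \<zero>" using car by (simp add: r_right_minus_eq)
      moreover have "c \<ominus> c' \<in> k" using * subringE(5,7)[OF ksub] by (simp add: a_minus_def)
      ultimately have "v \<in> E" using props(6)[of "c \<ominus> c'" v] Suc_dim(1) E by blast
      then show False using Suc_dim(2) by blast
    qed
    moreover have "e = e'"
      using *(5) car Suc_dim(1) add.l_cancel[of "c \<otimes> v" e e'] unfolding \<open>c = c'\<close> by blast
    ultimately show "c = c' \<and> e = e'" by blast
  qed
  then have "card (line_extension k v E) = card k * card E"
    unfolding img by (simp add: card_image card_cartesian_product)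
  then show ?case using Suc_dim(4)[OF k] k(2) unfolding img by simp
qed

text \<open>Compares residue rings through their coset maps by counting alone, without building an
  isomorphism between quotients.\<close>

lemma card_image_cong_fibres:
  assumes "\<And>x y. x \<in> S \<Longrightarrow> y \<in> S \<Longrightarrow> f x = f y \<longleftrightarrow> g x = g y"
  shows "card (f ` S) = card (g ` S)"
proof -
  let ?h = "\<lambda>z. g (inv_into S f z)"
  have h: "?h (f x) = g x" if "x \<in> S" for x
    using assms[of "inv_into S f (f x)" x] that f_inv_into_f[of "f x" f S] inv_into_into[of "f x" f S] by blast
  have "inj_on ?h (f ` S)"
    by (rule inj_onI) (use h assms in force)
  moreover have "?h ` f ` S = g ` S" using h by (force simp: image_image)
  ultimately show ?thesis using card_image by metis
qed

context galois_ext
begin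

abbreviation coset :: "'a set \<Rightarrow> 'a \<Rightarrow> 'a set" where
  "coset M x \<equiv> M +>\<^bsub>ring_of_integers L\<^esub> x"

lemma A_ring: "ring (ring_of_integers L)" "cring (ring_of_integers L)"
  using LD.R_ring LD.R_cring unfolding ring_of_integers_eq[symmetric] by auto

lemma L_ideal: "ideal J (ring_of_integers L) \<longleftrightarrow> LD.int_ideal J"
  by (rule LD.ideal_iff[unfolded ring_of_integers_eq[symmetric]])

lemma L_maximal: "maximalideal M (ring_of_integers L) \<longleftrightarrow> LD.maxi M"
  by (rule LD.maximalideal_iff[unfolded ring_of_integers_eq[symmetric]])

lemma K_maximal: "maximalideal P (ring_of_integers (L\<lparr>carrier := K\<rparr>)) \<longleftrightarrow> KD.maxi P"
  by (rule KD.maximalideal_iff[unfolded ring_of_integers_eq[symmetric]])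

lemma coset_eq_iff:
  assumes "LD.maxi M" "x \<in> A" "y \<in> A" shows "coset M x = coset M y \<longleftrightarrow> x \<ominus> y \<in> M"
proof -
  have "ideal M (ring_of_integers L)" using L_ideal LD.maxi_int[OF assms(1)] by blast
  then have "(x \<ominus>\<^bsub>ring_of_integers L\<^esub> y \<in> M) = (coset M x = coset M y)"
    using ring.quotient_eq_iff_same_a_r_cos[OF A_ring(1) _ assms(2,3)] by blast
  moreover have "x \<ominus>\<^bsub>ring_of_integers L\<^esub> y = x \<ominus> y"
    using LD.subring_minus[unfolded ring_of_integers_eq[symmetric], OF assms(3)] by (simp add: a_minus_def)
  ultimately show ?thesis by simp
qed

text \<open>Turns the residue degree into an exponent relating two cardinalities, which
  automorphisms preserve; the base being above 1 makes the exponent recoverable.\<close>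

lemma residue_card:
  assumes M: "LD.maxi M"
  shows "card (coset M ` A) = card (coset M ` B) ^ residue_degree L K M"
    and "card (coset M ` B) > 1" and "card (coset M ` A) > 1"
proof -
  let ?R = "ring_of_integers L"
  define Q where "Q = ?R Quot M"
  have max: "maximalideal M ?R" using L_maximal M by blast
  then interpret MI: maximalideal M ?R .
  interpret Q: field Q unfolding Q_def by (rule MI.quotient_is_field[OF A_ring(2)])
  have hom: "coset M \<in> ring_hom ?R Q" unfolding Q_def by (rule MI.rcos_ring_hom)
  interpret H: ring_hom_ring ?R Q "coset M"
    by (rule ring_hom_ringI2[OF A_ring(1) Q.is_ring hom])
  have Qc: "carrier Q = coset M ` A"
    unfolding Q_def FactRing_def by (auto simp: A_RCOSETS_def')
  let ?k = "coset M ` B"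
  have "ring (?R\<lparr>carrier := B\<rparr>)"
    using KD.R_ring unfolding ring_of_integers_def by simp
  then have "subring B ?R"
    by (rule ring.ring_incl_imp_subring[OF A_ring(1) BA(1)])
  then have ksub: "subring ?k Q" by (rule H.img_is_subring)
  have k: "subfield ?k Q"
  proof (rule Q.subfieldI'[OF ksub])
    fix z assume "z \<in> ?k - {\<zero>\<^bsub>Q\<^esub>}"
    then obtain x where x: "x \<in> B" "z = coset M x" "coset M x \<noteq> \<zero>\<^bsub>Q\<^esub>" by blast
    have zero: "coset M \<zero> = \<zero>\<^bsub>Q\<^esub>" using H.hom_zero by simp
    have xA: "x \<in> A" using x BA(1) by blast
    have "x \<notin> M"
      using coset_eq_iff[OF M xA LD.R_zero] x(3) zero LD.R_carrier[OF xA] by (auto simp: a_minus_def)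
    \<comment> \<open>The inverse of the class of \<open>x\<close> is found already among the
      classes of \<open>B\<close>, by comaximality of \<open>x\<close> with the prime below.\<close>
    then obtain m r where mr: "m \<in> M \<inter> B" "r \<in> B" "\<one> = m \<oplus> r \<otimes> x"
      using KD.maxi_comax[OF below_maxi[OF M] x(1)] by blast
    have c: "m \<in> carrier L" "r \<in> carrier L" "x \<in> carrier L" using mr x B_carrier by blast+
    have "r \<otimes> x \<ominus> \<one> = \<ominus> m" unfolding mr(3) using c by algebra
    then have "r \<otimes> x \<ominus> \<one> \<in> M" using mr(1) LD.submod_minus[OF LD.maxi_submod[OF M]] by simp
    moreover have rA: "r \<in> A" "r \<otimes> x \<in> A" using mr(2) xA BA(1) LD.R_mult by blast+
    ultimately have "coset M (r \<otimes> x) = coset M \<one>" using coset_eq_iff[OF M rA(2) LD.R_one] by blast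
    moreover have "coset M (r \<otimes> x) = coset M r \<otimes>\<^bsub>Q\<^esub> coset M x"
      using H.hom_mult[of r x] rA xA by simp
    moreover have "coset M \<one> = \<one>\<^bsub>Q\<^esub>" using H.hom_one by simp
    ultimately have "coset M x \<otimes>\<^bsub>Q\<^esub> coset M r = \<one>\<^bsub>Q\<^esub>"
      using Q.m_comm[of "coset M r" "coset M x"] Qc rA(1) xA by simp
    then have "inv\<^bsub>Q\<^esub> coset M x = coset M r"
      using Q.comm_inv_char[of "coset M x" "coset M r"] Qc rA(1) xA by simp
    then show "inv\<^bsub>Q\<^esub> z \<in> ?k" using x(2) mr(2) by simp
  qed
  have finA: "finite (coset M ` A)"
  proof -
    obtain a where a: "a \<in> M" "a \<noteq> \<zero>"
      using LD.maxi_nonzero[OF M] LD.submod_zero[OF LD.maxi_submod[OF M]] by blast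
    have aA: "a \<in> A" using a LD.maxi_subset[OF M] by blast
    obtain S where S: "finite S" "S \<subseteq> A" "\<forall>x\<in>A. \<exists>s\<in>S. \<exists>r\<in>A. x = s \<oplus> a \<otimes> r"
      using LD.R_finite_quotient[OF aA a(2)] by (elim exE conjE) simp
    have "coset M ` A \<subseteq> coset M ` S"
    proof clarify
      fix x assume x: "x \<in> A"
      obtain s r where s: "s \<in> S" "r \<in> A" "x = s \<oplus> a \<otimes> r" using S(3) x by blast
      have sA: "s \<in> A" using s S by blast
      have c: "s \<in> carrier L" "r \<in> carrier L" "a \<in> carrier L" using sA s(2) aA LD.R_carrier by blast+
      have "x \<ominus> s = r \<otimes> a" unfolding s(3) using c by algebra
      then have "x \<ominus> s \<in> M" using LD.submod_mult[OF LD.maxi_submod[OF M] s(2) a(1)] by simp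
      then have "coset M x = coset M s" using coset_eq_iff[OF M x sA] by blast
      then show "coset M x \<in> coset M ` S" using s(1) by blast
    qed
    then show ?thesis using S(1) finite_subset by blast
  qed
  have finB: "finite ?k" using finA BA(1) finite_subset[of ?k "coset M ` A"] by blast
  \<comment> \<open>All elements of the finite residue field serve as a spanning list. Finite
    dimension has to be known before \<open>dim\<close> denotes the actual dimension.\<close>
  obtain us where us: "set us = carrier Q" using finA Qc finite_list by metis
  have "Q.Span ?k us = carrier Q"
  proof
    show "Q.Span ?k us \<subseteq> carrier Q"
      using Q.Span_in_carrier[of ?k us] us subfieldE(3)[OF k] by simp
    show "carrier Q \<subseteq> Q.Span ?k us" using Q.Span_base_incl[OF k, of us] us by simp
  qed
  then have "Q.finite_dimension ?k (carrier Q)" using Q.Span_finite_dimension[OF k, of us] us by simp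
  then have "Q.dimension (Q.dim ?k (carrier Q)) ?k (carrier Q)"
    using Q.finite_dimensionE[OF k] unfolding over_def by blast
  moreover have "Q.dim ?k (carrier Q) = residue_degree L K M"
    unfolding residue_degree_def Q_def ..
  ultimately show "card (coset M ` A) = card ?k ^ residue_degree L K M"
    using Q.card_dimension[OF _ k finB] Qc by simp
  have "coset M \<one> \<noteq> coset M \<zero>"
    using coset_eq_iff[OF M LD.R_one LD.R_zero] LD.maxi_one[OF M] by (simp add: a_minus_def)
  moreover have "{coset M \<one>, coset M \<zero>} \<subseteq> ?k" using KD.R_one KD.R_zero by blast
  ultimately have "2 \<le> card ?k" using card_mono[OF finB, of "{coset M \<one>, coset M \<zero>}"] by simp
  then show "card ?k > 1" by simp
  moreover have "card ?k \<le> card (coset M ` A)" using card_mono[OF finA] BA(1) by blast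
  ultimately show "card (coset M ` A) > 1" by simp
qed

lemma residue_degree_pos: "LD.maxi M \<Longrightarrow> residue_degree L K M \<ge> 1"
  using residue_card(1,3)[of M] by (cases "residue_degree L K M") auto

text \<open>An automorphism carrying \<open>M\<close> to \<open>N\<close> matches the cosets of
  \<open>A\<close>, while the classes of \<open>B\<close> depend only on \<open>P\<close>. So both
  degrees are exponents giving the same power of the same number.\<close>

lemma residue_degree_eq:
  assumes M: "M \<in> above P" and N: "N \<in> above P"
  shows "residue_degree L K M = residue_degree L K N"
proof -
  obtain \<sigma> where \<sigma>: "\<sigma> \<in> Gal" "\<sigma> ` M = N" using Gal_transitive[OF assms] by blast
  have Mx: "LD.maxi M" "M \<inter> B = P" and Nx: "LD.maxi N" "N \<inter> B = P"
    using assms unfolding above_def by auto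
  have Mc: "M \<subseteq> carrier L" using LD.submod_subset[OF LD.maxi_submod[OF Mx(1)]] .
  have "\<sigma> ` A = A"
  proof
    show "\<sigma> ` A \<subseteq> A" using Gal_A[OF \<sigma>(1)] by blast
    show "A \<subseteq> \<sigma> ` A"
    proof
      fix x assume x: "x \<in> A"
      then have "x = \<sigma> (ginv \<sigma> x)" using ginv_simp(1)[OF \<sigma>(1)] LD.R_carrier by simp
      then show "x \<in> \<sigma> ` A" using Gal_A[OF ginv_Gal[OF \<sigma>(1)] x] by blast
    qed
  qed
  have "card (coset M ` A) = card ((\<lambda>x. coset N (\<sigma> x)) ` A)"
  proof (rule card_image_cong_fibres)
    fix x y assume xy: "x \<in> A" "y \<in> A"
    have c: "x \<in> carrier L" "y \<in> carrier L" using xy LD.R_carrier by blast+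
    have "\<sigma> x \<ominus> \<sigma> y \<in> N \<longleftrightarrow> x \<ominus> y \<in> M"
    proof
      assume "\<sigma> x \<ominus> \<sigma> y \<in> N"
      then have "\<sigma> (x \<ominus> y) \<in> \<sigma> ` M" using Gal_diff[OF \<sigma>(1) c] \<sigma>(2) by simp
      then obtain m where "m \<in> M" "\<sigma> (x \<ominus> y) = \<sigma> m" by blast
      then show "x \<ominus> y \<in> M" using Gal_inj[OF \<sigma>(1), of "x \<ominus> y" m] Mc c by auto
    next
      assume "x \<ominus> y \<in> M"
      then show "\<sigma> x \<ominus> \<sigma> y \<in> N" using Gal_diff[OF \<sigma>(1) c] \<sigma>(2) by (metis imageI)
    qed
    then show "coset M x = coset M y \<longleftrightarrow> coset N (\<sigma> x) = coset N (\<sigma> y)"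
      using coset_eq_iff[OF Mx(1) xy] coset_eq_iff[OF Nx(1) Gal_A[OF \<sigma>(1) xy(1)] Gal_A[OF \<sigma>(1) xy(2)]] by blast
  qed
  also have "(\<lambda>x. coset N (\<sigma> x)) ` A = coset N ` A" using \<open>\<sigma> ` A = A\<close> by (metis image_image)
  finally have cardA: "card (coset M ` A) = card (coset N ` A)" .
  have cardB: "card (coset M ` B) = card (coset N ` B)"
  proof (rule card_image_cong_fibres)
    fix x y assume xy: "x \<in> B" "y \<in> B"
    have xyA: "x \<in> A" "y \<in> A" using xy BA(1) by blast+
    have "x \<ominus> y \<in> B"
    proof -
      have "x \<ominus> y \<in> A" using LD.submod_diff[OF LD.submod_R xyA] .
      moreover have "x \<ominus> y \<in> K"
        unfolding a_minus_def using xy BA(2) subringE(5,7)[OF K_sub(1)] by blast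
      ultimately show ?thesis unfolding B_eq by blast
    qed
    then show "coset M x = coset M y \<longleftrightarrow> coset N x = coset N y"
      using coset_eq_iff[OF Mx(1) xyA] coset_eq_iff[OF Nx(1) xyA] Mx(2) Nx(2) by blast
  qed
  have "card (coset N ` B) ^ residue_degree L K M = card (coset N ` B) ^ residue_degree L K N"
    using residue_card(1)[OF Mx(1)] residue_card(1)[OF Nx(1)] cardA cardB by simp
  then show ?thesis using power_inject_exp[OF residue_card(2)[OF Nx(1)]] by blast
qed

lemma LFI: "fractional_ideals L = LD.FI"
  by (rule LD.fractional_ideals_eq) simp

lemma KFI: "fractional_ideals (L\<lparr>carrier := K\<rparr>) = KD.FI"
  by (rule KD.fractional_ideals_eq) simp

text \<open>By \<open>maxi_pow_eq\<close>, a prime has norm \<open>P^f\<close> with \<open>f\<close>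
  positive exactly when it lies above \<open>P\<close> and has residue degree
  \<open>f\<close>.\<close>

lemma ostrowski_ideal_eq:
  assumes P: "KD.maxi P" and f: "f \<ge> 1"
  shows "ostrowski_ideal L K P f = LD.fiprod {M \<in> above P. residue_degree L K M = f}"
proof -
  have "{M. maximalideal M (ring_of_integers L) \<and>
      relative_norm L K M = P [^]\<^bsub>fractional_ideals (L\<lparr>carrier := K\<rparr>)\<^esub> f} =
    {M \<in> above P. residue_degree L K M = f}"
    unfolding L_maximal relative_norm_def prime_below_def KFI above_def
    using KD.maxi_pow_eq[OF P below_maxi] f by auto
  then show ?thesis unfolding ostrowski_ideal_def LFI by simp
qed

lemma ostrowski_cases:
  assumes P: "KD.maxi P" and f: "f \<ge> 1"
  shows "ostrowski_ideal L K P f = A \<or> ostrowski_ideal L K P f = LD.fiprod (above P)"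
proof (cases "{M \<in> above P. residue_degree L K M = f} = {}")
  case True
  then show ?thesis unfolding ostrowski_ideal_eq[OF assms] by (simp only: True) simp
next
  case False
  then obtain M where "M \<in> above P" "residue_degree L K M = f" by blast
  then have "{M \<in> above P. residue_degree L K M = f} = above P" using residue_degree_eq by blast
  then show ?thesis using ostrowski_ideal_eq[OF assms] by simp
qed

lemma ostrowski_attained:
  assumes P: "KD.maxi P"
  shows "\<exists>f\<ge>1. ostrowski_ideal L K P f = LD.fiprod (above P)"
proof (cases "above P = {}")
  \<comment> \<open>With no prime above \<open>P\<close> both products are empty, and any positive
    exponent serves.\<close>
  case True
  then show ?thesis using ostrowski_ideal_eq[OF P, of 1] by (intro exI[of _ 1]) simp
next
  case False
  then obtain M where M: "M \<in> above P" by blast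
  let ?f = "residue_degree L K M"
  have "{N \<in> above P. residue_degree L K N = ?f} = above P" using residue_degree_eq[OF M] by auto
  moreover have "?f \<ge> 1" using residue_degree_pos M unfolding above_def by blast
  ultimately show ?thesis using ostrowski_ideal_eq[OF P, of ?f] by (intro exI[of _ ?f]) simp
qed

subsection \<open>Ramification indices\<close>

definition divides_pow :: "'a set \<Rightarrow> 'a set \<Rightarrow> nat \<Rightarrow> bool" where
  "divides_pow P M e \<longleftrightarrow> (\<exists>J. LD.int_ideal J \<and> P \<cdot> A = (M [^]\<^bsub>LD.FI\<^esub> e) \<cdot> J)"

lemma ramification_index_eq: "ramification_index L P M = (GREATEST e. divides_pow P M e)"
  unfolding ramification_index_def divides_pow_def extend_ideal_def LFI L_ideal ..

context
  fixes P M assumes M: "M \<in> above P"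
begin

lemma M_maxi: "LD.maxi M"
  using M unfolding above_def by simp

lemma PA: "LD.int_ideal (P \<cdot> A)" "P \<cdot> A \<noteq> {\<zero>}"
  using extend_props[OF KD.maxi_int KD.maxi_nonzero] above_prime[OF M] by blast+

lemma M_pow: "LD.int_ideal (M [^]\<^bsub>LD.FI\<^esub> (e::nat))" "M [^]\<^bsub>LD.FI\<^esub> (e::nat) \<noteq> {\<zero>}"
  using LD.pow_int[OF LD.maxi_int LD.maxi_nonzero] M_maxi by blast+

lemma divides_pow_iff: "divides_pow P M e \<longleftrightarrow> P \<cdot> A \<subseteq> M [^]\<^bsub>LD.FI\<^esub> e"
proof
  assume "divides_pow P M e"
  then obtain J where J: "LD.int_ideal J" "P \<cdot> A = (M [^]\<^bsub>LD.FI\<^esub> e) \<cdot> J" unfolding divides_pow_def by blast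
  have "(M [^]\<^bsub>LD.FI\<^esub> e) \<cdot> J \<subseteq> (M [^]\<^bsub>LD.FI\<^esub> e) \<cdot> A"
    using LD.prod_mono[OF subset_refl] J(1) unfolding LD.int_ideal_def by blast
  then show "P \<cdot> A \<subseteq> M [^]\<^bsub>LD.FI\<^esub> e" using J(2) LD.prod_R_right[OF LD.int_ideal_submod[OF M_pow(1)]] by simp
next
  assume "P \<cdot> A \<subseteq> M [^]\<^bsub>LD.FI\<^esub> e"
  then show "divides_pow P M e"
    unfolding divides_pow_def
    using LD.divides_if_subset[OF LD.int_ideal_fracid[OF M_pow] LD.int_ideal_fracid[OF PA]] by blast
qed

lemma M_carrier: "M \<in> carrier LD.FI"
  using LD.maxi_fracid[OF M_maxi] by simp

lemma M_pow_antimono: "k \<le> e \<Longrightarrow> M [^]\<^bsub>LD.FI\<^esub> (e::nat) \<subseteq> M [^]\<^bsub>LD.FI\<^esub> k"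
proof -
  assume "k \<le> e"
  then have "M [^]\<^bsub>LD.FI\<^esub> e = (M [^]\<^bsub>LD.FI\<^esub> (e - k)) \<cdot> (M [^]\<^bsub>LD.FI\<^esub> k)"
    using LD.FI.nat_pow_mult[OF M_carrier, of "e - k" k] by simp
  then show ?thesis using LD.prod_int_left[OF M_pow(1) LD.int_ideal_submod[OF M_pow(1)]] by simp
qed

text \<open>The powers of \<open>M\<close> up to \<open>e\<close> are distinct ideals above
  \<open>P \<cdot> A\<close>, and there are only finitely many of those. The bound makes
  \<open>GREATEST\<close> an actual maximum.\<close>

lemma divides_pow_bounded: "\<exists>N. \<forall>e. divides_pow P M e \<longrightarrow> e \<le> N"
proof -
  let ?O = "{J. LD.int_ideal J \<and> P \<cdot> A \<subseteq> J}"
  have fin: "finite ?O" using LD.finite_overideals'[OF PA] .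
  have "e \<le> card ?O" if "divides_pow P M e" for e
  proof -
    have "(\<lambda>k. M [^]\<^bsub>LD.FI\<^esub> (k::nat)) ` {..e} \<subseteq> ?O"
      using that[unfolded divides_pow_iff] M_pow(1) M_pow_antimono by fastforce
    then have "card ((\<lambda>k. M [^]\<^bsub>LD.FI\<^esub> (k::nat)) ` {..e}) \<le> card ?O" using card_mono[OF fin] by blast
    moreover have "inj_on (\<lambda>k. M [^]\<^bsub>LD.FI\<^esub> (k::nat)) {..e}"
      using LD.maxi_pow_inj[OF M_maxi] by (intro inj_onI) blast
    ultimately show ?thesis by (simp add: card_image)
  qed
  then show ?thesis by blast
qed

lemma pow_two: "M [^]\<^bsub>LD.FI\<^esub> (2::nat) = M \<cdot> M"
  using M_carrier by (simp add: numeral_2_eq_2 LD.prod_R[OF LD.maxi_submod[OF M_maxi]])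

text \<open>The exponent 1 always occurs, as \<open>M\<close> contains \<open>P \<cdot> A\<close>;
  so the greatest one is 1 exactly when 2 does not occur.\<close>

lemma ramification_index_one_iff: "ramification_index L P M = 1 \<longleftrightarrow> \<not> P \<cdot> A \<subseteq> M \<cdot> M"
proof -
  obtain N where N: "\<And>e. divides_pow P M e \<Longrightarrow> e \<le> N" using divides_pow_bounded by blast
  have "M [^]\<^bsub>LD.FI\<^esub> (1::nat) = M" using M_carrier LD.FI.nat_pow_eone by blast
  moreover have "P \<cdot> A \<subseteq> M" using extend_subset_iff[OF above_prime[OF M] M_maxi] M unfolding above_def by simp
  ultimately have 1: "divides_pow P M 1" unfolding divides_pow_iff by simp
  have ge: "(GREATEST e. divides_pow P M e) \<ge> e" if "divides_pow P M e" for e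
    using Greatest_le_nat[of "divides_pow P M" e N] that N by blast
  have G: "divides_pow P M (GREATEST e. divides_pow P M e)"
    using GreatestI_nat[of "divides_pow P M" 1 N] 1 N by blast
  show ?thesis
  proof
    assume "ramification_index L P M = 1"
    then have "\<not> divides_pow P M 2" using ge[of 2] unfolding ramification_index_eq by auto
    then show "\<not> P \<cdot> A \<subseteq> M \<cdot> M" unfolding divides_pow_iff pow_two .
  next
    assume *: "\<not> P \<cdot> A \<subseteq> M \<cdot> M"
    have "\<not> (GREATEST e. divides_pow P M e) \<ge> 2"
    proof
      assume two: "(GREATEST e. divides_pow P M e) \<ge> 2"
      have "P \<cdot> A \<subseteq> M [^]\<^bsub>LD.FI\<^esub> (2::nat)"
        by (rule subset_trans[OF iffD1[OF divides_pow_iff G] M_pow_antimono[OF two]])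
      then show False using * unfolding pow_two by blast
    qed
    then show "ramification_index L P M = 1" unfolding ramification_index_eq using ge[OF 1] by simp
  qed
qed

end

lemma unramified_iff: "unramified L K P \<longleftrightarrow> (\<forall>M\<in>above P. \<not> P \<cdot> A \<subseteq> M \<cdot> M)"
proof -
  have "unramified L K P \<longleftrightarrow> (\<forall>M\<in>above P. ramification_index L P M = 1)"
    unfolding unramified_def L_maximal prime_below_def above_def by simp
  then show ?thesis using ramification_index_one_iff by blast
qed

text \<open>Every ramified prime is the contraction of an ideal containing the one nonzero integer
  \<open>d\<close>, and such ideals are finite in number.\<close>

lemma finite_ramified: "finite {P. KD.maxi P \<and> \<not> unramified L K P}"
proof -
  obtain d where d: "d \<in> A" "d \<noteq> \<zero>"
    and d': "\<forall>P M x. M \<in> above P \<longrightarrow> x \<in> A \<longrightarrow> (\<forall>N\<in>above P. x \<in> N) \<longrightarrow> d \<otimes> x \<in> P \<cdot> A"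
    using different_exists by (elim bexE conjE)
  have "P \<in> (\<lambda>M. M \<inter> B) ` {M. LD.int_ideal M \<and> d \<in> M}" if ram: "\<not> unramified L K P" for P
  proof -
    obtain M where M: "M \<in> above P" "P \<cdot> A \<subseteq> M \<cdot> M" using ram unramified_iff by blast
    have "d \<in> M" by (rule ramified_contains_different[OF d(1) _ M]) (use d' in blast)
    then show ?thesis using M(1) LD.maxi_int unfolding above_def by blast
  qed
  then have "{P. KD.maxi P \<and> \<not> unramified L K P} \<subseteq> (\<lambda>M. M \<inter> B) ` {M. LD.int_ideal M \<and> d \<in> M}" by blast
  then show ?thesis by (rule finite_subset) (rule finite_imageI[OF LD.finite_overideals[OF d]])
qed

text \<open>Let \<open>J\<close> be the cofactor of the product in \<open>P \<cdot> A\<close>. A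
  prime \<open>N\<close> containing \<open>J\<close> would itself lie above \<open>P\<close>, so it
  would occur in the product as well, and \<open>N \<cdot> N\<close> would contain
  \<open>P \<cdot> A\<close>.\<close>

lemma unramified_product:
  assumes P: "KD.maxi P" and un: "unramified L K P" shows "LD.fiprod (above P) = P \<cdot> A"
proof -
  note E = extend_props[OF KD.maxi_int[OF P] KD.maxi_nonzero[OF P]]
  have S: "finite (above P)" "\<And>N. N \<in> above P \<Longrightarrow> LD.maxi N \<and> P \<cdot> A \<subseteq> N"
    using finite_above[OF P] extend_subset_iff[OF P] unfolding above_def by simp_all
  obtain J where J: "LD.int_ideal J" "J \<noteq> {\<zero>}" "P \<cdot> A = LD.fiprod (above P) \<cdot> J"
    using LD.fiprod_divides[OF E(1,2) S] by blast
  have Q: "LD.int_ideal (LD.fiprod (above P))" using LD.fiprod_int[OF S(1)] S(2) by blast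
  have "J = A"
  proof (rule ccontr)
    assume "J \<noteq> A"
    then obtain N where N: "LD.maxi N" "J \<subseteq> N" using LD.maxi_exists[OF J(1,2)] by blast
    have "P \<cdot> A \<subseteq> J" using LD.prod_int_left[OF Q LD.int_ideal_submod[OF J(1)]] J(3) by simp
    then have NS: "N \<in> above P" using extend_subset_iff[OF P N(1)] N unfolding above_def by blast
    have "LD.fiprod (above P) \<subseteq> N" using LD.fiprod_subset[OF S(1) _ NS] S(2) by blast
    then have "P \<cdot> A \<subseteq> N \<cdot> N" using LD.prod_mono[OF _ N(2)] J(3) by simp
    then show False using un NS unramified_iff by blast
  qed
  then show ?thesis using J(3) LD.prod_R_right[OF LD.int_ideal_submod[OF Q]] by simp
qed

end

section \<open>Class groups\<close>

context dedekind_subring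
begin

abbreviation prin :: "'a \<Rightarrow> 'a set" where
  "prin x \<equiv> (\<lambda>a. a \<otimes> x) ` R"

definition PR :: "'a set set" where
  "PR = {prin x | x. x \<in> carrier F \<and> x \<noteq> \<zero>}"

lemma prin_mult:
  assumes x: "x \<in> carrier F" and y: "y \<in> carrier F" shows "prin x \<cdot> prin y = prin (x \<otimes> y)"
proof
  show "prin x \<cdot> prin y \<subseteq> prin (x \<otimes> y)"
  proof (rule prod_least[OF submod_principal])
    show "x \<otimes> y \<in> carrier F" using x y by simp
    fix i j assume "i \<in> prin x" "j \<in> prin y"
    then obtain a b where ab: "a \<in> R" "b \<in> R" "i = a \<otimes> x" "j = b \<otimes> y" by blast
    have "i \<otimes> j = (a \<otimes> b) \<otimes> (x \<otimes> y)"
      unfolding ab(3,4) using R_carrier[OF ab(1)] R_carrier[OF ab(2)] x y by algebra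
    then show "i \<otimes> j \<in> prin (x \<otimes> y)" using R_mult[OF ab(1,2)] by blast
  qed
  show "prin (x \<otimes> y) \<subseteq> prin x \<cdot> prin y"
  proof
    fix z assume "z \<in> prin (x \<otimes> y)"
    then obtain a where a: "a \<in> R" "z = a \<otimes> (x \<otimes> y)" by blast
    then have "z = (a \<otimes> x) \<otimes> (\<one> \<otimes> y)" using R_carrier[OF a(1)] x y by (simp add: m_assoc)
    then show "z \<in> prin x \<cdot> prin y" using a(1) R_one by (auto intro!: ideal_prod.prod)
  qed
qed

lemma prin_one: "prin \<one> = R"
  using R_carrier by force

lemma PR_subgroup: "subgroup PR FI"
proof (rule FI.subgroupI)
  show "PR \<subseteq> carrier FI" unfolding PR_def using fracid_principal by auto
  show "PR \<noteq> {}" unfolding PR_def using one_closed one_not_zero by blast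
  show "I \<otimes>\<^bsub>FI\<^esub> J \<in> PR" if IJ: "I \<in> PR" "J \<in> PR" for I J
  proof -
    obtain x y where xy: "x \<in> carrier F" "x \<noteq> \<zero>" "y \<in> carrier F" "y \<noteq> \<zero>" "I = prin x" "J = prin y"
      using IJ unfolding PR_def by blast
    have "I \<otimes>\<^bsub>FI\<^esub> J = prin (x \<otimes> y)" using prin_mult xy by simp
    moreover have "x \<otimes> y \<noteq> \<zero>" using integral[of x y] xy by blast
    ultimately show ?thesis unfolding PR_def using xy(1,3) by blast
  qed
  show "finv I \<in> PR" if I: "I \<in> PR" for I
  proof -
    obtain x where x: "x \<in> carrier F" "x \<noteq> \<zero>" "I = prin x" using I unfolding PR_def by blast
    have i: "inv x \<in> carrier F" "inv x \<otimes> x = \<one>" "inv x \<noteq> \<zero>"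
      using x field_Units nonzero_imp_inverse_nonzero by auto
    have "finv I = prin (inv x)"
    proof (rule FI.inv_equality)
      show "prin (inv x) \<otimes>\<^bsub>FI\<^esub> I = \<one>\<^bsub>FI\<^esub>" using prin_mult[OF i(1) x(1)] x(3) i(2) prin_one by simp
    qed (use x i fracid_principal in auto)
    then show ?thesis unfolding PR_def using i by blast
  qed
qed

definition CG :: "'a set set monoid" where "CG = FI Mod PR"

definition cl :: "'a set \<Rightarrow> 'a set set" where "cl I = PR #>\<^bsub>FI\<^esub> I"

lemma PR_normal: "PR \<lhd> FI"
  using FI.normal_iff_subgroup PR_subgroup by blast

lemma CG_comm_group: "comm_group CG"
  unfolding CG_def by (rule FI.abelian_FactGroup[OF PR_subgroup])

lemma CG_carrier: "carrier CG = cl ` {I. fracid I}"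
  unfolding CG_def carrier_FactGroup cl_def by simp

lemma cl_mult: "fracid I \<Longrightarrow> fracid J \<Longrightarrow> cl I \<otimes>\<^bsub>CG\<^esub> cl J = cl (I \<cdot> J)"
  unfolding cl_def CG_def using normal.rcos_sum[OF PR_normal, of I J] by simp

lemma cl_one: "cl R = \<one>\<^bsub>CG\<^esub>"
  unfolding cl_def CG_def using FI.coset_join2[OF FI.one_closed PR_subgroup subgroup.one_closed[OF PR_subgroup]]
  by simp

lemma cl_prin: "x \<in> carrier F \<Longrightarrow> x \<noteq> \<zero> \<Longrightarrow> cl (prin x) = \<one>\<^bsub>CG\<^esub>"
  unfolding cl_def CG_def using FI.coset_join2[of "prin x", OF _ PR_subgroup] fracid_principal[of x]
  by (auto simp: PR_def)

lemma principal_eq: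
  assumes "R = integers F" shows "principal_fractional_ideals F = PR"
  unfolding principal_fractional_ideals_def PR_def assms[symmetric] ..

lemma class_group_eq:
  assumes "R = integers F" shows "class_group F = CG" "ideal_class F = cl"
  unfolding class_group_def ideal_class_def CG_def cl_def fun_eq_iff
    principal_eq[OF assms] fractional_ideals_eq[OF assms] by auto

end

section \<open>Extension of ideal classes and comparison of the subgroups\<close>

context galois_ext
begin

lemma extend_fracid:
  assumes I: "KD.fracid I" shows "LD.fracid (I \<cdot> A)"
proof -
  note Is = KD.fracid_submod[OF I]
  have IK: "I \<subseteq> K" "I \<subseteq> carrier L" using KD.submod_subset[OF Is] K_sub(2) by auto
  have Ac: "A \<subseteq> carrier L" using LD.R_carrier by blast
  have eq: "I \<cdot> A = A \<cdot> I" using LD.prod_comm[OF IK(2) Ac] .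
  have s: "LD.submod (I \<cdot> A)"
    unfolding eq using LD.submod_prod'[OF LD.submod_R IK(2)] KD.submod_zero[OF Is] by blast
  obtain y where y: "y \<in> I" "y \<noteq> \<zero>" using KD.fracid_nonzero[OF I] by blast
  have "y \<otimes> \<one> \<in> I \<cdot> A" by (rule ideal_prod.prod[OF y(1) LD.R_one])
  then have ne: "I \<cdot> A \<noteq> {\<zero>}" using y IK(2) by auto
  obtain d where d: "d \<in> B" "d \<noteq> \<zero>" "\<forall>x\<in>I. d \<otimes> x \<in> B" using I unfolding KD.fracid_def by blast
  have dc: "d \<in> carrier L" using B_carrier[OF d(1)] .
  have "d \<otimes> z \<in> A" if "z \<in> I \<cdot> A" for z
    using that
  proof induct
    case (prod i j)
    have "d \<otimes> (i \<otimes> j) = (d \<otimes> i) \<otimes> j" using prod dc IK(2) Ac by (intro m_assoc[symmetric]) auto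
    then show ?case using d(3) prod BA(1) LD.R_mult by (metis subsetD)
  next
    case (sum x y)
    have "x \<in> carrier L" "y \<in> carrier L" using sum(1,3) LD.submod_carrier[OF s] by blast+
    then show ?case using sum dc LD.R_add by (simp add: r_distr)
  qed
  then show ?thesis unfolding LD.fracid_def using s ne d(1,2) BA(1) by blast
qed

lemma extend_mult:
  assumes I: "KD.fracid I" and J: "KD.fracid J" shows "(I \<cdot> J) \<cdot> A = (I \<cdot> A) \<cdot> (J \<cdot> A)"
proof -
  have c: "I \<subseteq> carrier L" "J \<subseteq> carrier L" "A \<subseteq> carrier L"
    using KD.submod_subset[OF KD.fracid_submod[OF I]] KD.submod_subset[OF KD.fracid_submod[OF J]] K_sub(2)
      LD.R_carrier by blast+
  have "(I \<cdot> A) \<cdot> (J \<cdot> A) = I \<cdot> (A \<cdot> (J \<cdot> A))"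
    using LD.prod_assoc'[OF c(1,3) LD.prod_carrier[OF c(2,3)]] .
  also have "A \<cdot> (J \<cdot> A) = J \<cdot> A" using LD.prod_R[OF LD.fracid_submod[OF extend_fracid[OF J]]] .
  also have "I \<cdot> (J \<cdot> A) = (I \<cdot> J) \<cdot> A" using LD.prod_assoc'[OF c] by simp
  finally show ?thesis by simp
qed

abbreviation Kprin :: "'a \<Rightarrow> 'a set" where
  "Kprin x \<equiv> (\<lambda>a. a \<otimes> x) ` B"

lemma extend_prin:
  assumes x: "x \<in> K" shows "Kprin x \<cdot> A = LD.prin x"
proof
  have xc: "x \<in> carrier L" using x K_sub(2) by blast
  show "Kprin x \<cdot> A \<subseteq> LD.prin x"
  proof (rule LD.prod_least[OF LD.submod_principal[OF xc]])
    fix i j assume ij: "i \<in> Kprin x" "j \<in> A"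
    obtain b where b: "b \<in> B" "i = b \<otimes> x" using ij(1) by (elim imageE)
    have "i \<otimes> j = (b \<otimes> j) \<otimes> x"
      unfolding b(2) using B_carrier[OF b(1)] LD.R_carrier[OF ij(2)] xc by algebra
    then show "i \<otimes> j \<in> LD.prin x" using LD.R_mult[OF _ ij(2), of b] b(1) BA(1) by blast
  qed
  show "LD.prin x \<subseteq> Kprin x \<cdot> A"
  proof clarify
    fix a assume a: "a \<in> A"
    have "(\<one> \<otimes> x) \<otimes> a \<in> Kprin x \<cdot> A" by (rule ideal_prod.prod[OF imageI[OF KD.R_one] a])
    then show "a \<otimes> x \<in> Kprin x \<cdot> A" using xc LD.R_carrier[OF a] by (simp add: m_comm)
  qed
qed

lemma extend_one: "B \<cdot> A = A"
  using extend_prin[of \<one>] KD.prin_one LD.prin_one subringE(3)[OF K_sub(1)] by simp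

text \<open>The map is taken on ideals, where it is plainly a homomorphism;
  \<open>class_extension_cl\<close> shows that it computes the map on classes.\<close>

definition ext :: "'a set \<Rightarrow> 'a set set" where "ext I = LD.cl (I \<cdot> A)"

lemma ext_mult:
  assumes "KD.fracid I" "KD.fracid J" shows "ext (I \<cdot> J) = ext I \<otimes>\<^bsub>LD.CG\<^esub> ext J"
  unfolding ext_def extend_mult[OF assms]
  by (rule LD.cl_mult[symmetric]) (intro extend_fracid assms)+

lemma ext_prin: "x \<in> K \<Longrightarrow> x \<noteq> \<zero> \<Longrightarrow> ext (Kprin x) = \<one>\<^bsub>LD.CG\<^esub>"
  unfolding ext_def using extend_prin LD.cl_prin[of x] K_sub(2) by auto

lemma ext_closed: "KD.fracid I \<Longrightarrow> ext I \<in> carrier LD.CG"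
  unfolding ext_def LD.CG_carrier using extend_fracid by blast

sublocale CL: comm_group LD.CG
  by (rule LD.CG_comm_group)

lemma ext_hom: "ext \<in> hom KD.FI LD.CG"
  by (rule homI) (simp_all add: ext_closed ext_mult)

lemma ext_prin_mult:
  assumes "KD.fracid I" "x \<in> K" "x \<noteq> \<zero>" shows "ext (Kprin x \<cdot> I) = ext I"
  using ext_mult[OF KD.fracid_principal[OF assms(2,3)] assms(1)] ext_prin[OF assms(2,3)]
    CL.l_one[OF ext_closed[OF assms(1)]] by simp

text \<open>Changing \<open>I\<close> by a principal ideal of \<open>K\<close> changes its extension
  by a principal ideal of \<open>L\<close>, so the set under \<open>the_elem\<close> is indeed a
  singleton.\<close>

lemma class_extension_cl:
  assumes I: "KD.fracid I" shows "class_extension L (KD.cl I) = ext I"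
proof -
  have LC: "ideal_class L = LD.cl" by (rule LD.class_group_eq[OF refl])
  have "(\<lambda>I. ideal_class L (extend_ideal L I)) ` KD.cl I = {ext I}"
  proof
    show "(\<lambda>I. ideal_class L (extend_ideal L I)) ` KD.cl I \<subseteq> {ext I}"
    proof clarify
      fix J assume "J \<in> KD.cl I"
      then obtain x where x: "x \<in> K" "x \<noteq> \<zero>" "J = Kprin x \<cdot> I"
        unfolding KD.cl_def r_coset_def KD.PR_def by auto
      have "ideal_class L (extend_ideal L J) = ext J" unfolding LC extend_ideal_def ext_def ..
      also have "\<dots> = ext I" unfolding x(3) by (rule ext_prin_mult[OF I x(1,2)])
      finally show "ideal_class L (extend_ideal L J) = ext I" .
    qed
    moreover have "I \<in> KD.cl I"
      unfolding KD.cl_def using KD.FI.rcos_self[OF _ KD.PR_subgroup, of I] I by simp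
    ultimately show "{ext I} \<subseteq> (\<lambda>I. ideal_class L (extend_ideal L I)) ` KD.cl I" by blast
  qed
  then show ?thesis unfolding class_extension_def by simp
qed

lemma class_extension_image:
  "class_extension L ` carrier (class_group (L\<lparr>carrier := K\<rparr>)) = ext ` {I. KD.fracid I}"
proof -
  have "class_group (L\<lparr>carrier := K\<rparr>) = KD.CG" by (rule KD.class_group_eq[OF refl])
  then show ?thesis using class_extension_cl by (simp add: KD.CG_carrier image_image)
qed

definition gens_nr :: "'a set set set" where
  "gens_nr = {LD.cl (ostrowski_ideal L K P f) | P f. KD.maxi P \<and> f \<ge> 1 \<and> unramified L K P}"

lemma Po_nr_eq: "relative_Polya_group_nr L K = generate LD.CG gens_nr"
proof -
  have "class_group L = LD.CG" "ideal_class L = LD.cl" by (rule LD.class_group_eq[OF refl])+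
  then show ?thesis unfolding relative_Polya_group_nr_def gens_nr_def K_maximal by simp
qed

lemma fiprod_above_fracid: "KD.maxi P \<Longrightarrow> LD.fracid (LD.fiprod (above P))"
  using LD.int_ideal_fracid LD.fiprod_int[OF finite_above, of P] unfolding above_def by blast

lemma ostrowski_fracid: "KD.maxi P \<Longrightarrow> f \<ge> 1 \<Longrightarrow> LD.fracid (ostrowski_ideal L K P f)"
  using ostrowski_cases[of P f] fiprod_above_fracid[of P] LD.fracid_R by auto

lemma gens_nr_closed: "gens_nr \<subseteq> carrier LD.CG"
  unfolding gens_nr_def LD.CG_carrier using ostrowski_fracid by blast

lemma ext_prime_in_Po_nr:
  assumes P: "KD.maxi P" "unramified L K P" shows "ext P \<in> gens_nr"
proof -
  obtain f where "f \<ge> 1" "ostrowski_ideal L K P f = LD.fiprod (above P)"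
    using ostrowski_attained[OF P(1)] by blast
  then have "ext P = LD.cl (ostrowski_ideal L K P f)"
    unfolding ext_def using unramified_product[OF P] by simp
  then show ?thesis unfolding gens_nr_def using P \<open>f \<ge> 1\<close> by blast
qed

text \<open>Up to a principal factor from \<open>K\<close>, which \<open>ext\<close> ignores,
  \<open>I\<close> is integral and contained in no ramified prime. All its prime factors are then
  unramified, and each contributes a generator.\<close>

lemma ext_in_Po_nr:
  assumes I: "KD.fracid I" shows "ext I \<in> generate LD.CG gens_nr"
proof -
  let ?T = "{P. KD.maxi P \<and> \<not> unramified L K P}"
  have "\<exists>x\<in>K. x \<noteq> \<zero> \<and> KD.int_ideal (Kprin x \<cdot> I) \<and> (\<forall>P\<in>?T. \<not> Kprin x \<cdot> I \<subseteq> P)"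
    by (rule KD.coprime_representative[OF I finite_ramified]) simp
  then obtain x where x: "x \<in> K" "x \<noteq> \<zero>" "KD.int_ideal (Kprin x \<cdot> I)" "\<forall>P\<in>?T. \<not> Kprin x \<cdot> I \<subseteq> P"
    by (elim bexE conjE)
  let ?J = "Kprin x \<cdot> I"
  have J: "KD.fracid ?J" using KD.fracid_prod[OF KD.fracid_principal[OF x(1,2)] I] .
  then have "?J \<noteq> {\<zero>}" unfolding KD.fracid_def by blast
  \<comment> \<open>The avoidance condition is part of the induction claim: it passes from a product
    to both factors, because each of them contains the product.\<close>
  with x(3) have "(\<forall>P\<in>?T. \<not> ?J \<subseteq> P) \<longrightarrow> ext ?J \<in> generate LD.CG gens_nr"
  proof (induct rule: KD.int_ideal_induct)
    case R
    have "ext B = \<one>\<^bsub>LD.CG\<^esub>" unfolding ext_def extend_one by (rule LD.cl_one)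
    then show ?case using generate.one[of LD.CG gens_nr] by simp
  next
    case (prod M J)
    show ?case
    proof
      assume *: "\<forall>P\<in>?T. \<not> M \<cdot> J \<subseteq> P"
      have s: "KD.submod M" "KD.submod J" using KD.maxi_submod[OF prod(1)] KD.int_ideal_submod[OF prod(2)] .
      have MJ: "M \<cdot> J \<subseteq> J" "M \<cdot> J \<subseteq> M"
        using KD.prod_int_left[OF KD.maxi_int[OF prod(1)] s(2)] KD.prod_int_left[OF prod(2) s(1)]
          KD.prod_comm[OF KD.submod_subset[OF s(1)] KD.submod_subset[OF s(2)]] by auto
      have "ext J \<in> generate LD.CG gens_nr" using * MJ(1) prod(4) by blast
      moreover have "unramified L K M" using * MJ(2) prod(1) by blast
      then have "ext M \<in> generate LD.CG gens_nr"
        using ext_prime_in_Po_nr[OF prod(1)] generate.incl[of "ext M" gens_nr LD.CG] by blast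
      ultimately show "ext (M \<cdot> J) \<in> generate LD.CG gens_nr"
        using ext_mult[OF KD.maxi_fracid[OF prod(1)] KD.int_ideal_fracid[OF prod(2,3)]]
          generate.eng[of "ext M" LD.CG gens_nr "ext J"] by simp
    qed
  qed
  then show ?thesis using x(4) ext_prin_mult[OF I x(1,2)] by simp
qed

lemma ext_image_subgroup: "subgroup (ext ` {I. KD.fracid I}) LD.CG"
proof -
  interpret h: group_hom KD.FI LD.CG ext
    by (intro group_hom.intro group_hom_axioms.intro KD.FI.is_group CL.is_group ext_hom)
  show ?thesis using h.img_is_subgroup by simp
qed

text \<open>By \<open>ostrowski_cases\<close> and \<open>unramified_product\<close>, each generator
  is the class of the unit ideal or of some \<open>P \<cdot> A\<close>, hence an extended class;
  \<open>ext_in_Po_nr\<close> gives the converse.\<close>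

lemma Po_nr_eq_ext: "generate LD.CG gens_nr = ext ` {I. KD.fracid I}"
proof
  show "ext ` {I. KD.fracid I} \<subseteq> generate LD.CG gens_nr" using ext_in_Po_nr by blast
  have "gens_nr \<subseteq> ext ` {I. KD.fracid I}"
  proof
    fix c assume "c \<in> gens_nr"
    then obtain P f where Pf: "KD.maxi P" "f \<ge> 1" "unramified L K P" "c = LD.cl (ostrowski_ideal L K P f)"
      unfolding gens_nr_def by blast
    have "c = ext B \<or> c = ext P"
      using ostrowski_cases[OF Pf(1,2)] Pf(4) unramified_product[OF Pf(1,3)] unfolding ext_def extend_one by auto
    then show "c \<in> ext ` {I. KD.fracid I}" using KD.fracid_R KD.maxi_fracid[OF Pf(1)] by blast
  qed
  then show "generate LD.CG gens_nr \<subseteq> ext ` {I. KD.fracid I}"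
    by (rule CL.generate_subgroup_incl[OF _ ext_image_subgroup])
qed

text \<open>The inclusion is read inside the quotient group. As
  \<open>relative_Polya_group_nr L K\<close> lies in \<open>relative_Polya_group L K\<close> and
  equals the image of \<open>ext\<close>, intersecting with that image returns it. Both quotients
  are therefore the same group, and the carrier in question is the whole of it.\<close>

lemma Ostrowski_quotient_subgroup:
  "subgroup (carrier (Ostrowski_quotient L K))
    ((class_group L)\<lparr>carrier := relative_Polya_group L K\<rparr> Mod relative_Polya_group_nr L K)"
proof -
  have CGe: "class_group L = LD.CG" "ideal_class L = LD.cl" by (rule LD.class_group_eq[OF refl])+
  let ?Po = "relative_Polya_group L K" and ?N = "generate LD.CG gens_nr"
  define gens where "gens = {LD.cl (ostrowski_ideal L K P f) | P f. KD.maxi P \<and> f \<ge> 1}"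
  have Po: "?Po = generate LD.CG gens"
    unfolding relative_Polya_group_def gens_def K_maximal CGe ..
  have gens: "gens \<subseteq> carrier LD.CG"
    unfolding gens_def LD.CG_carrier using ostrowski_fracid by blast
  have "gens_nr \<subseteq> gens" unfolding gens_def gens_nr_def by blast
  then have NPo: "?N \<subseteq> ?Po" unfolding Po by (rule CL.mono_generate)
  have sPo: "subgroup ?Po LD.CG" unfolding Po by (rule CL.generate_is_subgroup[OF gens])
  have sN: "subgroup ?N LD.CG" by (rule CL.generate_is_subgroup[OF gens_nr_closed])
  let ?G = "LD.CG\<lparr>carrier := ?Po\<rparr>"
  have "subgroup ?N ?G" by (rule CL.subgroup_incl[OF sN sPo NPo])
  moreover have "comm_group ?G"
  proof (rule group.group_comm_groupI)
    show "group ?G" by (rule subgroup.subgroup_is_group[OF sPo CL.is_group])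
    show "x \<otimes>\<^bsub>?G\<^esub> y = y \<otimes>\<^bsub>?G\<^esub> x" if "x \<in> carrier ?G" "y \<in> carrier ?G" for x y
      using CL.m_comm[of x y] that subgroup.subset[OF sPo] by auto
  qed
  ultimately have "?N \<lhd> ?G" using comm_group.normal_iff_subgroup[of ?G ?N] by blast
  then have grp: "group (?G Mod ?N)" by (rule normal.factorgroup_is_group)
  have "?Po \<inter> ext ` {I. KD.fracid I} = ?N" using NPo Po_nr_eq_ext by blast
  then have "Ostrowski_quotient L K = ?G Mod ?N"
    unfolding Ostrowski_quotient_def class_extension_image CGe by simp
  then show ?thesis unfolding Po_nr_eq CGe using group.subgroup_self[OF grp] by simp
qed

end

theorem theorem4p4:
  fixes L :: "('a, 'b) ring_scheme" and K :: "'a set"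
  assumes "number_field L"
    and "subfield K L"
    and "number_field (L\<lparr>carrier := K\<rparr>)"
    and "finite_galois_extension L K"
  shows "subgroup (carrier (Ostrowski_quotient L K))
           ((class_group L)\<lparr>carrier := relative_Polya_group L K\<rparr> Mod relative_Polya_group_nr L K)"
proof -
  interpret galois_ext L K
    by (intro galois_ext.intro galois_ext_axioms.intro number_field_num_field assms)
  show ?thesis by (rule Ostrowski_quotient_subgroup)
qed

end
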